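(* Let $\Phi:(0,\infty)\to\mathbb{C}$ be twice continuously differentiable with $$\sup_{0<t<\infty}\big(|\Phi(t)|+t|\Phi'(t)|\big)+\sup_{0<t\le 1}|t^2\Phi''(t)|<\infty.$$ For all sufficiently small $\delta,\delta'>0$ and all large enough $\kappa\ge1$ the following hold, with constants $C$ independent of the polynomial $f$ on $\mathbb{R}^n$ with $\int_{\mathbb{R}^n}f\,d\gamma=0$. (i) If $\int_1^\infty(|\Phi'(t)|+t|\Phi''(t)|)\,dt<\infty$, then $$\|\pi_3f\|_1\le C\,\|(1+\log_+|\cdot|)\,f\|_1.$$ (ii) If there exist an integer $N$ and a constant $C_0$ such that $|\Phi'(t)|+t|\Phi''(t)|\le C_0\,t^N$ for all $t\ge1$, then for $1<p\le2$ $$\|\pi_3f\|_p\le C\,\|f\|_p.$$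
   Context: Work on $\mathbb{R}^n$ with the Gaussian measure $d\gamma(x)=\pi^{-n/2}e^{-|x|^2}\,dx$; $\|\cdot\|_p$ is the norm of $L^p(\gamma)$; $\log_+r=\max(\log r,0)$. The Ornstein--Uhlenbeck operator is $L=-\frac12\Delta+x\cdot\nabla$, realized as a non-negative self-adjoint operator on $L^2(\gamma)$ with spectrum $\{0,1,2,\dots\}$ and the Hermite polynomials as eigenfunctions. The semigroup is $e^{-tL}f(x)=\int_{\mathbb{R}^n}M_t(x,y)f(y)\,d\gamma(y)$, $t>0$, with Mehler kernel $$M_t(x,y)=\frac{1}{(1-e^{-2t})^{n/2}}\exp\Big(-\frac{e^{-t}}{1-e^{-2t}}|x-y|^2\Big)\exp\Big(\frac{e^{-t}}{1+e^{-t}}(|x|^2+|y|^2)\Big).$$ Discretized admissibility function: $\widetilde m(x)=1$ if $|x|<1$, and $\widetilde m(x)=2^{-k}$ if $2^{k-1}\le|x|<2^k$, $k\ge1$. For $\delta,\delta'>0$ and $\kappa\ge1$ put $\widetilde\Phi(t)=\Phi((\delta'+\delta)t)$, and for a polynomial $f$ with $\int f\,d\gamma=0$ define $$\pi_3f=\int_{\widetilde m(\cdot)/\kappa}^\infty\widetilde\Phi(t^2)\,(t^2L)^2e^{-(\delta'+\delta)t^2L}f\,\frac{dt}{t},$$ where the value at $x$ uses the lower limit $\widetilde m(x)/\kappa$. The phrase "for all sufficiently small $\delta,\delta'>0$ and all large enough $\kappa$" means: there is $\delta_0>0$ such that for all $0<\delta,\delta'\le\delta_0$ there is $\kappa_0\ge1$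 such that the assertion holds for all $\kappa\ge\kappa_0$. The constants $C$ may depend on $n,p,\Phi,\delta,\delta',\kappa$. *)

theory Defs
  imports "HOL-Analysis.Analysis"
begin

definition gaussian :: "(real ^ 'n) measure" where
  "gaussian = density lborel
     (\<lambda>x. ennreal (pi powr (- real CARD('n) / 2) * exp (- (norm x)\<^sup>2)))"

text \<open>The value is \<open>\<infinity>\<close> for functions outside \<open>L\<^sup>p\<close>, so that an inequality
  \<open>gaussian_Lp p g \<le> ennreal C\<close> includes the membership of \<open>g\<close> in \<open>L\<^sup>p\<close>.\<close>

definition gaussian_Lp :: "real \<Rightarrow> (real ^ 'n \<Rightarrow> complex) \<Rightarrow> ennreal" where
  "gaussian_Lp p g =
     (if g \<in> borel_measurable gaussian \<and> integrable gaussian (\<lambda>x. norm (g x) powr p)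
      then ennreal ((LINT x|gaussian. norm (g x) powr p) powr (1 / p))
      else \<infinity>)"

text \<open>As \<open>ln 0 = 0\<close>, the value at \<open>0\<close> is \<open>0\<close>, in accordance with \<open>log 0 = -\<infinity>\<close>.\<close>

definition log_plus :: "real \<Rightarrow> real" where
  "log_plus r = max (ln r) 0"

definition partial_deriv :: "'n \<Rightarrow> (real ^ 'n \<Rightarrow> complex) \<Rightarrow> real ^ 'n \<Rightarrow> complex" where
  "partial_deriv i f x = frechet_derivative f (at x) (axis i 1)"

text \<open>\<open>L = -\<Delta>/2 + x \<cdot> \<nabla>\<close> as a differential expression. It is applied to polynomials only
  (the semigroup maps polynomials to polynomials); these lie in the domain of the self-adjoint
  realization, which acts on them by this expression.\<close>

definition OU :: "(real ^ 'n \<Rightarrow> complex) \<Rightarrow> real ^ 'n \<Rightarrow> complex" where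
  "OU f x = - (1 / 2) * (\<Sum>i\<in>UNIV. partial_deriv i (partial_deriv i f) x)
            + (\<Sum>i\<in>UNIV. of_real (x $ i) * partial_deriv i f x)"

definition mehler :: "real \<Rightarrow> real ^ 'n \<Rightarrow> real ^ 'n \<Rightarrow> real" where
  "mehler t x y =
     1 / (1 - exp (- 2 * t)) powr (real CARD('n) / 2)
     * exp (- (exp (- t) / (1 - exp (- 2 * t))) * (norm (x - y))\<^sup>2)
     * exp (exp (- t) / (1 + exp (- t)) * ((norm x)\<^sup>2 + (norm y)\<^sup>2))"

definition OU_semigroup :: "real \<Rightarrow> (real ^ 'n \<Rightarrow> complex) \<Rightarrow> real ^ 'n \<Rightarrow> complex" where
  "OU_semigroup t f x = (LINT y|gaussian. of_real (mehler t x y) * f y)"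

definition m_tilde :: "real ^ 'n \<Rightarrow> real" where
  "m_tilde x =
     (if norm x < 1 then 1
      else 1 / 2 ^ (THE k::nat. 1 \<le> k \<and> 2 ^ (k - 1) \<le> norm x \<and> norm x < 2 ^ k))"

definition pi3 ::
  "(real \<Rightarrow> complex) \<Rightarrow> real \<Rightarrow> real \<Rightarrow> real \<Rightarrow> (real ^ 'n \<Rightarrow> complex) \<Rightarrow> real ^ 'n \<Rightarrow> complex" where
  "pi3 \<Phi> \<delta> \<delta>' \<kappa> f x =
     (LINT t:{m_tilde x / \<kappa>..}|lborel.
        \<Phi> ((\<delta>' + \<delta>) * t\<^sup>2)
        * ((\<lambda>g y. of_real (t\<^sup>2) * OU g y) ^^ 2) (OU_semigroup ((\<delta>' + \<delta>) * t\<^sup>2) f) x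
        / of_real t)"

text \<open>\<open>polynomial_function f\<close> for complex-valued \<open>f\<close> says that the real and imaginary parts
  of \<open>f\<close> are real polynomials, i.e. that \<open>f\<close> is a polynomial with complex coefficients.\<close>

definition mean_zero_polynomial :: "(real ^ 'n \<Rightarrow> complex) \<Rightarrow> bool" where
  "mean_zero_polynomial f \<longleftrightarrow> polynomial_function f \<and> (LINT x|gaussian. f x) = 0"

end

theory Submission
  imports Defs "HOL-Probability.Distributions" "HOL-Real_Asymp.Real_Asymp"
begin

text \<open>With \<open>a = \<delta>' + \<delta>\<close> and \<open>s = at\<^sup>2\<close>, the function \<open>\<pi>\<^sub>3f\<close> is, up to a constant, the integral of
  \<open>s \<Phi>(s) u''(s)\<close> over \<open>s > s\<^sub>0(x)\<close>, where \<open>u(s) = e\<^bsup>-sL\<^esup>f(x)\<close>. Integrating by parts twice leaves the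
  boundary terms \<open>s\<^sub>0u'(s\<^sub>0)\<close>, \<open>u(s\<^sub>0)\<close> and the integral of \<open>(s\<Phi>(s))'' u(s)\<close>. As
  \<open>s\<^sub>0\<bar>x\<bar>\<^sup>2\<close> is bounded, a Harnack inequality for the Mehler kernel bounds the boundary terms by averages of
  \<open>e\<^bsup>-sL\<^esup>\<bar>f\<bar>\<close> over \<open>2s\<^sub>0 \<le> s \<le> 4s\<^sub>0\<close>. So everything but large times is dominated by the positive kernel
  \<open>K(x,y) = \<integral> M\<^sub>s(x,y) ds/s\<close>, \<open>s\<^sub>0(x) \<le> s \<le> S\<close>. Its column integrals are \<open>O(1 + log\<^sub>+\<bar>y\<bar>)\<close>, which is the
  \<open>L\<^sup>1\<close> estimate. For \<open>p > 1\<close> Schur's test applies with Gaussian weights, because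
  \<open>e\<^bsup>-sL\<^esup>e\<^bsup>\<alpha>\<bar>\<cdot>\<bar>\<^sup>2\<^esup>(x)\<close> decays like \<open>e\<^bsup>\<alpha>\<bar>x\<bar>\<^sup>2 - cs\<bar>x\<bar>\<^sup>2\<^esup>\<close> and hence the logarithm disappears. At large times
  \<open>f\<close> has mean zero and \<open>\<bar>M\<^sub>s(x,y) - 1\<bar> \<le> C e\<^bsup>-s\<^esup>e\<^bsup>\<epsilon>(\<bar>x\<bar>\<^sup>2 + \<bar>y\<bar>\<^sup>2)\<^esup>\<close>.\<close>

section \<open>Polynomials and the Ornstein--Uhlenbeck operator\<close>

text \<open>In \<open>pi3\<close> the operator \<open>OU\<close> acts in space. For a polynomial f,
  e^{-sL}f is a finite sum of e^{-ks} g_k with g_k an eigenfunction of \<open>OU\<close> for k, so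
  (t^2 L)^2 turns into t^4 times a second derivative in time. The expansion also settles all
  convergence questions for a single f, but the constants must not depend on it; hence the kernel
  estimates. Integration by parts is forced by the kernel of (sL)^2 e^{-sL}: the motion of the
  centre e^{-s}x costs factors of size sqrt(s)|x|, so no uniform domination by M_s is available.
  With both derivatives on the multiplier only M_s itself remains at interior times, and its time
  derivative enters only at s_0, where s_0|x|^2 is small. The weight (s \<Phi>(s))'' is O(1/s) on
  bounded intervals, which produces the measure ds/s. The two hypotheses enter at large times. In
  (i) the weight is integrable and contractivity on L^1 suffices. In (ii) it may grow like a power,
  and the factor e^{-s} gained from the mean zero condition makes the integral converge.\<close>

inductive poly_fn :: "(real ^ 'n \<Rightarrow> complex) \<Rightarrow> bool" where
  const: "poly_fn (\<lambda>_. c)"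
| coord: "poly_fn g \<Longrightarrow> poly_fn (\<lambda>x. of_real (x $ i) * g x)"
| add: "poly_fn g \<Longrightarrow> poly_fn h \<Longrightarrow> poly_fn (\<lambda>x. g x + h x)"

lemma poly_fn_cmult: "poly_fn g \<Longrightarrow> poly_fn (\<lambda>x. c * g x)"
proof (induction rule: poly_fn.induct)
  case (const d)
  then show ?case by (rule poly_fn.const)
next
  case (coord g i)
  have "(\<lambda>x. c * (of_real (x $ i) * g x)) = (\<lambda>x. of_real (x $ i) * (c * g x))"
    by (simp add: fun_eq_iff)
  then show ?case using poly_fn.coord[OF coord.IH, of i] by simp
next
  case (add g h)
  then show ?case by (simp add: distrib_left poly_fn.add)
qed

lemma poly_fn_mult: "poly_fn g \<Longrightarrow> poly_fn h \<Longrightarrow> poly_fn (\<lambda>x. g x * h x)"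
proof (induction rule: poly_fn.induct)
  case (const d)
  then show ?case by (rule poly_fn_cmult)
next
  case (coord g i)
  then show ?case using poly_fn.coord[of "\<lambda>x. g x * h x" i] by (simp add: mult.assoc)
next
  case (add g1 g2)
  then show ?case by (simp add: distrib_right poly_fn.add)
qed

lemma poly_fn_sum: "(\<And>i. i \<in> A \<Longrightarrow> poly_fn (g i)) \<Longrightarrow> poly_fn (\<lambda>x. \<Sum>i\<in>A. g i x)"
  by (induction A rule: infinite_finite_induct) (auto intro: poly_fn.intros)

lemma poly_fn_diff: "poly_fn g \<Longrightarrow> poly_fn h \<Longrightarrow> poly_fn (\<lambda>x. g x - h x)"
  using poly_fn.add[of g "\<lambda>x. (-1) * h x"] poly_fn_cmult[of h "-1"] by simp

text \<open>A linear functional is a combination of coordinates, so every generator of the real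
  polynomials is reached although \<open>poly_fn\<close> multiplies by one coordinate at a time.
  That restriction pays off in the inductions below: they only have to know what multiplication by
  x_i does to derivatives and to the semigroup.\<close>

lemma poly_fn_of_real_polynomial:
  "real_polynomial_function g \<Longrightarrow> poly_fn (\<lambda>x. of_real (g x))"
proof (induction rule: real_polynomial_function.induct)
  case (linear f)
  have fx: "f x = (\<Sum>i\<in>UNIV. x $ i * f (axis i 1))" for x
  proof -
    have "f x = f (\<Sum>i\<in>UNIV. (x $ i) *\<^sub>R axis i 1)"
      unfolding scalar_mult_eq_scaleR[symmetric] basis_expansion ..
    also have "\<dots> = (\<Sum>i\<in>UNIV. x $ i * f (axis i 1))"
      unfolding linear_sum[OF bounded_linear.linear[OF linear]]
      by (simp add: linear_cmul[OF bounded_linear.linear[OF linear]])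
    finally show ?thesis .
  qed
  have eq: "(\<lambda>x. complex_of_real (f x)) = (\<lambda>x. \<Sum>i\<in>UNIV. of_real (x $ i) * of_real (f (axis i 1)))"
    by (rule ext, subst fx) simp
  show ?case
    unfolding eq by (intro poly_fn_sum poly_fn.coord poly_fn.const)
next
  case (const c)
  then show ?case by (rule poly_fn.const)
next
  case (add f g)
  then show ?case by (simp add: poly_fn.add)
next
  case (mult f g)
  then show ?case by (simp add: poly_fn_mult)
qed

lemma poly_fn_of_polynomial_function:
  fixes f :: "real ^ 'n \<Rightarrow> complex"
  assumes "polynomial_function f"
  shows "poly_fn f"
proof -
  have "real_polynomial_function (Re \<circ> f)" "real_polynomial_function (Im \<circ> f)"
    using assms bounded_linear_Re bounded_linear_Im by (auto simp: polynomial_function_def)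
  from this[THEN poly_fn_of_real_polynomial]
  have "poly_fn (\<lambda>x. of_real (Re (f x)))" "poly_fn (\<lambda>x. of_real (Im (f x)))"
    by (simp_all add: o_def)
  then have "poly_fn (\<lambda>x. of_real (Re (f x)) + \<i> * of_real (Im (f x)))"
    by (intro poly_fn.add poly_fn_cmult)
  then show ?thesis
    by (simp flip: complex_eq)
qed

lemma poly_fn_differentiable: "poly_fn f \<Longrightarrow> f differentiable (at x)"
proof (induction rule: poly_fn.induct)
  case (coord g i)
  have "(\<lambda>x. complex_of_real (x $ i)) differentiable (at x)"
    by (intro bounded_linear_imp_differentiable bounded_linear_compose[OF bounded_linear_of_real] bounded_linear_vec_nth)
  then show ?case using coord by (intro derivative_intros)
qed (auto intro!: derivative_intros)

lemma poly_fn_has_derivative: "poly_fn f \<Longrightarrow> (f has_derivative frechet_derivative f (at x)) (at x)"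
  using poly_fn_differentiable frechet_derivative_works by blast

lemma poly_fn_continuous: "poly_fn f \<Longrightarrow> continuous_on A f"
  by (meson continuous_at_imp_continuous_on differentiable_imp_continuous_within poly_fn_differentiable)

lemma poly_fn_measurable: "poly_fn f \<Longrightarrow> f \<in> borel_measurable borel"
  by (intro borel_measurable_continuous_onI poly_fn_continuous)

lemma partial_deriv_eqI: "(f has_derivative D) (at x) \<Longrightarrow> partial_deriv i f x = D (axis i 1)"
  unfolding partial_deriv_def using frechet_derivative_at by metis

lemma partial_deriv_const [simp]: "partial_deriv i (\<lambda>_. c) = (\<lambda>_. 0)"
  by (rule ext, subst partial_deriv_eqI[where D="\<lambda>_. 0"]) auto

lemma partial_deriv_add:
  "poly_fn f \<Longrightarrow> poly_fn g \<Longrightarrow> partial_deriv i (\<lambda>x. f x + g x) = (\<lambda>x. partial_deriv i f x + partial_deriv i g x)"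
  by (rule ext, subst partial_deriv_eqI[OF has_derivative_add[OF poly_fn_has_derivative poly_fn_has_derivative]])
    (auto simp: partial_deriv_def)

lemma partial_deriv_cmult:
  "poly_fn f \<Longrightarrow> partial_deriv i (\<lambda>x. c * f x) = (\<lambda>x. c * partial_deriv i f x)"
  by (rule ext, subst partial_deriv_eqI[OF has_derivative_mult_right[OF poly_fn_has_derivative]])
    (auto simp: partial_deriv_def)

lemma partial_deriv_diff:
  "poly_fn f \<Longrightarrow> poly_fn g \<Longrightarrow> partial_deriv i (\<lambda>x. f x - g x) = (\<lambda>x. partial_deriv i f x - partial_deriv i g x)"
  by (rule ext, subst partial_deriv_eqI[OF has_derivative_diff[OF poly_fn_has_derivative poly_fn_has_derivative]])
    (auto simp: partial_deriv_def)

lemma partial_deriv_coord: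
  assumes "poly_fn f"
  shows "partial_deriv i (\<lambda>x. of_real (x $ j) * f x)
    = (\<lambda>x. of_real (x $ j) * partial_deriv i f x + (if i = j then f x else 0))"
proof
  fix x
  have "((\<lambda>x. complex_of_real (x $ j)) has_derivative (\<lambda>h. of_real (h $ j))) (at x)"
    by (intro bounded_linear_imp_has_derivative bounded_linear_compose[OF bounded_linear_of_real] bounded_linear_vec_nth)
  from partial_deriv_eqI[OF has_derivative_mult[OF this poly_fn_has_derivative[OF assms]], of i]
  show "partial_deriv i (\<lambda>x. of_real (x $ j) * f x) x
      = of_real (x $ j) * partial_deriv i f x + (if i = j then f x else 0)"
    by (auto simp: partial_deriv_def axis_def)
qed

lemma poly_fn_partial_deriv: "poly_fn f \<Longrightarrow> poly_fn (partial_deriv i f)"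
proof (induction rule: poly_fn.induct)
  case (coord g j)
  then show ?case
    by (cases "i = j") (auto simp: partial_deriv_coord intro: poly_fn.intros)
qed (auto simp: partial_deriv_add intro: poly_fn.intros)

text \<open>For x_k g either order of differentiation yields x_k times the mixed derivative of g
  plus two Kronecker terms, an expression symmetric in i and j.\<close>

lemma partial_deriv_commute:
  "poly_fn f \<Longrightarrow> partial_deriv i (partial_deriv j f) = partial_deriv j (partial_deriv i f)"
proof (induction rule: poly_fn.induct)
  case (coord g k)
  note p = coord.hyps poly_fn_partial_deriv[OF coord.hyps] poly_fn.coord
  have "partial_deriv i (partial_deriv j (\<lambda>x. of_real (x $ k) * g x)) x
     = of_real (x $ k) * partial_deriv i (partial_deriv j g) x
       + (if i = k then partial_deriv j g x else 0) + (if j = k then partial_deriv i g x else 0)" for i j x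
    by (cases "j = k") (simp_all add: partial_deriv_coord partial_deriv_add p)
  then show ?case
    unfolding fun_eq_iff coord.IH[THEN fun_cong] by (simp add: coord.IH[THEN fun_cong])
qed (simp_all add: partial_deriv_add poly_fn_partial_deriv)

lemma OU_cmult: "poly_fn f \<Longrightarrow> OU (\<lambda>x. c * f x) = (\<lambda>x. c * OU f x)"
  by (simp add: OU_def fun_eq_iff partial_deriv_cmult poly_fn_partial_deriv sum_distrib_left algebra_simps)

lemma OU_add: "poly_fn f \<Longrightarrow> poly_fn g \<Longrightarrow> OU (\<lambda>x. f x + g x) = (\<lambda>x. OU f x + OU g x)"
  by (simp add: OU_def fun_eq_iff partial_deriv_add poly_fn_partial_deriv sum.distrib algebra_simps)

lemma OU_diff: "poly_fn f \<Longrightarrow> poly_fn g \<Longrightarrow> OU (\<lambda>x. f x - g x) = (\<lambda>x. OU f x - OU g x)"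
  by (simp add: OU_def fun_eq_iff partial_deriv_diff poly_fn_partial_deriv sum_subtractf algebra_simps)

lemma OU_const [simp]: "OU (\<lambda>_. c) = (\<lambda>_. 0)"
  by (simp add: OU_def fun_eq_iff)

lemma OU_sum:
  assumes "\<And>k. k \<in> A \<Longrightarrow> poly_fn (g k)"
  shows "OU (\<lambda>x. \<Sum>k\<in>A. g k x) = (\<lambda>x. \<Sum>k\<in>A. OU (g k) x)"
  using assms by (induction A rule: infinite_finite_induct) (auto simp: OU_add poly_fn_sum)

text \<open>This is the commutator of \<open>OU\<close> with multiplication by x_i: the drift
  contributes x_i, the cross term of the Laplacian contributes the derivative. It is what makes the
  raising operators shift eigenvalues by one.\<close>

lemma OU_coord:
  assumes "poly_fn f"
  shows "OU (\<lambda>x. of_real (x $ i) * f x)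
    = (\<lambda>x. of_real (x $ i) * OU f x + of_real (x $ i) * f x - partial_deriv i f x)"
proof
  fix x
  have 1: "partial_deriv k (\<lambda>x. of_real (x $ i) * f x) x
      = of_real (x $ i) * partial_deriv k f x + (if k = i then f x else 0)" for k x
    by (simp add: partial_deriv_coord assms)
  have 2: "partial_deriv k (partial_deriv k (\<lambda>x. of_real (x $ i) * f x)) x
      = of_real (x $ i) * partial_deriv k (partial_deriv k f) x + (if k = i then 2 * partial_deriv i f x else 0)" for k
    by (cases "k = i")
      (simp_all add: partial_deriv_coord partial_deriv_add assms poly_fn_partial_deriv poly_fn.coord)
  show "OU (\<lambda>x. of_real (x $ i) * f x) x
    = of_real (x $ i) * OU f x + of_real (x $ i) * f x - partial_deriv i f x"
    unfolding OU_def 1 2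
    by (simp add: sum.distrib distrib_left sum_distrib_left if_distrib[of "\<lambda>z. _ * z"] sum.delta algebra_simps cong: if_cong)
qed

text \<open>Generalized Hermite polynomials: the eigenspaces of \<open>OU\<close> in the polynomials, generated from
  the constants by the raising operators \<open>x\<^sub>i - \<partial>\<^sub>i / 2\<close>.\<close>

inductive herm :: "nat \<Rightarrow> (real ^ 'n \<Rightarrow> complex) \<Rightarrow> bool" where
  const: "herm 0 (\<lambda>_. c)"
| raise: "herm k g \<Longrightarrow> herm (Suc k) (\<lambda>x. of_real (x $ i) * g x - partial_deriv i g x / 2)"
| zero: "herm k (\<lambda>_. 0)"
| add: "herm k g \<Longrightarrow> herm k h \<Longrightarrow> herm k (\<lambda>x. g x + h x)"

lemma herm_poly_fn: "herm k g \<Longrightarrow> poly_fn g"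
proof (induction rule: herm.induct)
  case (raise k g i)
  then show ?case
    using poly_fn_diff[OF poly_fn.coord[of g i] poly_fn_cmult[OF poly_fn_partial_deriv[of g i], of "1/2"]]
    by simp
qed (auto intro: poly_fn.intros)

lemma herm_cmult: "herm k g \<Longrightarrow> herm k (\<lambda>x. c * g x)"
proof (induction rule: herm.induct)
  case (raise k g i)
  then show ?case
    using herm.raise[OF raise.IH, of i]
    by (simp add: partial_deriv_cmult herm_poly_fn algebra_simps)
qed (auto simp: distrib_left intro: herm.intros)

lemma partial_deriv_half: "poly_fn f \<Longrightarrow> partial_deriv i (\<lambda>x. f x / 2) = (\<lambda>x. partial_deriv i f x / 2)"
  using partial_deriv_cmult[of f i "1/2"] by simp

lemma poly_fn_half: "poly_fn f \<Longrightarrow> poly_fn (\<lambda>x. f x / 2)"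
  using poly_fn_cmult[of f "1/2"] by simp

text \<open>Differentiation commutes with a raising operator up to a Kronecker term, hence lowers
  the degree. The clause for k = 0 is carried along because truncated subtraction leaves degree 0 at
  0, where the derivative has to vanish.\<close>

lemma herm_partial_deriv: "herm k g \<Longrightarrow> herm (k - 1) (partial_deriv j g) \<and> (k = 0 \<longrightarrow> partial_deriv j g = (\<lambda>_. 0))"
proof (induction rule: herm.induct)
  case (raise k g i)
  have p: "poly_fn g" "\<And>i. poly_fn (partial_deriv i g)"
    using herm_poly_fn[OF raise.hyps] by (auto intro: poly_fn_partial_deriv)
  have eq: "partial_deriv j (\<lambda>x. of_real (x $ i) * g x - partial_deriv i g x / 2)
     = (\<lambda>x. (of_real (x $ i) * partial_deriv j g x - partial_deriv i (partial_deriv j g) x / 2)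
         + (if j = i then g x else 0))"
    by (simp add: partial_deriv_diff partial_deriv_coord partial_deriv_half p poly_fn.coord poly_fn_half
        fun_eq_iff partial_deriv_commute[OF p(1), of j i])
  have "herm k (\<lambda>x. of_real (x $ i) * partial_deriv j g x - partial_deriv i (partial_deriv j g) x / 2)"
  proof (cases k)
    case 0
    then show ?thesis using raise.IH by (auto intro: herm.const)
  next
    case (Suc k')
    then show ?thesis using herm.raise[of "k - 1" "partial_deriv j g" i] raise.IH by auto
  qed
  moreover have "herm k (\<lambda>x. if j = i then g x else 0)"
    using raise.hyps by (cases "j = i") (auto intro: herm.zero)
  ultimately show ?case
    unfolding eq using herm.add by simp
qed (auto simp: partial_deriv_add herm_poly_fn intro: herm.intros)

text \<open>By \<open>OU_coord\<close>, L(x_i g - g_i/2) = (k+1) x_i g - g_i - (k-1) g_i/2 with g_i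
  the i-th derivative, and the last two terms add up to -(k+1) g_i/2. The eigenvalue of g_i, of
  degree k-1, is needed as well, hence strong induction on k around the rule induction.\<close>

lemma herm_OU: "herm k g \<Longrightarrow> OU g = (\<lambda>x. of_nat k * g x)"
proof (induction k arbitrary: g rule: less_induct)
  case (less k)
  from less.prems less.IH show ?case
  proof (induction rule: herm.induct)
    case (raise k g i)
    note p = herm_poly_fn[OF raise.hyps] poly_fn_partial_deriv[OF herm_poly_fn[OF raise.hyps], of i]
    have g: "OU g = (\<lambda>x. of_nat k * g x)"
      by (rule raise.prems) (use raise.hyps in auto)
    \<comment> \<open>The subtraction is in the complex numbers; for k = 0 the value -1 is harmless
      because the derivative is zero.\<close>
    have d: "OU (partial_deriv i g) = (\<lambda>x. (of_nat k - 1) * partial_deriv i g x)"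
    proof (cases k)
      case 0
      then show ?thesis using herm_partial_deriv[OF raise.hyps, of i] by simp
    next
      case (Suc k')
      then show ?thesis
        using raise.prems[of "k - 1" "partial_deriv i g"] herm_partial_deriv[OF raise.hyps, of i] by simp
    qed
    have h: "OU (\<lambda>x. partial_deriv i g x / 2) = (\<lambda>x. (of_nat k - 1) * partial_deriv i g x / 2)"
      using OU_cmult[OF p(2), of "1/2"] by (simp add: d)
    have "OU (\<lambda>x. of_real (x $ i) * g x - partial_deriv i g x / 2) x
      = of_nat (Suc k) * (of_real (x $ i) * g x - partial_deriv i g x / 2)" for x
      unfolding OU_diff[OF poly_fn.coord[OF p(1)] poly_fn_half[OF p(2)]] OU_coord[OF p(1)] g h
      by (simp add: algebra_simps diff_divide_distrib add_divide_distrib)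
    then show ?case by blast
  qed (auto simp: OU_add herm_poly_fn algebra_simps)
qed

section \<open>The Mehler kernel\<close>

lemma powr_half_card: "x > 0 \<Longrightarrow> x powr (real m / 2) = sqrt x ^ m"
  by (metis (no_types, lifting) mult.commute mult.right_neutral powr_half_sqrt powr_powr powr_realpow real_sqrt_gt_zero
      times_divide_eq_left times_divide_eq_right less_imp_le)

lemma nn_integral_exp_square_real:
  fixes A z :: real
  assumes "A > 0"
  shows "(\<integral>\<^sup>+t. ennreal (exp (- A * (t - z)\<^sup>2)) \<partial>lborel) = ennreal (sqrt (pi / A))"
proof -
  define \<sigma> where "\<sigma> = 1 / sqrt (2 * A)"
  have s: "\<sigma> > 0" "2 * \<sigma>\<^sup>2 = 1 / A" using assms by (auto simp: \<sigma>_def power_divide)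
  have "normal_density z \<sigma> t = 1 / sqrt (pi / A) * exp (- A * (t - z)\<^sup>2)" for t
  proof -
    have "2 * pi * \<sigma>\<^sup>2 = pi * (2 * \<sigma>\<^sup>2)" by simp
    also have "\<dots> = pi / A" using s by simp
    finally show ?thesis unfolding normal_density_def s(2) by simp
  qed
  then have eq: "exp (- A * (t - z)\<^sup>2) = sqrt (pi / A) * normal_density z \<sigma> t" for t
    using assms by simp
  have "(\<integral>\<^sup>+t. ennreal (exp (- A * (t - z)\<^sup>2)) \<partial>lborel)
      = ennreal (sqrt (pi / A)) * (\<integral>\<^sup>+t. ennreal (normal_density z \<sigma> t) \<partial>lborel)"
    unfolding eq using assms by (subst ennreal_mult) (auto simp: nn_integral_cmult)
  also have "(\<integral>\<^sup>+t. ennreal (normal_density z \<sigma> t) \<partial>lborel) = 1"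
    using s(1) by (subst nn_integral_eq_integral) auto
  finally show ?thesis by simp
qed

lemma nn_integral_exp_square:
  fixes z :: "real ^ 'n"
  assumes "A > 0"
  shows "(\<integral>\<^sup>+y. ennreal (exp (- A * (norm (y - z))\<^sup>2)) \<partial>lborel) = ennreal ((pi / A) powr (real CARD('n) / 2))"
proof -
  have "exp (- A * (norm (y - z))\<^sup>2) = (\<Prod>b\<in>Basis. exp (- A * (y \<bullet> b - z \<bullet> b)\<^sup>2))" for y
  proof -
    have "(norm (y - z))\<^sup>2 = (\<Sum>b\<in>Basis. (y \<bullet> b - z \<bullet> b)\<^sup>2)"
      unfolding power2_norm_eq_inner euclidean_inner[of "y - z" "y - z"]
      by (simp add: inner_diff_left power2_eq_square)
    then show ?thesis by (simp add: sum_distrib_left sum_negf flip: exp_sum)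
  qed
  then have "(\<integral>\<^sup>+y. ennreal (exp (- A * (norm (y - z))\<^sup>2)) \<partial>lborel)
     = (\<integral>\<^sup>+y. (\<Prod>b\<in>Basis. ennreal (exp (- A * (y \<bullet> b - z \<bullet> b)\<^sup>2))) \<partial>lborel)"
    by (simp add: prod_ennreal)
  also have "\<dots> = (\<Prod>b::real^'n\<in>Basis. (\<integral>\<^sup>+t. ennreal (exp (- A * (t - z \<bullet> b)\<^sup>2)) \<partial>lborel))"
    by (rule nn_integral_lborel_prod) auto
  also have "\<dots> = ennreal ((pi / A) powr (real CARD('n) / 2))"
    using assms by (simp add: nn_integral_exp_square_real[simplified] powr_half_card ennreal_power)
  finally show ?thesis .
qed

section \<open>The Gaussian measure and the transition densities\<close>

lemma sets_gaussian [simp, measurable_cong]: "sets gaussian = sets borel"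
  by (simp add: gaussian_def)

lemma space_gaussian [simp]: "space gaussian = UNIV"
  by (simp add: gaussian_def)

lemma nn_integral_gaussian:
  fixes g :: "real ^ 'n \<Rightarrow> ennreal"
  assumes [measurable]: "g \<in> borel_measurable borel"
  shows "(\<integral>\<^sup>+y. g y \<partial>gaussian)
    = (\<integral>\<^sup>+y. ennreal (pi powr (- real CARD('n) / 2) * exp (- (norm y)\<^sup>2)) * g y \<partial>lborel)"
  unfolding gaussian_def by (subst nn_integral_density) auto

lemma emeasure_gaussian_UNIV: "emeasure (gaussian :: (real ^ 'n) measure) UNIV = 1"
proof -
  have "emeasure (gaussian :: (real ^ 'n) measure) UNIV = (\<integral>\<^sup>+y. 1 \<partial>(gaussian :: (real ^ 'n) measure))" by simp
  also have "\<dots> = ennreal (pi powr (- real CARD('n) / 2)) * (\<integral>\<^sup>+y. ennreal (exp (- 1 * (norm (y - (0::real^'n)))\<^sup>2)) \<partial>lborel)"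
    by (subst nn_integral_gaussian) (auto simp: ennreal_mult nn_integral_cmult)
  also have "\<dots> = ennreal (pi powr (- real CARD('n) / 2) * pi powr (real CARD('n) / 2))"
    by (subst nn_integral_exp_square) (auto simp: ennreal_mult)
  also have "\<dots> = 1" by (simp flip: powr_add)
  finally show ?thesis .
qed

interpretation gaussian: prob_space gaussian
  by (rule prob_spaceI) (simp add: emeasure_gaussian_UNIV)

text \<open>The density of the transition probability \<open>M\<^sub>s(x, \<cdot>) d\<gamma>\<close> with respect to Lebesgue measure.\<close>

definition heat :: "real \<Rightarrow> real ^ 'n \<Rightarrow> real ^ 'n \<Rightarrow> real" where
  "heat s x y = pi powr (- real CARD('n) / 2) * (1 - exp (- 2 * s)) powr (- real CARD('n) / 2)
     * exp (- (norm (y - exp (- s) *\<^sub>R x))\<^sup>2 / (1 - exp (- 2 * s)))"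

lemma exp_neg_two: "exp (- 2 * s) = exp (- s) * exp (- (s::real))" "exp (- (2 * s)) = exp (- s) * exp (- (s::real))"
  by (auto simp flip: exp_add)

text \<open>With r = e^{-s}, writing r/(1+r) as r(1-r)/(1-r^2) gives all terms one denominator, and
  the exponent becomes a complete square. So M_s(x,.) d\<gamma> is the normal law centred at rx with
  variance (1-r^2)/2 in each coordinate.\<close>

lemma mehler_heat:
  fixes x y :: "real ^ 'n"
  assumes "s > 0"
  shows "pi powr (- real CARD('n) / 2) * exp (- (norm y)\<^sup>2) * mehler s x y = heat s x y"
proof -
  define r where "r = exp (- s)"
  have r: "0 < r" "r < 1" using assms by (auto simp: r_def)
  have D: "1 - r * r = (1 - r) * (1 + r)" by (simp add: algebra_simps)
  have D0: "1 - r * r \<noteq> 0" unfolding D using r by simp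
  have E: "- (norm y)\<^sup>2 + (- (r / (1 - r * r)) * (norm (x - y))\<^sup>2 + r / (1 + r) * ((norm x)\<^sup>2 + (norm y)\<^sup>2))
     = - (norm (y - r *\<^sub>R x))\<^sup>2 / (1 - r * r)"
  proof -
    have eq: "r / (1 + r) = r * (1 - r) / (1 - r * r)" unfolding D using r by simp
    define D where "D = 1 - r * r"
    have D0: "D \<noteq> 0" using D0 by (simp add: D_def)
    have n: "(norm (x - y))\<^sup>2 = x \<bullet> x + y \<bullet> y - 2 * (x \<bullet> y)"
      "(norm (y - r *\<^sub>R x))\<^sup>2 = y \<bullet> y - 2 * r * (x \<bullet> y) + r * r * (x \<bullet> x)"
      by (simp_all add: power2_norm_eq_inner inner_diff_left inner_diff_right inner_commute algebra_simps)
    have "- (y \<bullet> y) * D + (- r * (x \<bullet> x + y \<bullet> y - 2 * (x \<bullet> y)) + r * (1 - r) * (x \<bullet> x + y \<bullet> y))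
       = - (y \<bullet> y - 2 * r * (x \<bullet> y) + r * r * (x \<bullet> x))"
      by (simp add: D_def algebra_simps)
    then show ?thesis
      unfolding eq n power2_norm_eq_inner[of x] power2_norm_eq_inner[of y] D_def[symmetric] using D0 by (simp add: divide_simps)
  qed
  have "exp (- (norm y)\<^sup>2) * (exp (- (r / (1 - r * r)) * (norm (x - y))\<^sup>2) * exp (r / (1 + r) * ((norm x)\<^sup>2 + (norm y)\<^sup>2)))
     = exp (- (norm (y - r *\<^sub>R x))\<^sup>2 / (1 - r * r))"
    unfolding exp_add[symmetric] E ..
  then show ?thesis
    unfolding mehler_def heat_def exp_neg_two r_def[symmetric]
    by (simp add: powr_minus_divide)
qed

lemma mehler_commute: "mehler s x y = mehler s y x"
  by (simp add: mehler_def norm_minus_commute add.commute)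

lemma mehler_nonneg [simp]: "0 \<le> mehler s x y"
  by (simp add: mehler_def)

lemma heat_nonneg [simp]: "0 \<le> heat s x y"
  by (simp add: heat_def)

lemma mehler_measurable [measurable (raw)]:
  fixes f g :: "'a \<Rightarrow> real ^ 'n"
  assumes [measurable]: "h \<in> borel_measurable M" "f \<in> borel_measurable M" "g \<in> borel_measurable M"
  shows "(\<lambda>z. mehler (h z) (f z) (g z)) \<in> borel_measurable M"
  unfolding mehler_def by measurable

lemma heat_measurable [measurable (raw)]:
  fixes f g :: "'a \<Rightarrow> real ^ 'n"
  assumes [measurable]: "h \<in> borel_measurable M" "f \<in> borel_measurable M" "g \<in> borel_measurable M"
  shows "(\<lambda>z. heat (h z) (f z) (g z)) \<in> borel_measurable M"
  unfolding heat_def by measurable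

lemma nn_integral_mehler:
  fixes x :: "real ^ 'n"
  assumes [measurable]: "g \<in> borel_measurable borel" and "s > 0"
  shows "(\<integral>\<^sup>+y. ennreal (mehler s x y) * g y \<partial>gaussian) = (\<integral>\<^sup>+y. ennreal (heat s x y) * g y \<partial>lborel)"
  by (subst nn_integral_gaussian)
    (auto simp: mult.assoc[symmetric] ennreal_mult[symmetric] mehler_heat[OF assms(2), simplified])

text \<open>Multiplying a normal density by exp(\<alpha>|y|^2) gives another Gaussian as long as
  \<alpha>D < 1, where D = 1 - e^{-2s}: the precision becomes (1 - \<alpha>D)/D and the centre moves
  to rx/(1 - \<alpha>D).\<close>

lemma nn_integral_mehler_exp_eq:
  fixes x :: "real ^ 'n"
  assumes "s > 0" "\<alpha> < 1" "0 \<le> \<alpha>"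
  shows "(\<integral>\<^sup>+y. ennreal (mehler s x y) * ennreal (exp (\<alpha> * (norm y)\<^sup>2)) \<partial>gaussian)
    = ennreal ((1 - \<alpha> * (1 - exp (- 2 * s))) powr (- real CARD('n) / 2)
        * exp (\<alpha> * exp (- 2 * s) / (1 - \<alpha> * (1 - exp (- 2 * s))) * (norm x)\<^sup>2))"
proof -
  define r where "r = exp (- s)"
  define D where "D = 1 - r * r"
  have r: "0 < r" "r < 1" using assms by (auto simp: r_def)
  have D: "0 < D" "D < 1" using r mult_strict_mono[of r 1 r 1] by (auto simp: D_def)
  have "\<alpha> * D < 1 * 1" using assms D by (intro mult_less_le_imp_less[of \<alpha> 1 D 1]) auto
  then have B: "1 - \<alpha> * D > 0" by simp
  define A where "A = (1 - \<alpha> * D) / D"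
  define z where "z = (r / (1 - \<alpha> * D)) *\<^sub>R x"
  have A: "A > 0" using B D by (simp add: A_def)
  have E: "- (norm (y - r *\<^sub>R x))\<^sup>2 / D + \<alpha> * (norm y)\<^sup>2
     = - A * (norm (y - z))\<^sup>2 + \<alpha> * (r * r) / (1 - \<alpha> * D) * (norm x)\<^sup>2" for y
  proof -
    define Y where "Y = y \<bullet> y" define X where "X = x \<bullet> x" define P where "P = x \<bullet> y"
    have 1: "(norm (y - r *\<^sub>R x))\<^sup>2 = Y - 2 * r * P + r * r * X"
      by (simp add: power2_norm_eq_inner inner_diff_left inner_diff_right X_def Y_def P_def inner_commute algebra_simps)
    have 2: "(norm (y - z))\<^sup>2 = Y - 2 * (r / (1 - \<alpha> * D)) * P + (r / (1 - \<alpha> * D)) * (r / (1 - \<alpha> * D)) * X"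
      unfolding z_def
      by (simp add: power2_norm_eq_inner inner_diff_left inner_diff_right X_def Y_def P_def inner_commute algebra_simps)
    have 3: "(norm y)\<^sup>2 = Y" "(norm x)\<^sup>2 = X" by (auto simp: power2_norm_eq_inner X_def Y_def)
    define B where "B = 1 - \<alpha> * D"
    \<comment> \<open>Eliminating \<alpha> in favour of B leaves a rational identity whose
      denominators are only B and D.\<close>
    have aD: "\<alpha> = (1 - B) / D" using D by (simp add: B_def)
    show ?thesis
      unfolding 1 2 3 A_def B_def[symmetric] unfolding aD
      using D B[folded B_def] by (simp add: field_simps)
  qed
  have "(\<integral>\<^sup>+y. ennreal (mehler s x y) * ennreal (exp (\<alpha> * (norm y)\<^sup>2)) \<partial>gaussian)
    = (\<integral>\<^sup>+y. ennreal (heat s x y) * ennreal (exp (\<alpha> * (norm y)\<^sup>2)) \<partial>lborel)"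
    using assms by (intro nn_integral_mehler) auto
  also have "\<dots> = (\<integral>\<^sup>+y. ennreal (pi powr (- real CARD('n) / 2) * D powr (- real CARD('n) / 2)
      * exp (\<alpha> * (r * r) / (1 - \<alpha> * D) * (norm x)\<^sup>2)) * ennreal (exp (- A * (norm (y - z))\<^sup>2)) \<partial>lborel)"
  proof (intro nn_integral_cong)
    fix y :: "real ^ 'n"
    have "heat s x y * exp (\<alpha> * (norm y)\<^sup>2)
       = pi powr (- real CARD('n) / 2) * D powr (- real CARD('n) / 2) * exp (- (norm (y - r *\<^sub>R x))\<^sup>2 / D + \<alpha> * (norm y)\<^sup>2)"
      unfolding heat_def exp_neg_two r_def[symmetric] D_def[symmetric] exp_add by simp
    also have "\<dots> = pi powr (- real CARD('n) / 2) * D powr (- real CARD('n) / 2)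
      * exp (\<alpha> * (r * r) / (1 - \<alpha> * D) * (norm x)\<^sup>2) * exp (- A * (norm (y - z))\<^sup>2)"
      unfolding E exp_add by simp
    finally show "ennreal (heat s x y) * ennreal (exp (\<alpha> * (norm y)\<^sup>2)) = ennreal (pi powr (- real CARD('n) / 2) * D powr (- real CARD('n) / 2)
      * exp (\<alpha> * (r * r) / (1 - \<alpha> * D) * (norm x)\<^sup>2)) * ennreal (exp (- A * (norm (y - z))\<^sup>2))"
      by (simp add: ennreal_mult[symmetric])
  qed
  also have "\<dots> = ennreal (pi powr (- real CARD('n) / 2) * D powr (- real CARD('n) / 2)
      * exp (\<alpha> * (r * r) / (1 - \<alpha> * D) * (norm x)\<^sup>2)) * ennreal ((pi / A) powr (real CARD('n) / 2))"
    by (subst nn_integral_cmult) (auto simp: nn_integral_exp_square[OF A, simplified])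
  also have "\<dots> = ennreal ((1 - \<alpha> * D) powr (- real CARD('n) / 2) * exp (\<alpha> * (r * r) / (1 - \<alpha> * D) * (norm x)\<^sup>2))"
  proof -
    define m where "m = real CARD('n) / 2"
    have m: "- real CARD('n) / 2 = - m" "real CARD('n) / 2 = m" by (auto simp: m_def)
    have "pi powr - m * D powr - m * (pi / A) powr m = (1 - \<alpha> * D) powr - m"
      using B D by (simp add: A_def powr_minus powr_divide powr_mult field_simps)
    then have "pi powr - m * D powr - m * exp (\<alpha> * (r * r) / (1 - \<alpha> * D) * (norm x)\<^sup>2) * (pi / A) powr m
      = (1 - \<alpha> * D) powr - m * exp (\<alpha> * (r * r) / (1 - \<alpha> * D) * (norm x)\<^sup>2)"
      by (simp add: mult_ac)
    then show ?thesis unfolding m by (simp add: ennreal_mult[symmetric])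
  qed
  finally show ?thesis
    unfolding exp_neg_two r_def[symmetric] D_def[symmetric] .
qed

text \<open>With E = 1 - e^{-2s}, the elementary bound 1 - E \<le> (1 - (1-\<alpha>)E)(1 -
  \<alpha>E) makes the exponent drop by an amount linear in E. The loss \<alpha>(1-\<alpha>)E|x|^2
  vanishes at \<alpha> = 0, which is why exponential weights avoid the logarithm and the constant
  weight does not.\<close>

lemma nn_integral_mehler_exp:
  fixes x :: "real ^ 'n"
  assumes "s > 0" "\<alpha> < 1" "0 \<le> \<alpha>"
  shows "(\<integral>\<^sup>+y. ennreal (mehler s x y) * ennreal (exp (\<alpha> * (norm y)\<^sup>2)) \<partial>gaussian)
    \<le> ennreal ((1 - \<alpha>) powr (- real CARD('n) / 2)
        * exp (\<alpha> * (norm x)\<^sup>2 - \<alpha> * (1 - \<alpha>) * (1 - exp (- 2 * s)) * (norm x)\<^sup>2))"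
proof -
  define E where "E = 1 - exp (- 2 * s)"
  have E: "0 < E" "E < 1" using assms by (auto simp: E_def)
  have aE: "1 - \<alpha> \<le> 1 - \<alpha> * E" using assms E by (simp add: mult_left_le)
  have B: "1 - \<alpha> * E > 0" using aE assms by simp
  have "(1 - \<alpha> * E) powr (- real CARD('n) / 2) \<le> (1 - \<alpha>) powr (- real CARD('n) / 2)"
    using aE assms by (intro powr_mono2') auto
  moreover have "\<alpha> * exp (- 2 * s) / (1 - \<alpha> * E) * (norm x)\<^sup>2 \<le> \<alpha> * (norm x)\<^sup>2 - \<alpha> * (1 - \<alpha>) * E * (norm x)\<^sup>2"
  proof -
    have "exp (- 2 * s) = 1 - E" by (simp add: E_def)
    have "(1 - E) \<le> (1 - (1 - \<alpha>) * E) * (1 - \<alpha> * E)"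
    proof -
      have "(1 - (1 - \<alpha>) * E) * (1 - \<alpha> * E) = 1 - E + \<alpha> * (1 - \<alpha>) * E * E" by (simp add: algebra_simps)
      then show ?thesis using assms E by simp
    qed
    then have "(1 - E) / (1 - \<alpha> * E) \<le> 1 - (1 - \<alpha>) * E"
      using B by (simp add: divide_le_eq)
    then have "\<alpha> * (norm x)\<^sup>2 * ((1 - E) / (1 - \<alpha> * E)) \<le> \<alpha> * (norm x)\<^sup>2 * (1 - (1 - \<alpha>) * E)"
      using assms by (intro mult_left_mono) auto
    then show ?thesis unfolding \<open>exp (- 2 * s) = 1 - E\<close> by (simp add: algebra_simps)
  qed
  ultimately show ?thesis
    unfolding nn_integral_mehler_exp_eq[OF assms] E_def[symmetric]
    by (intro ennreal_leI mult_mono) auto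
qed

lemma nn_integral_mehler_1: "s > 0 \<Longrightarrow> (\<integral>\<^sup>+y. ennreal (mehler s x y) \<partial>gaussian) = 1"
  using nn_integral_mehler_exp_eq[of s 0 x] by simp

section \<open>The local kernel\<close>

text \<open>Up to constant factors this is the inverse square of \<open>m_tilde\<close>: it replaces
  the step function by an expression that can be integrated.\<close>

definition wt :: "real ^ 'n \<Rightarrow> real" where
  "wt x = 1 + (norm x)\<^sup>2"

lemma wt_ge_1: "1 \<le> wt x" and wt_pos: "0 < wt x"
  by (auto simp: wt_def add_pos_nonneg)

lemma wt_nonneg [simp]: "0 \<le> wt x"
  using wt_pos[of x] by simp

lemma wt_measurable [measurable]: "wt \<in> borel_measurable borel"
  unfolding wt_def by measurable

text \<open>For s \<le> S the quantity 1 - e^{-2s} is at least a multiple of s, so the gain is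
  exp(-bs|x|^2). Only 1/(1 + bs|x|^2) is kept of it; since s is bounded, this is at most a constant
  over s(1 + |x|^2).\<close>

lemma nn_integral_mehler_exp_decay:
  fixes \<alpha> S :: real
  assumes "0 < \<alpha>" "\<alpha> < 1" "0 < S"
  obtains C where "0 < C" "\<And>s x. 0 < s \<Longrightarrow> s \<le> S \<Longrightarrow>
    (\<integral>\<^sup>+y. ennreal (mehler s (x :: real ^ 'n) y) * ennreal (exp (\<alpha> * (norm y)\<^sup>2)) \<partial>gaussian)
      \<le> ennreal (C * exp (\<alpha> * (norm x)\<^sup>2) / (s * wt x))"
proof -
  define b where "b = \<alpha> * (1 - \<alpha>) * (2 / (1 + 2 * S))"
  define A where "A = (1 - \<alpha>) powr (- real CARD('n) / 2)"
  have b: "b > 0" using assms by (simp add: b_def)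
  have A: "A > 0" using assms by (simp add: A_def)
  show ?thesis
  proof (rule that[of "A * (S + 1 / b)"])
    show "A * (S + 1 / b) > 0" using A b assms by (simp add: add_pos_pos)
    fix s and x :: "real ^ 'n" assume s: "0 < s" "s \<le> S"
    define X where "X = (norm x)\<^sup>2"
    have X: "X \<ge> 0" by (simp add: X_def)
    have "1 + 2 * s \<le> exp (2 * s)" by (rule exp_ge_add_one_self)
    then have "exp (- 2 * s) \<le> 1 / (1 + 2 * s)"
      using s by (simp add: exp_minus field_simps)
    then have "2 * s / (1 + 2 * s) \<le> 1 - exp (- 2 * s)"
      using s by (simp add: field_simps)
    moreover have "2 * s / (1 + 2 * S) \<le> 2 * s / (1 + 2 * s)"
      using s by (intro divide_left_mono) auto
    ultimately have "\<alpha> * (1 - \<alpha>) * (2 * s / (1 + 2 * S)) * X \<le> \<alpha> * (1 - \<alpha>) * (1 - exp (- 2 * s)) * X"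
      using assms X by (intro mult_right_mono mult_left_mono) auto
    then have "b * s * X \<le> \<alpha> * (1 - \<alpha>) * (1 - exp (- 2 * s)) * X"
      by (simp add: b_def)
    then have "exp (\<alpha> * X - \<alpha> * (1 - \<alpha>) * (1 - exp (- 2 * s)) * X) \<le> exp (\<alpha> * X) * exp (- (b * s * X))"
      by (simp flip: exp_add)
    also have "exp (- (b * s * X)) \<le> 1 / (1 + b * s * X)"
      using exp_ge_add_one_self[of "b * s * X"] b s X
      by (simp add: exp_minus inverse_eq_divide add_pos_nonneg frac_le)
    also have "1 / (1 + b * s * X) \<le> (S + 1 / b) / (s * wt x)"
    proof -
      have "s * wt x = s + s * X" by (simp add: wt_def X_def algebra_simps)
      also have "\<dots> \<le> S + s * X + S * (b * s * X) + 1 / b"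
      proof -
        have "0 \<le> S * (b * s * X)" "0 \<le> 1 / b" using s b X by auto
        then show ?thesis using s by linarith
      qed
      also have "\<dots> = (S + 1 / b) * (1 + b * s * X)"
        using b by (simp add: field_simps)
      finally show ?thesis
        using s b X wt_pos[of x] by (simp add: divide_le_eq pos_le_divide_eq add_pos_nonneg mult.commute)
    qed
    finally have "A * exp (\<alpha> * X - \<alpha> * (1 - \<alpha>) * (1 - exp (- 2 * s)) * X)
       \<le> A * (exp (\<alpha> * X) * ((S + 1 / b) / (s * wt x)))"
      using A by (intro mult_left_mono) auto
    then show "(\<integral>\<^sup>+y. ennreal (mehler s x y) * ennreal (exp (\<alpha> * (norm y)\<^sup>2)) \<partial>gaussian)
      \<le> ennreal (A * (S + 1 / b) * exp (\<alpha> * (norm x)\<^sup>2) / (s * wt x))"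
      unfolding X_def[symmetric] A_def
      by (intro order_trans[OF nn_integral_mehler_exp[OF s(1) assms(2) less_imp_le[OF assms(1)]]] ennreal_leI)
        (simp add: mult.assoc X_def[symmetric] mult.commute[of "S + 1 / b"])
  qed
qed

text \<open>The polynomial weight is absorbed by the exponential one: \<open>\<bar>y\<bar>\<^sup>2 \<le> e\<^bsup>\<tau>\<bar>y\<bar>\<^sup>2\<^esup> / \<tau>\<close>
  with \<open>\<tau>\<close> of order \<open>1 / wt x\<close>, so that \<open>\<tau>\<bar>x\<bar>\<^sup>2\<close> stays bounded.\<close>

lemma nn_integral_mehler_wt_exp:
  fixes \<alpha> :: real
  assumes "0 \<le> \<alpha>" "\<alpha> < 1"
  obtains C where "0 < C" "\<And>s x. 0 < s \<Longrightarrow>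
    (\<integral>\<^sup>+y. ennreal (mehler s (x :: real ^ 'n) y) * ennreal (wt y * exp (\<alpha> * (norm y)\<^sup>2)) \<partial>gaussian)
      \<le> ennreal (C * (wt x * exp (\<alpha> * (norm x)\<^sup>2)))"
proof -
  define A where "A = ((1 - \<alpha>) / 2) powr (- real CARD('n) / 2)"
  define B where "B = 1 + 2 / (1 - \<alpha>)"
  have A: "A > 0" and B: "B > 0" using assms by (auto simp: A_def B_def add_pos_nonneg)
  show ?thesis
  proof (rule that[of "B * A * exp 1"])
    show "B * A * exp 1 > 0" using A B by simp
    fix s and x :: "real ^ 'n" assume s: "0 < (s::real)"
    \<comment> \<open>The factor 1/2 keeps \<alpha> + \<tau> below (1 + \<alpha>)/2, so the
      prefactor of the exponential moment stays uniformly bounded.\<close>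
    define \<tau> where "\<tau> = (1 - \<alpha>) / 2 / wt x"
    have \<tau>: "0 < \<tau>" "\<tau> \<le> (1 - \<alpha>) / 2"
      using assms wt_ge_1[of x] divide_left_mono[of 1 "wt x" "(1 - \<alpha>) / 2"] by (auto simp: \<tau>_def)
    have at: "0 \<le> \<alpha> + \<tau>" "\<alpha> + \<tau> < 1" using assms \<tau> by (auto simp: field_simps)
    have "wt y * exp (\<alpha> * (norm y)\<^sup>2) \<le> B * wt x * exp ((\<alpha> + \<tau>) * (norm y)\<^sup>2)" for y :: "real ^ 'n"
    proof -
      have "\<tau> * (norm y)\<^sup>2 \<le> exp (\<tau> * (norm y)\<^sup>2)"
        using exp_ge_add_one_self[of "\<tau> * (norm y)\<^sup>2"] by linarith
      then have "(norm y)\<^sup>2 \<le> exp (\<tau> * (norm y)\<^sup>2) / \<tau>"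
        using \<tau> by (simp add: field_simps)
      moreover have "1 \<le> exp (\<tau> * (norm y)\<^sup>2)" using \<tau> by simp
      moreover have "(1 + 1 / \<tau>) * exp (\<tau> * (norm y)\<^sup>2) = exp (\<tau> * (norm y)\<^sup>2) + exp (\<tau> * (norm y)\<^sup>2) / \<tau>"
        by (simp add: algebra_simps)
      ultimately have "wt y \<le> (1 + 1 / \<tau>) * exp (\<tau> * (norm y)\<^sup>2)"
        unfolding wt_def by linarith
      also have "1 + 1 / \<tau> \<le> B * wt x"
      proof -
        have "1 / \<tau> = 2 / (1 - \<alpha>) * wt x" using assms by (simp add: \<tau>_def)
        then show ?thesis using wt_ge_1[of x] by (simp add: B_def algebra_simps)
      qed
      finally have "wt y \<le> B * wt x * exp (\<tau> * (norm y)\<^sup>2)" by simp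
      then have "wt y * exp (\<alpha> * (norm y)\<^sup>2) \<le> B * wt x * exp (\<tau> * (norm y)\<^sup>2) * exp (\<alpha> * (norm y)\<^sup>2)"
        by (intro mult_right_mono) auto
      then show ?thesis by (simp add: distrib_right exp_add mult_ac)
    qed
    then have "(\<integral>\<^sup>+y. ennreal (mehler s x y) * ennreal (wt y * exp (\<alpha> * (norm y)\<^sup>2)) \<partial>gaussian)
      \<le> (\<integral>\<^sup>+y. ennreal (B * wt x) * (ennreal (mehler s x y) * ennreal (exp ((\<alpha> + \<tau>) * (norm y)\<^sup>2))) \<partial>gaussian)"
      using B wt_pos[of x]
      by (intro nn_integral_mono) (simp add: ennreal_mult[symmetric] mult.left_commute[of _ "mehler s x _"] mult_left_mono)
    also have "\<dots> = ennreal (B * wt x) * (\<integral>\<^sup>+y. ennreal (mehler s x y) * ennreal (exp ((\<alpha> + \<tau>) * (norm y)\<^sup>2)) \<partial>gaussian)"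
      by (rule nn_integral_cmult) measurable
    also have "\<dots> \<le> ennreal (B * wt x) * ennreal (A * (exp 1 * exp (\<alpha> * (norm x)\<^sup>2)))"
    proof (intro mult_left_mono order_trans[OF nn_integral_mehler_exp[OF s at(2,1)]] ennreal_leI mult_mono)
      show "(1 - (\<alpha> + \<tau>)) powr (- real CARD('n) / 2) \<le> A"
        unfolding A_def using assms \<tau> by (intro powr_mono2') (auto simp: field_simps)
      have "\<tau> * (norm x)\<^sup>2 \<le> (1 - \<alpha>) / 2"
      proof -
        have "\<tau> * (norm x)\<^sup>2 \<le> \<tau> * wt x" using \<tau> by (intro mult_left_mono) (auto simp: wt_def)
        also have "\<dots> = (1 - \<alpha>) / 2" using wt_pos[of x] by (simp add: \<tau>_def)
        finally show ?thesis .
      qed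
      moreover have "0 \<le> (\<alpha> + \<tau>) * (1 - (\<alpha> + \<tau>)) * (1 - exp (- 2 * s)) * (norm x)\<^sup>2"
        using at s by auto
      ultimately have "(\<alpha> + \<tau>) * (norm x)\<^sup>2 - (\<alpha> + \<tau>) * (1 - (\<alpha> + \<tau>)) * (1 - exp (- 2 * s)) * (norm x)\<^sup>2
          \<le> 1 + \<alpha> * (norm x)\<^sup>2"
        using assms by (simp add: distrib_right)
      then show "exp ((\<alpha> + \<tau>) * (norm x)\<^sup>2 - (\<alpha> + \<tau>) * (1 - (\<alpha> + \<tau>)) * (1 - exp (- 2 * s)) * (norm x)\<^sup>2)
          \<le> exp 1 * exp (\<alpha> * (norm x)\<^sup>2)"
        by (simp flip: exp_add)
    qed (use A in auto)
    also have "\<dots> = ennreal (B * A * exp 1 * (wt x * exp (\<alpha> * (norm x)\<^sup>2)))"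
      using A B wt_pos[of x] by (simp add: ennreal_mult[symmetric] mult_ac)
    finally show "(\<integral>\<^sup>+y. ennreal (mehler s x y) * ennreal (wt y * exp (\<alpha> * (norm y)\<^sup>2)) \<partial>gaussian)
      \<le> ennreal (B * A * exp 1 * (wt x * exp (\<alpha> * (norm x)\<^sup>2)))" .
  qed
qed

section \<open>The discretized admissibility function\<close>

lemma m_tilde_eq:
  fixes x :: "real ^ 'n"
  assumes "norm x \<ge> 1"
  shows "m_tilde x = 2 powr (- of_int \<lfloor>log 2 (norm x)\<rfloor> - 1)"
proof -
  \<comment> \<open>The dyadic index of x is j + 1. Removing the definite description in favour of a
    floor also makes measurability visible.\<close>
  define j where "j = nat \<lfloor>log 2 (norm x)\<rfloor>"
  have l0: "0 \<le> log 2 (norm x)" using assms by (subst zero_le_log_cancel_iff) auto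
  then have j: "real j = of_int \<lfloor>log 2 (norm x)\<rfloor>" by (simp add: j_def)
  have 1: "2 ^ j \<le> norm x"
  proof -
    have "real j \<le> log 2 (norm x)" unfolding j by linarith
    then have "2 powr real j \<le> norm x" using assms by (subst (asm) le_log_iff) auto
    then show ?thesis by (simp add: powr_realpow)
  qed
  have 2: "norm x < 2 ^ (Suc j)"
  proof -
    have "log 2 (norm x) < real (Suc j)" using j by simp linarith
    then have "norm x < 2 powr real (Suc j)" using assms by (subst (asm) log_less_iff) auto
    then show ?thesis by (simp only: powr_realpow zero_less_numeral)
  qed
  have "(THE k::nat. 1 \<le> k \<and> 2 ^ (k - 1) \<le> norm x \<and> norm x < 2 ^ k) = Suc j"
  proof (rule the_equality)
    show "1 \<le> Suc j \<and> 2 ^ (Suc j - 1) \<le> norm x \<and> norm x < 2 ^ Suc j" using 1 2 by auto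
    fix k :: nat assume k: "1 \<le> k \<and> 2 ^ (k - 1) \<le> norm x \<and> norm x < 2 ^ k"
    have "(2::real) ^ (k - 1) < 2 ^ Suc j" "(2::real) ^ j < 2 ^ k" using k 1 2 by linarith+
    then have "k - 1 < Suc j" "j < k" by (auto simp only: power_strict_increasing_iff one_less_numeral_iff semiring_norm)
    then show "k = Suc j" using k by simp
  qed
  then have "m_tilde x = 1 / 2 ^ Suc j" using assms by (simp add: m_tilde_def)
  also have "\<dots> = 2 powr (- real (Suc j))" by (simp only: powr_minus_divide powr_realpow zero_less_numeral)
  also have "- real (Suc j) = - of_int \<lfloor>log 2 (norm x)\<rfloor> - 1" by (simp add: j)
  finally show ?thesis .
qed

text \<open>For |x| \<ge> 1 the product \<open>m_tilde x\<close> |x| lies between 1/2 and 1 because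
  a real number exceeds its floor by less than one. The last bound is the square of 1 \<le> 2
  \<open>m_tilde x\<close> max(1,|x|); it turns the cutoff in time into the weight
  \<open>wt\<close>.\<close>

lemma m_tilde_bounds:
  fixes x :: "real ^ 'n"
  shows "0 < m_tilde x" "m_tilde x \<le> 1" "m_tilde x * norm x \<le> 1" "1 \<le> 4 * (m_tilde x)\<^sup>2 * wt x"
proof -
  have "0 < m_tilde x \<and> m_tilde x \<le> 1 \<and> m_tilde x * norm x \<le> 1 \<and> 1 \<le> 2 * m_tilde x * max 1 (norm x)"
  proof (cases "norm x < 1")
    case True
    then show ?thesis by (simp add: m_tilde_def)
  next
    case False
    then have n: "norm x \<ge> 1" by simp
    define l where "l = log 2 (norm x)"
    have nl: "norm x = 2 powr l" using n unfolding l_def by (subst powr_log_cancel) auto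
    have l: "0 \<le> l" using n unfolding l_def by (subst zero_le_log_cancel_iff) auto
    have m: "m_tilde x = 2 powr (- of_int \<lfloor>l\<rfloor> - 1)" using m_tilde_eq[OF n] by (simp add: l_def)
    have "m_tilde x * norm x = 2 powr (- of_int \<lfloor>l\<rfloor> - 1 + l)" unfolding m nl by (simp add: powr_add)
    also have "\<dots> \<le> 2 powr 0" by (intro powr_mono) linarith+
    finally have 1: "m_tilde x * norm x \<le> 1" by simp
    have "1 = 2 powr (0::real)" by simp
    also have "\<dots> \<le> 2 powr (1 + (- of_int \<lfloor>l\<rfloor> - 1 + l))" by (intro powr_mono) linarith+
    also have "\<dots> = 2 * m_tilde x * norm x" unfolding m nl powr_add by simp
    finally have 2: "1 \<le> 2 * m_tilde x * norm x" .
    have 3: "m_tilde x > 0" by (simp add: m)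
    have "m_tilde x * 1 \<le> m_tilde x * norm x" using 3 n by (intro mult_left_mono) auto
    then have "m_tilde x \<le> 1" using 1 by simp
    then show ?thesis using 1 2 3 n by (auto simp: max_def)
  qed
  then show 1: "0 < m_tilde x" "m_tilde x \<le> 1" "m_tilde x * norm x \<le> 1" and 2: "1 \<le> 4 * (m_tilde x)\<^sup>2 * wt x"
  proof -
    assume *: "0 < m_tilde x \<and> m_tilde x \<le> 1 \<and> m_tilde x * norm x \<le> 1 \<and> 1 \<le> 2 * m_tilde x * max 1 (norm x)"
    then show "0 < m_tilde x" "m_tilde x \<le> 1" "m_tilde x * norm x \<le> 1" by auto
    have "1\<^sup>2 \<le> (2 * m_tilde x * max 1 (norm x))\<^sup>2" using * by (intro power_mono) auto
    also have "\<dots> = 4 * (m_tilde x)\<^sup>2 * (max 1 (norm x))\<^sup>2" by (simp add: power_mult_distrib)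
    also have "\<dots> \<le> 4 * (m_tilde x)\<^sup>2 * wt x"
      by (intro mult_left_mono) (auto simp: wt_def max_def)
    finally show "1 \<le> 4 * (m_tilde x)\<^sup>2 * wt x" by simp
  qed
qed

lemma m_tilde_measurable [measurable]: "(m_tilde :: real ^ 'n \<Rightarrow> real) \<in> borel_measurable borel"
proof -
  have "m_tilde = (\<lambda>x :: real ^ 'n. if norm x < 1 then 1 else 2 powr (- of_int \<lfloor>log 2 (norm x)\<rfloor> - 1))"
  proof
    fix x :: "real ^ 'n"
    show "m_tilde x = (if norm x < 1 then 1 else 2 powr (- of_int \<lfloor>log 2 (norm x)\<rfloor> - 1))"
      using m_tilde_eq[of x] by (cases "norm x < 1") (auto simp: m_tilde_def[of x])
  qed
  also have "\<dots> \<in> borel_measurable borel" by measurable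
  finally show ?thesis .
qed

text \<open>The cutoff in time depends on the first argument only, so the symmetry of the Mehler
  kernel is lost and rows and columns need separate estimates. Values in \<open>ennreal\<close>
  allow Tonelli's theorem without integrability conditions.\<close>

definition local_kernel :: "real \<Rightarrow> real \<Rightarrow> real \<Rightarrow> real ^ 'n \<Rightarrow> real ^ 'n \<Rightarrow> ennreal" where
  "local_kernel a \<kappa> T x y
    = (\<integral>\<^sup>+t. indicator {m_tilde x / \<kappa>..T} t * ennreal (1 / t) * ennreal (mehler (a * t\<^sup>2) x y) \<partial>lborel)"

lemma indicator_Icc_measurable [measurable (raw)]:
  fixes f g h :: "'a \<Rightarrow> real"
  assumes [measurable]: "f \<in> borel_measurable M" "g \<in> borel_measurable M" "h \<in> borel_measurable M"
  shows "(\<lambda>x. indicator {f x..g x} (h x) :: ennreal) \<in> borel_measurable M"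
  unfolding indicator_def atLeastAtMost_iff by measurable

lemma local_kernel_measurable [measurable (raw)]:
  fixes f g :: "'a \<Rightarrow> real ^ 'n"
  assumes [measurable]: "f \<in> borel_measurable M" "g \<in> borel_measurable M"
  shows "(\<lambda>z. local_kernel a \<kappa> T (f z) (g z)) \<in> borel_measurable M"
  unfolding local_kernel_def by measurable

interpretation gaussian_lborel: pair_sigma_finite "gaussian :: (real ^ 'n) measure" "lborel :: real measure"
  by unfold_locales

interpretation gaussian_gaussian: pair_sigma_finite "gaussian :: (real ^ 'n) measure" "gaussian :: (real ^ 'n) measure"
  by unfold_locales

lemma local_kernel_row:
  fixes x :: "real ^ 'n"
  assumes [measurable]: "g \<in> borel_measurable borel"
  shows "(\<integral>\<^sup>+y. local_kernel a \<kappa> T x y * g y \<partial>gaussian)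
    = (\<integral>\<^sup>+t. indicator {m_tilde x / \<kappa>..T} t * ennreal (1 / t)
        * (\<integral>\<^sup>+y. ennreal (mehler (a * t\<^sup>2) x y) * g y \<partial>gaussian) \<partial>lborel)"
proof -
  have "(\<integral>\<^sup>+y. local_kernel a \<kappa> T x y * g y \<partial>gaussian)
    = (\<integral>\<^sup>+y. (\<integral>\<^sup>+t. indicator {m_tilde x / \<kappa>..T} t * ennreal (1 / t) * ennreal (mehler (a * t\<^sup>2) x y) * g y \<partial>lborel) \<partial>gaussian)"
    unfolding local_kernel_def by (subst nn_integral_multc) auto
  also have "\<dots> = (\<integral>\<^sup>+t. (\<integral>\<^sup>+y. indicator {m_tilde x / \<kappa>..T} t * ennreal (1 / t) * ennreal (mehler (a * t\<^sup>2) x y) * g y \<partial>gaussian) \<partial>lborel)"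
    by (rule gaussian_lborel.Fubini'[symmetric]) measurable
  finally show ?thesis by (simp add: mult.assoc nn_integral_cmult)
qed

text \<open>Tonelli's theorem, after which the symmetry of \<open>mehler\<close> makes the inner
  integral a semigroup average at y. The cutoff stays inside because it depends on the integration
  variable.\<close>

lemma local_kernel_column:
  fixes y :: "real ^ 'n"
  assumes [measurable]: "g \<in> borel_measurable borel"
  shows "(\<integral>\<^sup>+x. local_kernel a \<kappa> T x y * g x \<partial>gaussian)
    = (\<integral>\<^sup>+t. ennreal (1 / t) * (\<integral>\<^sup>+x. indicator {m_tilde x / \<kappa>..T} t
        * (ennreal (mehler (a * t\<^sup>2) y x) * g x) \<partial>gaussian) \<partial>lborel)"
proof -
  have "(\<integral>\<^sup>+x. local_kernel a \<kappa> T x y * g x \<partial>gaussian)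
    = (\<integral>\<^sup>+x. (\<integral>\<^sup>+t. indicator {m_tilde x / \<kappa>..T} t * ennreal (1 / t) * ennreal (mehler (a * t\<^sup>2) x y) * g x \<partial>lborel) \<partial>gaussian)"
    unfolding local_kernel_def by (subst nn_integral_multc) auto
  also have "\<dots> = (\<integral>\<^sup>+t. (\<integral>\<^sup>+x. indicator {m_tilde x / \<kappa>..T} t * ennreal (1 / t) * ennreal (mehler (a * t\<^sup>2) x y) * g x \<partial>gaussian) \<partial>lborel)"
    by (rule gaussian_lborel.Fubini'[symmetric]) measurable
  also have "\<dots> = (\<integral>\<^sup>+t. (\<integral>\<^sup>+x. ennreal (1 / t) * (indicator {m_tilde x / \<kappa>..T} t * (ennreal (mehler (a * t\<^sup>2) y x) * g x)) \<partial>gaussian) \<partial>lborel)"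
    by (simp add: mult_ac mehler_commute)
  finally show ?thesis by (simp add: nn_integral_cmult)
qed

section \<open>Elementary integrals over time\<close>

lemma nn_integral_inverse_cube:
  assumes "0 < (c::real)"
  shows "(\<integral>\<^sup>+t. ennreal (1 / t ^ 3) * indicator {c..} t \<partial>lborel) = ennreal (1 / (2 * c\<^sup>2))"
proof -
  have "((\<lambda>t::real. - 1 / (2 * t\<^sup>2)) \<longlongrightarrow> 0) at_top" by real_asymp
  then have "(\<integral>\<^sup>+t. ennreal (1 / t ^ 3) * indicator {c..} t \<partial>lborel) = ennreal (0 - (- 1 / (2 * c\<^sup>2)))"
  proof (rule nn_integral_FTC_atLeast[rotated 3])
    show "DERIV (\<lambda>t. - 1 / (2 * t\<^sup>2)) t :> 1 / t ^ 3" if "c \<le> t" for t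
      using that assms by (auto intro!: derivative_eq_intros simp: field_simps power2_eq_square power3_eq_cube)
  qed (use assms in auto)
  then show ?thesis by simp
qed

lemma nn_integral_ident:
  assumes "0 \<le> (c::real)"
  shows "(\<integral>\<^sup>+t. ennreal t * indicator {0..c} t \<partial>lborel) = ennreal (c\<^sup>2 / 2)"
proof -
  have "(\<integral>\<^sup>+t. ennreal t * indicator {0..c} t \<partial>lborel) = ennreal (c\<^sup>2 / 2 - 0\<^sup>2 / 2)"
    by (rule nn_integral_FTC_Icc) (use assms in \<open>auto intro!: derivative_eq_intros\<close>)
  then show ?thesis by simp
qed

lemma nn_integral_inverse:
  assumes "0 < (c::real)" "c \<le> T"
  shows "(\<integral>\<^sup>+t. ennreal (1 / t) * indicator {c..T} t \<partial>lborel) = ennreal (ln T - ln c)"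
  by (rule nn_integral_FTC_Icc) (use assms in \<open>auto intro!: derivative_eq_intros\<close>)

text \<open>The exponential moment supplies 1/(a t^2 wt x), so the time integral is of order
  1/(t_0^2 wt x) with t_0 = \<open>m_tilde x\<close> / \<kappa>. As 1/t_0^2 \<le> 4 \<kappa>^2 wt x,
  the weight cancels.\<close>

lemma local_kernel_row_exp:
  assumes "0 < \<alpha>" "\<alpha> < 1" "0 < a" "0 < \<kappa>" "0 < T"
  obtains C where "0 < C" "\<And>x :: real ^ 'n.
    (\<integral>\<^sup>+y. local_kernel a \<kappa> T x y * ennreal (exp (\<alpha> * (norm y)\<^sup>2)) \<partial>gaussian) \<le> ennreal (C * exp (\<alpha> * (norm x)\<^sup>2))"
proof -
  have S: "0 < a * T\<^sup>2" using assms by simp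
  obtain B where B: "0 < B" "\<And>s x. 0 < s \<Longrightarrow> s \<le> a * T\<^sup>2 \<Longrightarrow>
    (\<integral>\<^sup>+y. ennreal (mehler s (x :: real ^ 'n) y) * ennreal (exp (\<alpha> * (norm y)\<^sup>2)) \<partial>gaussian)
      \<le> ennreal (B * exp (\<alpha> * (norm x)\<^sup>2) / (s * wt x))"
    using nn_integral_mehler_exp_decay[OF assms(1,2) S] by blast
  show ?thesis
  proof (rule that[of "B / a * (2 * \<kappa>\<^sup>2)"])
    show "0 < B / a * (2 * \<kappa>\<^sup>2)" using B assms by simp
    fix x :: "real ^ 'n"
    define t0 where "t0 = m_tilde x / \<kappa>"
    have t0: "0 < t0" using assms m_tilde_bounds(1)[of x] by (simp add: t0_def)
    define E where "E = B * exp (\<alpha> * (norm x)\<^sup>2) / (a * wt x)"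
    have E: "0 \<le> E" using B assms wt_pos[of x] by (simp add: E_def)
    have "(\<integral>\<^sup>+y. local_kernel a \<kappa> T x y * ennreal (exp (\<alpha> * (norm y)\<^sup>2)) \<partial>gaussian)
      = (\<integral>\<^sup>+t. indicator {t0..T} t * ennreal (1 / t)
        * (\<integral>\<^sup>+y. ennreal (mehler (a * t\<^sup>2) x y) * ennreal (exp (\<alpha> * (norm y)\<^sup>2)) \<partial>gaussian) \<partial>lborel)"
      unfolding t0_def by (rule local_kernel_row) measurable
    also have "\<dots> \<le> (\<integral>\<^sup>+t. ennreal E * (ennreal (1 / t ^ 3) * indicator {t0..} t) \<partial>lborel)"
    proof (intro nn_integral_mono)
      fix t :: real
      show "indicator {t0..T} t * ennreal (1 / t)
        * (\<integral>\<^sup>+y. ennreal (mehler (a * t\<^sup>2) x y) * ennreal (exp (\<alpha> * (norm y)\<^sup>2)) \<partial>gaussian)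
        \<le> ennreal E * (ennreal (1 / t ^ 3) * indicator {t0..} t)"
      proof (cases "t \<in> {t0..T}")
        case True
        then have t: "0 < t" "t0 \<le> t" "t \<le> T" using t0 by auto
        have "a * t\<^sup>2 \<le> a * T\<^sup>2" using t assms by (intro mult_left_mono power_mono) auto
        then have "ennreal (1 / t) * (\<integral>\<^sup>+y. ennreal (mehler (a * t\<^sup>2) x y) * ennreal (exp (\<alpha> * (norm y)\<^sup>2)) \<partial>gaussian)
           \<le> ennreal (1 / t) * ennreal (B * exp (\<alpha> * (norm x)\<^sup>2) / (a * t\<^sup>2 * wt x))"
          using t assms by (intro mult_left_mono B(2)) auto
        also have "\<dots> = ennreal (1 / t * (B * exp (\<alpha> * (norm x)\<^sup>2) / (a * t\<^sup>2 * wt x)))"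
          using t B assms by (intro ennreal_mult[symmetric]) auto
        also have "1 / t * (B * exp (\<alpha> * (norm x)\<^sup>2) / (a * t\<^sup>2 * wt x)) = E * (1 / t ^ 3)"
          by (simp add: E_def power2_eq_square power3_eq_cube)
        finally show ?thesis using True E t by (simp add: ennreal_mult[symmetric])
      qed simp
    qed
    also have "\<dots> = ennreal (E * (1 / (2 * t0\<^sup>2)))"
      using E by (simp add: nn_integral_cmult nn_integral_inverse_cube[OF t0] ennreal_mult[symmetric])
    also have "E * (1 / (2 * t0\<^sup>2)) \<le> B / a * (2 * \<kappa>\<^sup>2) * exp (\<alpha> * (norm x)\<^sup>2)"
    proof -
      have "1 / (2 * t0\<^sup>2) = \<kappa>\<^sup>2 / (2 * (m_tilde x)\<^sup>2)" by (simp add: t0_def power_divide)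
      also have "\<dots> \<le> 2 * \<kappa>\<^sup>2 * wt x"
        using m_tilde_bounds(1)[of x] mult_left_mono[OF m_tilde_bounds(4)[of x], of "\<kappa>\<^sup>2"]
        by (simp add: divide_le_eq mult_ac)
      finally have "E * (1 / (2 * t0\<^sup>2)) \<le> E * (2 * \<kappa>\<^sup>2 * wt x)" using E by (intro mult_left_mono)
      also have "\<dots> = B / a * (2 * \<kappa>\<^sup>2) * exp (\<alpha> * (norm x)\<^sup>2)"
        using wt_pos[of x] by (simp add: E_def)
      finally show ?thesis .
    qed
    finally show "(\<integral>\<^sup>+y. local_kernel a \<kappa> T x y * ennreal (exp (\<alpha> * (norm y)\<^sup>2)) \<partial>gaussian)
        \<le> ennreal (B / a * (2 * \<kappa>\<^sup>2) * exp (\<alpha> * (norm x)\<^sup>2))"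
      by (simp add: ennreal_leI)
  qed
qed

text \<open>Only times \<open>t \<ge> m_tilde x / \<kappa>\<close> enter the kernel, and this restriction is relaxed to the factor
  \<open>4 \<kappa>\<^sup>2 t\<^sup>2 wt x \<ge> 1\<close>; it makes the column integrals converge at \<open>t = 0\<close>.\<close>

lemma local_kernel_column_small_times:
  assumes "0 \<le> \<alpha>" "\<alpha> < 1" "0 < a" "0 < \<kappa>"
  obtains C where "0 < C" "\<And>(y :: real ^ 'n) t T. 0 < t \<Longrightarrow>
    (\<integral>\<^sup>+x. indicator {m_tilde x / \<kappa>..T} t * (ennreal (mehler (a * t\<^sup>2) y x) * ennreal (exp (\<alpha> * (norm x)\<^sup>2))) \<partial>gaussian)
      \<le> ennreal (C * (t\<^sup>2 * wt y * exp (\<alpha> * (norm y)\<^sup>2)))"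
proof -
  obtain B where B: "0 < B" "\<And>s x. 0 < s \<Longrightarrow>
    (\<integral>\<^sup>+y. ennreal (mehler s (x :: real ^ 'n) y) * ennreal (wt y * exp (\<alpha> * (norm y)\<^sup>2)) \<partial>gaussian)
      \<le> ennreal (B * (wt x * exp (\<alpha> * (norm x)\<^sup>2)))"
    using nn_integral_mehler_wt_exp[OF assms(1,2)] by blast
  show ?thesis
  proof (rule that[of "4 * \<kappa>\<^sup>2 * B"])
    show "0 < 4 * \<kappa>\<^sup>2 * B" using B assms by simp
    fix y :: "real ^ 'n" and t T :: real assume t: "0 < t"
    have "indicator {m_tilde x / \<kappa>..T} t \<le> ennreal (4 * \<kappa>\<^sup>2 * t\<^sup>2) * ennreal (wt x)" for x :: "real ^ 'n"
    proof (cases "t \<in> {m_tilde x / \<kappa>..T}")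
      case True
      then have "m_tilde x \<le> \<kappa> * t" using assms by (simp add: divide_le_eq mult.commute)
      then have "(m_tilde x)\<^sup>2 \<le> \<kappa>\<^sup>2 * t\<^sup>2"
        using m_tilde_bounds(1)[of x] power_mono[of "m_tilde x" "\<kappa> * t" 2] by (simp add: power_mult_distrib)
      then have "4 * (m_tilde x)\<^sup>2 * wt x \<le> 4 * (\<kappa>\<^sup>2 * t\<^sup>2) * wt x"
        by (intro mult_right_mono mult_left_mono) auto
      then have "1 \<le> 4 * \<kappa>\<^sup>2 * t\<^sup>2 * wt x" using m_tilde_bounds(4)[of x] by simp
      then show ?thesis using True by (simp add: ennreal_mult[symmetric])
    qed simp
    then have "(\<integral>\<^sup>+x. indicator {m_tilde x / \<kappa>..T} t * (ennreal (mehler (a * t\<^sup>2) y x) * ennreal (exp (\<alpha> * (norm x)\<^sup>2))) \<partial>gaussian)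
      \<le> (\<integral>\<^sup>+x. ennreal (4 * \<kappa>\<^sup>2 * t\<^sup>2) * ennreal (wt x) * (ennreal (mehler (a * t\<^sup>2) y x) * ennreal (exp (\<alpha> * (norm x)\<^sup>2))) \<partial>gaussian)"
      by (intro nn_integral_mono mult_right_mono) auto
    also have "\<dots> = (\<integral>\<^sup>+x. ennreal (4 * \<kappa>\<^sup>2 * t\<^sup>2) * (ennreal (mehler (a * t\<^sup>2) y x) * ennreal (wt x * exp (\<alpha> * (norm x)\<^sup>2))) \<partial>gaussian)"
      by (intro nn_integral_cong) (simp add: ennreal_mult mult_ac)
    also have "\<dots> = ennreal (4 * \<kappa>\<^sup>2 * t\<^sup>2) * (\<integral>\<^sup>+x. ennreal (mehler (a * t\<^sup>2) y x) * ennreal (wt x * exp (\<alpha> * (norm x)\<^sup>2)) \<partial>gaussian)"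
      by (rule nn_integral_cmult) measurable
    also have "\<dots> \<le> ennreal (4 * \<kappa>\<^sup>2 * t\<^sup>2) * ennreal (B * (wt y * exp (\<alpha> * (norm y)\<^sup>2)))"
      using t assms by (intro mult_left_mono B(2)) auto
    also have "\<dots> = ennreal (4 * \<kappa>\<^sup>2 * B * (t\<^sup>2 * wt y * exp (\<alpha> * (norm y)\<^sup>2)))"
      using B by (simp add: ennreal_mult[symmetric] mult_ac)
    finally show "(\<integral>\<^sup>+x. indicator {m_tilde x / \<kappa>..T} t * (ennreal (mehler (a * t\<^sup>2) y x) * ennreal (exp (\<alpha> * (norm x)\<^sup>2))) \<partial>gaussian)
      \<le> ennreal (4 * \<kappa>\<^sup>2 * B * (t\<^sup>2 * wt y * exp (\<alpha> * (norm y)\<^sup>2)))" .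
  qed
qed

text \<open>The time integral is split at the natural scale c of y, given by c^2 wt y = 1. Below c
  the relaxed cutoff gives the integrand t wt y, above c the decay of the exponential moment gives
  1/(t^3 wt y); both integrals are bounded independently of y.\<close>

lemma local_kernel_column_exp:
  assumes "0 < \<alpha>" "\<alpha> < 1" "0 < a" "0 < \<kappa>" "0 < T"
  obtains C where "0 < C" "\<And>y :: real ^ 'n.
    (\<integral>\<^sup>+x. local_kernel a \<kappa> T x y * ennreal (exp (\<alpha> * (norm x)\<^sup>2)) \<partial>gaussian) \<le> ennreal (C * exp (\<alpha> * (norm y)\<^sup>2))"
proof -
  have S: "0 < a * T\<^sup>2" using assms by simp
  obtain B where B: "0 < B" "\<And>s x. 0 < s \<Longrightarrow> s \<le> a * T\<^sup>2 \<Longrightarrow>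
    (\<integral>\<^sup>+y. ennreal (mehler s (x :: real ^ 'n) y) * ennreal (exp (\<alpha> * (norm y)\<^sup>2)) \<partial>gaussian)
      \<le> ennreal (B * exp (\<alpha> * (norm x)\<^sup>2) / (s * wt x))"
    using nn_integral_mehler_exp_decay[OF assms(1,2) S] by blast
  obtain D where D: "0 < D" "\<And>(y :: real ^ 'n) t T. 0 < t \<Longrightarrow>
    (\<integral>\<^sup>+x. indicator {m_tilde x / \<kappa>..T} t * (ennreal (mehler (a * t\<^sup>2) y x) * ennreal (exp (\<alpha> * (norm x)\<^sup>2))) \<partial>gaussian)
      \<le> ennreal (D * (t\<^sup>2 * wt y * exp (\<alpha> * (norm y)\<^sup>2)))"
    using local_kernel_column_small_times[OF less_imp_le[OF assms(1)] assms(2-4)] by blast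
  show ?thesis
  proof (rule that[of "D / 2 + B / a / 2"])
    show "0 < D / 2 + B / a / 2" using B D assms by (simp add: add_pos_pos)
    fix y :: "real ^ 'n"
    define c where "c = 1 / sqrt (wt y)"
    have c: "0 < c" "c\<^sup>2 = 1 / wt y" using wt_pos[of y] by (auto simp: c_def power_divide)
    define E where "E = exp (\<alpha> * (norm y)\<^sup>2)"
    have E: "0 \<le> E" by (simp add: E_def)
    have "(\<integral>\<^sup>+x. local_kernel a \<kappa> T x y * ennreal (exp (\<alpha> * (norm x)\<^sup>2)) \<partial>gaussian)
      = (\<integral>\<^sup>+t. ennreal (1 / t) * (\<integral>\<^sup>+x. indicator {m_tilde x / \<kappa>..T} t
        * (ennreal (mehler (a * t\<^sup>2) y x) * ennreal (exp (\<alpha> * (norm x)\<^sup>2))) \<partial>gaussian) \<partial>lborel)"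
      by (rule local_kernel_column) measurable
    also have "\<dots> \<le> (\<integral>\<^sup>+t. ennreal (D * wt y * E) * (ennreal t * indicator {0..c} t)
        + ennreal (B * E / (a * wt y)) * (ennreal (1 / t ^ 3) * indicator {c..} t) \<partial>lborel)"
      (is "_ \<le> (\<integral>\<^sup>+t. ?R t \<partial>lborel)")
    proof (intro nn_integral_mono)
      fix t :: real
      show "ennreal (1 / t) * (\<integral>\<^sup>+x. indicator {m_tilde x / \<kappa>..T} t
        * (ennreal (mehler (a * t\<^sup>2) y x) * ennreal (exp (\<alpha> * (norm x)\<^sup>2))) \<partial>gaussian) \<le> ?R t" (is "_ * ?I \<le> _")
      proof (cases "0 < t")
        case t: True
        show ?thesis
        proof (cases "t \<le> c")
          case True
          have "ennreal (1 / t) * ?I \<le> ennreal (1 / t) * ennreal (D * (t\<^sup>2 * wt y * E))"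
            unfolding E_def using t by (intro mult_left_mono D(2)) auto
          also have "\<dots> = ennreal (D * wt y * E) * (ennreal t * indicator {0..c} t)"
            using t True D E by (simp add: ennreal_mult[symmetric] power2_eq_square mult_ac)
          finally show ?thesis by (rule order_trans) simp
        next
          case False
          show ?thesis
          proof (cases "t \<le> T")
            case True
            have "a * t\<^sup>2 \<le> a * T\<^sup>2" using True t assms by (intro mult_left_mono power_mono) auto
            have "?I \<le> (\<integral>\<^sup>+x. ennreal (mehler (a * t\<^sup>2) y x) * ennreal (exp (\<alpha> * (norm x)\<^sup>2)) \<partial>gaussian)"
              by (intro nn_integral_mono) (auto split: split_indicator)
            also have "\<dots> \<le> ennreal (B * E / (a * t\<^sup>2 * wt y))"
              unfolding E_def using t assms \<open>a * t\<^sup>2 \<le> a * T\<^sup>2\<close> by (intro B(2)) auto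
            finally have "ennreal (1 / t) * ?I \<le> ennreal (1 / t) * ennreal (B * E / (a * t\<^sup>2 * wt y))"
              by (intro mult_left_mono) auto
            also have "\<dots> = ennreal (B * E / (a * wt y)) * (ennreal (1 / t ^ 3) * indicator {c..} t)"
              using t False B E assms
              by (simp add: ennreal_mult[symmetric] power2_eq_square power3_eq_cube mult_ac)
            finally show ?thesis by (rule order_trans) simp
          next
            case False
            then show ?thesis by simp
          qed
        qed
      \<comment> \<open>For t \<le> 0 the factor \<open>ennreal (1 / t)\<close> is 0, also at t = 0
        because division by zero gives 0.\<close>
      qed (simp add: ennreal_neg)
    qed
    also have "\<dots> = ennreal (D * wt y * E) * ennreal (c\<^sup>2 / 2) + ennreal (B * E / (a * wt y)) * ennreal (1 / (2 * c\<^sup>2))"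
      using c by (simp add: nn_integral_add nn_integral_cmult nn_integral_ident nn_integral_inverse_cube)
    also have "\<dots> = ennreal ((D / 2 + B / a / 2) * E)"
      using B D E assms wt_pos[of y]
      by (simp add: c ennreal_mult[symmetric] ennreal_plus[symmetric] field_simps del: ennreal_plus)
    finally show "(\<integral>\<^sup>+x. local_kernel a \<kappa> T x y * ennreal (exp (\<alpha> * (norm x)\<^sup>2)) \<partial>gaussian)
      \<le> ennreal ((D / 2 + B / a / 2) * exp (\<alpha> * (norm y)\<^sup>2))" unfolding E_def .
  qed
qed

text \<open>The same splitting with \<alpha> = 0. Above c only the total mass 1 of the transition
  probability is available, so dt/t is integrated from c to T and leaves ln T - ln c, where -ln c is
  half the logarithm of wt y. This is the source of the logarithmic weight in (i).\<close>

lemma local_kernel_column_log: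
  assumes "0 < a" "0 < \<kappa>" "0 < T"
  obtains C where "0 < C" "\<And>y :: real ^ 'n.
    (\<integral>\<^sup>+x. local_kernel a \<kappa> T x y \<partial>gaussian) \<le> ennreal (C * (1 + log_plus (norm y)))"
proof -
  obtain D where D: "0 < D" "\<And>(y :: real ^ 'n) t T. 0 < t \<Longrightarrow>
    (\<integral>\<^sup>+x. indicator {m_tilde x / \<kappa>..T} t * (ennreal (mehler (a * t\<^sup>2) y x) * ennreal (exp (0 * (norm x)\<^sup>2))) \<partial>gaussian)
      \<le> ennreal (D * (t\<^sup>2 * wt y * exp (0 * (norm y)\<^sup>2)))"
    using local_kernel_column_small_times[OF order_refl zero_less_one assms(1,2)] by blast
  show ?thesis
  proof (rule that[of "D / 2 + \<bar>ln T\<bar> + 1"])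
    show "0 < D / 2 + \<bar>ln T\<bar> + 1" using D by simp
    fix y :: "real ^ 'n"
    define c where "c = 1 / sqrt (wt y)"
    have c: "0 < c" "c\<^sup>2 = 1 / wt y" using wt_pos[of y] by (auto simp: c_def power_divide)
    have lp: "0 \<le> log_plus (norm y)" by (simp add: log_plus_def)
    have lnc: "- ln c \<le> 1 + log_plus (norm y)"
    proof -
      have "- ln c = ln (wt y) / 2" using wt_pos[of y] by (simp add: c_def ln_div ln_sqrt)
      also have "\<dots> \<le> 1 + log_plus (norm y)"
      proof (cases "norm y \<le> 1")
        case True
        then have "wt y \<le> 1 + 1\<^sup>2" unfolding wt_def by (intro add_mono power_mono) auto
        moreover have "ln (wt y) \<le> wt y - 1" using wt_pos[of y] by (rule ln_le_minus_one)
        ultimately show ?thesis using lp by simp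
      next
        case False
        then have n0: "0 < norm y" by linarith
        have "1\<^sup>2 \<le> (norm y)\<^sup>2" using False by (intro power_mono) auto
        then have "wt y \<le> 2 * (norm y)\<^sup>2" by (simp add: wt_def)
        then have "ln (wt y) \<le> ln (2 * (norm y)\<^sup>2)" using wt_pos[of y] n0 by (subst ln_le_cancel_iff) auto
        also have "\<dots> = ln 2 + 2 * ln (norm y)" using n0 by (simp add: ln_mult ln_realpow)
        also have "\<dots> \<le> 1 + 2 * log_plus (norm y)"
          using ln_le_minus_one[of 2] by (simp add: log_plus_def)
        finally show ?thesis by simp
      qed
      finally show ?thesis .
    qed
    have "(\<integral>\<^sup>+x. local_kernel a \<kappa> T x y \<partial>gaussian) = (\<integral>\<^sup>+x. local_kernel a \<kappa> T x y * 1 \<partial>gaussian)" by simp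
    also have "\<dots> = (\<integral>\<^sup>+t. ennreal (1 / t) * (\<integral>\<^sup>+x. indicator {m_tilde x / \<kappa>..T} t
        * (ennreal (mehler (a * t\<^sup>2) y x) * 1) \<partial>gaussian) \<partial>lborel)"
      by (rule local_kernel_column) measurable
    also have "\<dots> \<le> (\<integral>\<^sup>+t. ennreal (D * wt y) * (ennreal t * indicator {0..c} t)
        + ennreal (1 / t) * indicator {c..T} t \<partial>lborel)"
      (is "_ \<le> (\<integral>\<^sup>+t. ?R t \<partial>lborel)")
    proof (intro nn_integral_mono)
      fix t :: real
      show "ennreal (1 / t) * (\<integral>\<^sup>+x. indicator {m_tilde x / \<kappa>..T} t
        * (ennreal (mehler (a * t\<^sup>2) y x) * 1) \<partial>gaussian) \<le> ?R t" (is "_ * ?I \<le> _")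
      proof (cases "0 < t")
        case t: True
        show ?thesis
        proof (cases "t \<le> c")
          case True
          have "ennreal (1 / t) * ?I \<le> ennreal (1 / t) * ennreal (D * (t\<^sup>2 * wt y))"
            using t D(2)[of t T y] by (intro mult_left_mono) auto
          also have "\<dots> = ennreal (D * wt y) * (ennreal t * indicator {0..c} t)"
            using t True D by (simp add: ennreal_mult[symmetric] power2_eq_square mult_ac)
          finally show ?thesis by (rule order_trans) simp
        next
          case False
          show ?thesis
          proof (cases "t \<le> T")
            case True
            have "?I \<le> (\<integral>\<^sup>+x. ennreal (mehler (a * t\<^sup>2) y x) \<partial>gaussian)"
              by (intro nn_integral_mono) (auto split: split_indicator)
            also have "\<dots> = 1"
              using t assms by (intro nn_integral_mehler_1) auto
            finally have "ennreal (1 / t) * ?I \<le> ennreal (1 / t) * 1"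
              by (intro mult_left_mono) auto
            also have "\<dots> = ennreal (1 / t) * indicator {c..T} t"
              using False True by simp
            finally show ?thesis by (rule order_trans) simp
          next
            case False
            then show ?thesis by simp
          qed
        qed
      qed (simp add: ennreal_neg)
    qed
    also have "\<dots> = ennreal (D / 2) + (\<integral>\<^sup>+t. ennreal (1 / t) * indicator {c..T} t \<partial>lborel)"
      using c D wt_pos[of y]
      by (simp add: nn_integral_add nn_integral_cmult nn_integral_ident ennreal_mult[symmetric])
    also have "\<dots> \<le> ennreal (D / 2) + ennreal (\<bar>ln T\<bar> + (1 + log_plus (norm y)))"
    proof (intro add_left_mono)
      show "(\<integral>\<^sup>+t. ennreal (1 / t) * indicator {c..T} t \<partial>lborel) \<le> ennreal (\<bar>ln T\<bar> + (1 + log_plus (norm y)))"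
      proof (cases "c \<le> T")
        case True
        then show ?thesis
          unfolding nn_integral_inverse[OF c(1) True] using lnc by (intro ennreal_leI) auto
      qed simp
    qed
    also have "\<dots> = ennreal (D / 2 + \<bar>ln T\<bar> + (1 + log_plus (norm y)))"
      using D lp by (simp add: ennreal_plus[symmetric] del: ennreal_plus)
    also have "\<dots> \<le> ennreal ((D / 2 + \<bar>ln T\<bar> + 1) * (1 + log_plus (norm y)))"
    proof (intro ennreal_leI)
      define u where "u = D / 2 + \<bar>ln T\<bar>"
      have "0 \<le> u * log_plus (norm y)" using D lp by (simp add: u_def)
      then show "D / 2 + \<bar>ln T\<bar> + (1 + log_plus (norm y)) \<le> (D / 2 + \<bar>ln T\<bar> + 1) * (1 + log_plus (norm y))"
        unfolding u_def[symmetric] by (simp add: algebra_simps)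
    qed
    finally show "(\<integral>\<^sup>+x. local_kernel a \<kappa> T x y \<partial>gaussian) \<le> ennreal ((D / 2 + \<bar>ln T\<bar> + 1) * (1 + log_plus (norm y)))" .
  qed
qed

section \<open>Differentiation of the heat kernel\<close>

text \<open>Dominated convergence for difference quotients along sequences. The parameter enters
  through the real factor only, so the mean value inequality is applied to \<phi> and the complex f
  y is a constant.\<close>

lemma has_vector_derivative_param_integral:
  fixes \<phi> \<phi>' :: "real \<Rightarrow> 'a \<Rightarrow> real" and f :: "'a \<Rightarrow> complex"
  assumes e: "0 < e"
    and deriv: "\<And>t y. \<bar>t - t0\<bar> < e \<Longrightarrow> ((\<lambda>t. \<phi> t y) has_real_derivative \<phi>' t y) (at t)"
    and bound: "\<And>t y. \<bar>t - t0\<bar> < e \<Longrightarrow> \<bar>\<phi>' t y\<bar> * norm (f y) \<le> g y"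
    and g: "integrable M g"
    and int: "\<And>t. \<bar>t - t0\<bar> < e \<Longrightarrow> integrable M (\<lambda>y. of_real (\<phi> t y) * f y)"
  shows "((\<lambda>t. LINT y|M. of_real (\<phi> t y) * f y) has_vector_derivative (LINT y|M. of_real (\<phi>' t0 y) * f y)) (at t0)"
proof -
  define U where "U = (\<lambda>t. LINT y|M. of_real (\<phi> t y) * f y)"
  define D where "D = (LINT y|M. of_real (\<phi>' t0 y) * f y)"
  have at: "at t0 = at t0 within {t0 - e<..<t0 + e}"
    using e by (subst at_within_open) auto
  have "((\<lambda>t. (U t - U t0) / of_real (t - t0)) \<longlongrightarrow> D) (at t0)"
    unfolding at tendsto_at_iff_sequentially
  proof (intro allI impI)
    fix X assume X: "\<forall>i. X i \<in> {t0 - e<..<t0 + e} - {t0}" and X0: "X \<longlonglongrightarrow> t0"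
    then have Xe: "\<bar>X i - t0\<bar> < e" "X i \<noteq> t0" for i by (auto simp: abs_less_iff dest!: spec[of _ i])
    have t0e: "\<bar>t0 - t0\<bar> < e" using e by simp
    define q where "q = (\<lambda>i y. of_real ((\<phi> (X i) y - \<phi> t0 y) / (X i - t0)) * f y)"
    have q_lim: "(\<lambda>i. q i y) \<longlonglongrightarrow> of_real (\<phi>' t0 y) * f y" for y
    proof -
      have "((\<lambda>t. (\<phi> t y - \<phi> t0 y) / (t - t0)) \<longlongrightarrow> \<phi>' t0 y) (at t0)"
        using deriv[OF t0e, of y] by (simp add: has_field_derivative_iff)
      then have "(\<lambda>i. (\<phi> (X i) y - \<phi> t0 y) / (X i - t0)) \<longlonglongrightarrow> \<phi>' t0 y"
        using X X0 unfolding at tendsto_at_iff_sequentially by (auto simp: comp_def)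
      then show ?thesis unfolding q_def by (intro tendsto_intros)
    qed
    have q_int: "integrable M (q i)" "(LINT y|M. q i y) = (U (X i) - U t0) / of_real (X i - t0)" for i
    proof -
      have *: "q i = (\<lambda>y. (of_real (\<phi> (X i) y) * f y - of_real (\<phi> t0 y) * f y) / of_real (X i - t0))"
        by (simp add: q_def fun_eq_iff algebra_simps diff_divide_distrib)
      show "integrable M (q i)" unfolding * using int[OF Xe(1)] int[OF t0e] by auto
      show "(LINT y|M. q i y) = (U (X i) - U t0) / of_real (X i - t0)"
        unfolding * U_def using int[OF Xe(1)] int[OF t0e] by simp
    qed
    have q_bound: "norm (q i y) \<le> g y" for i y
    proof -
      let ?S = "{t0 - e<..<t0 + e}"
      have *: "norm (\<phi> (X i) y - \<phi> t0 y) * norm (f y) \<le> g y * norm (X i - t0)"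
      \<comment> \<open>If f y vanishes, the domination says nothing about the derivative of \<phi>,
        but then the whole product is zero.\<close>
      proof (cases "f y = 0")
        case True
        have "0 \<le> g y" using bound[OF t0e, of y] True by simp
        then show ?thesis using True by simp
      next
        case False
        have "norm (\<phi> (X i) y - \<phi> t0 y) \<le> g y / norm (f y) * norm (X i - t0)"
        proof (rule field_differentiable_bound[of ?S "\<lambda>t. \<phi> t y" "\<lambda>t. \<phi>' t y"])
          fix t assume "t \<in> ?S"
          then have t: "\<bar>t - t0\<bar> < e" by auto
          show "((\<lambda>t. \<phi> t y) has_real_derivative \<phi>' t y) (at t within ?S)"
            using deriv[OF t] by (rule has_field_derivative_at_within)
          show "norm (\<phi>' t y) \<le> g y / norm (f y)"
            using bound[OF t, of y] False by (simp add: field_simps)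
        qed (use Xe[of i] e in auto)
        then show ?thesis using False by (simp add: field_simps)
      qed
      have "norm (q i y) = norm (\<phi> (X i) y - \<phi> t0 y) * norm (f y) / norm (X i - t0)"
        by (simp add: q_def norm_mult norm_divide del: of_real_diff)
      also have "\<dots> \<le> g y" using * Xe(2)[of i] by (simp add: divide_le_eq)
      finally show ?thesis .
    qed
    have "(\<lambda>i. LINT y|M. q i y) \<longlonglongrightarrow> D"
      unfolding D_def
    proof (rule integral_dominated_convergence)
      show "q i \<in> borel_measurable M" for i using q_int(1) by auto
      \<comment> \<open>Measurability is inherited as a pointwise limit of the difference
        quotients.\<close>
      show "(\<lambda>y. of_real (\<phi>' t0 y) * f y) \<in> borel_measurable M"
        by (rule borel_measurable_LIMSEQ_metric[where f=q]) (use q_int(1) q_lim in auto)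
    qed (use g q_lim q_bound in auto)
    then show "((\<lambda>t. (U t - U t0) / of_real (t - t0)) \<circ> X) \<longlonglongrightarrow> D"
      by (simp add: q_int(2) comp_def)
  qed
  then have "((\<lambda>t. norm ((U t - U t0) / of_real (t - t0) - D)) \<longlongrightarrow> 0) (at t0)"
    using tendsto_norm_zero LIM_zero by blast
  moreover have "\<forall>\<^sub>F t in at t0. norm ((U t - U t0) / of_real (t - t0) - D)
      = norm ((U t - U t0) - (t - t0) *\<^sub>R D) / norm (t - t0)"
  proof (rule eventually_mono[OF eventually_neq_at_within[of t0]])
    fix t assume t: "t \<noteq> t0"
    have "(U t - U t0) / of_real (t - t0) - D = ((U t - U t0) - (t - t0) *\<^sub>R D) / of_real (t - t0)"
      using t by (simp add: field_simps scaleR_conv_of_real)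
    then show "norm ((U t - U t0) / of_real (t - t0) - D) = norm ((U t - U t0) - (t - t0) *\<^sub>R D) / norm (t - t0)"
      by (simp add: norm_divide del: of_real_diff)
  qed
  ultimately have "((\<lambda>t. norm ((U t - U t0) - (t - t0) *\<^sub>R D) / norm (t - t0)) \<longlongrightarrow> 0) (at t0)"
    by (rule Lim_transform_eventually)
  then show ?thesis
    unfolding has_vector_derivative_def has_derivative_iff_norm U_def D_def
    by (simp add: bounded_linear_scaleR_left)
qed

text \<open>Multiplication by a coordinate spends half of \<epsilon> on the new factor and leaves
  the other half to the induction hypothesis, hence the induction with \<epsilon> arbitrary.\<close>

lemma poly_fn_bound:
  assumes "poly_fn f" "0 < \<epsilon>"
  obtains B where "0 \<le> B" "\<And>y. norm (f y) \<le> B * exp (\<epsilon> * (norm y)\<^sup>2)"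
proof -
  have "\<exists>B\<ge>0. \<forall>y. norm (f y) \<le> B * exp (\<epsilon> * (norm y)\<^sup>2)"
    using assms
  proof (induction arbitrary: \<epsilon> rule: poly_fn.induct)
    case (const c)
    then show ?case by (intro exI[of _ "norm c"]) (auto intro!: mult_left_le[of 1, simplified] simp: mult_le_cancel_left1)
  next
    case (coord g i)
    have e: "0 < \<epsilon> / 2" using coord.prems by simp
    obtain B where B: "B \<ge> 0" "\<And>y. norm (g y) \<le> B * exp (\<epsilon> / 2 * (norm y)\<^sup>2)"
      using coord.IH[OF e] by blast
    have "norm (of_real (y $ i) * g y) \<le> (1 + 2 / \<epsilon>) * B * exp (\<epsilon> * (norm y)\<^sup>2)" for y
    proof -
      have "0 \<le> (norm y - 1)\<^sup>2" by simp
      then have "norm y \<le> 1 + (norm y)\<^sup>2" using norm_ge_zero[of y] unfolding power2_diff by (simp only: power_one mult_1_right)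
      then have "\<bar>y $ i\<bar> \<le> 1 + (norm y)\<^sup>2" using component_le_norm_cart[of y i] by linarith
      also have "\<dots> \<le> (1 + 2 / \<epsilon>) * (1 + \<epsilon> / 2 * (norm y)\<^sup>2)"
        using coord.prems by (simp add: field_simps)
      also have "\<dots> \<le> (1 + 2 / \<epsilon>) * exp (\<epsilon> / 2 * (norm y)\<^sup>2)"
        using coord.prems by (intro mult_left_mono exp_ge_add_one_self) auto
      finally have "\<bar>y $ i\<bar> * norm (g y) \<le> (1 + 2 / \<epsilon>) * exp (\<epsilon> / 2 * (norm y)\<^sup>2) * (B * exp (\<epsilon> / 2 * (norm y)\<^sup>2))"
        by (intro mult_mono B) auto
      also have "\<dots> = (1 + 2 / \<epsilon>) * B * exp (\<epsilon> / 2 * (norm y)\<^sup>2 + \<epsilon> / 2 * (norm y)\<^sup>2)"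
        by (simp only: exp_add mult_ac)
      also have "\<epsilon> / 2 * (norm y)\<^sup>2 + \<epsilon> / 2 * (norm y)\<^sup>2 = \<epsilon> * (norm y)\<^sup>2" by simp
      finally show ?thesis by (simp add: norm_mult)
    qed
    then show ?case using B coord.prems by (intro exI[of _ "(1 + 2 / \<epsilon>) * B"]) auto
  next
    case (add g h)
    then obtain B C where B: "B \<ge> 0" "\<And>y. norm (g y) \<le> B * exp (\<epsilon> * (norm y)\<^sup>2)"
      and C: "C \<ge> 0" "\<And>y. norm (h y) \<le> C * exp (\<epsilon> * (norm y)\<^sup>2)" by meson
    then show ?case
      by (intro exI[of _ "B + C"]) (auto simp: distrib_right intro: order_trans[OF norm_triangle_ineq add_mono])
  qed
  then show ?thesis using that by blast
qed

text \<open>From |y|^2/2 - R^2 \<le> |y - rx|^2 and D \<le> 1 the kernel decays at the rate 1/2,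
  uniformly in the range of s and x. An eighth of the rate pays for 1 + |y|^2, which dominates the
  factors produced by differentiation; \<open>heat_poly_bound\<close> spends another eighth on the
  polynomial.\<close>

lemma heat_bound:
  fixes R s1 :: real
  assumes "0 < s1"
  obtains C where "0 < C" "\<And>s (x :: real ^ 'n) y. s1 \<le> s \<Longrightarrow> norm x \<le> R \<Longrightarrow>
    heat s x y * (1 + (norm y)\<^sup>2) \<le> C * exp (- (norm y)\<^sup>2 * (3 / 8))"
proof -
  define D1 where "D1 = 1 - exp (- 2 * s1)"
  define A where "A = pi powr (- real CARD('n) / 2) * D1 powr (- real CARD('n) / 2)"
  have D1: "0 < D1" "D1 \<le> 1" using assms by (auto simp: D1_def)
  have A: "0 < A" using D1 by (simp add: A_def)
  show ?thesis
  proof (rule that[of "A * exp (R\<^sup>2) * 8"])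
    show "0 < A * exp (R\<^sup>2) * 8" using A by simp
    fix s and x y :: "real ^ 'n" assume s: "s1 \<le> s" and x: "norm x \<le> R"
    define D where "D = 1 - exp (- 2 * s)"
    define r where "r = exp (- s)"
    have D: "D1 \<le> D" "D \<le> 1" using s by (auto simp: D_def D1_def)
    have r: "0 \<le> r" "r \<le> 1" using s assms by (auto simp: r_def)
    have "norm y \<le> norm (y - r *\<^sub>R x) + norm (r *\<^sub>R x)" using norm_triangle_ineq[of "y - r *\<^sub>R x" "r *\<^sub>R x"] by simp
    also have "norm (r *\<^sub>R x) \<le> 1 * R" unfolding norm_scaleR using r x by (intro mult_mono) auto
    finally have "norm y \<le> norm (y - r *\<^sub>R x) + R" by simp
    then have "(norm y)\<^sup>2 \<le> (norm (y - r *\<^sub>R x) + R)\<^sup>2" by (intro power_mono) auto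
    also have "\<dots> \<le> 2 * (norm (y - r *\<^sub>R x))\<^sup>2 + 2 * R\<^sup>2"
      using zero_le_power2[of "norm (y - r *\<^sub>R x) - R"] by (simp add: power2_sum power2_diff)
    finally have "(norm y)\<^sup>2 / 2 - R\<^sup>2 \<le> (norm (y - r *\<^sub>R x))\<^sup>2" by simp
    also have "\<dots> \<le> (norm (y - r *\<^sub>R x))\<^sup>2 / D"
      using D D1 by (simp add: le_divide_eq mult_left_le)
    finally have "exp (- (norm (y - r *\<^sub>R x))\<^sup>2 / D) \<le> exp (R\<^sup>2 - (norm y)\<^sup>2 / 2)" by simp
    moreover have "pi powr (- real CARD('n) / 2) * D powr (- real CARD('n) / 2) \<le> A"
      unfolding A_def using D D1 by (intro mult_left_mono powr_mono2') auto
    ultimately have "heat s x y \<le> A * exp (R\<^sup>2 - (norm y)\<^sup>2 / 2)"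
      unfolding heat_def r_def[symmetric] D_def[symmetric] using A by (intro mult_mono) auto
    moreover have "1 + (norm y)\<^sup>2 \<le> 8 * exp ((norm y)\<^sup>2 / 8)"
      using exp_ge_add_one_self[of "(norm y)\<^sup>2 / 8"] by linarith
    ultimately have "heat s x y * (1 + (norm y)\<^sup>2) \<le> A * exp (R\<^sup>2 - (norm y)\<^sup>2 / 2) * (8 * exp ((norm y)\<^sup>2 / 8))"
      using A by (intro mult_mono) auto
    also have "\<dots> = A * 8 * exp (R\<^sup>2 - (norm y)\<^sup>2 / 2 + (norm y)\<^sup>2 / 8)" by (simp only: exp_add mult_ac)
    also have "R\<^sup>2 - (norm y)\<^sup>2 / 2 + (norm y)\<^sup>2 / 8 = R\<^sup>2 + (- (norm y)\<^sup>2 * (3 / 8))" by simp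
    also have "A * 8 * exp \<dots> = A * exp (R\<^sup>2) * 8 * exp (- (norm y)\<^sup>2 * (3 / 8))" unfolding exp_add by simp
    finally show "heat s x y * (1 + (norm y)\<^sup>2) \<le> A * exp (R\<^sup>2) * 8 * exp (- (norm y)\<^sup>2 * (3 / 8))" .
  qed
qed

lemma integrable_exp_square:
  assumes "0 < A"
  shows "integrable lborel (\<lambda>y :: real ^ 'n. C * exp (- A * (norm y)\<^sup>2))"
proof -
  have "integrable lborel (\<lambda>y :: real ^ 'n. exp (- A * (norm (y - 0))\<^sup>2))"
    by (rule integrableI_bounded) (simp_all only: real_norm_def abs_exp_cancel nn_integral_exp_square[OF assms], auto)
  then show ?thesis by simp
qed

lemma heat_poly_bound:
  fixes f :: "real ^ 'n \<Rightarrow> complex" and R s1 :: real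
  assumes "poly_fn f" "0 < s1"
  obtains C where "0 \<le> C" "\<And>s x y. s1 \<le> s \<Longrightarrow> norm x \<le> R \<Longrightarrow>
    heat s x y * (1 + (norm y)\<^sup>2) * norm (f y) \<le> C * exp (- (1 / 4) * (norm y)\<^sup>2)"
proof -
  obtain A where A: "0 < A" "\<And>s (x :: real ^ 'n) y. s1 \<le> s \<Longrightarrow> norm x \<le> R \<Longrightarrow>
    heat s x y * (1 + (norm y)\<^sup>2) \<le> A * exp (- (norm y)\<^sup>2 * (3 / 8))"
    using heat_bound[OF assms(2)] by blast
  obtain B where B: "0 \<le> B" "\<And>y. norm (f y) \<le> B * exp (1 / 8 * (norm y)\<^sup>2)"
    using poly_fn_bound[OF assms(1), of "1/8"] by auto
  show ?thesis
  proof (rule that[of "A * B"])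
    show "0 \<le> A * B" using A B by simp
    fix s and x y :: "real ^ 'n" assume "s1 \<le> s" "norm x \<le> R"
    then have "heat s x y * (1 + (norm y)\<^sup>2) * norm (f y)
      \<le> A * exp (- (norm y)\<^sup>2 * (3 / 8)) * (B * exp (1 / 8 * (norm y)\<^sup>2))"
      using A(1) by (intro mult_mono A(2) B(2)) auto
    also have "\<dots> = A * B * exp (- (norm y)\<^sup>2 * (3 / 8) + 1 / 8 * (norm y)\<^sup>2)"
      by (simp only: exp_add mult_ac)
    also have "- (norm y)\<^sup>2 * (3 / 8) + 1 / 8 * (norm y)\<^sup>2 = - (1 / 4) * (norm y)\<^sup>2" by simp
    finally show "heat s x y * (1 + (norm y)\<^sup>2) * norm (f y) \<le> A * B * exp (- (1 / 4) * (norm y)\<^sup>2)" .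
  qed
qed

lemma integrable_heat_poly:
  fixes f :: "real ^ 'n \<Rightarrow> complex"
  assumes "poly_fn f" "0 < s"
  shows "integrable lborel (\<lambda>y. of_real (heat s x y) * f y)"
proof -
  note [measurable] = poly_fn_measurable[OF assms(1)]
  obtain C where C: "0 \<le> C" "\<And>y. heat s x y * (1 + (norm y)\<^sup>2) * norm (f y) \<le> C * exp (- (1 / 4) * (norm y)\<^sup>2)"
    using heat_poly_bound[OF assms, of "norm x"] by (metis order_refl)
  show ?thesis
  proof (rule Bochner_Integration.integrable_bound[OF integrable_exp_square[of "1/4" C]])
    show "AE y in lborel. norm (of_real (heat s x y) * f y) \<le> norm (C * exp (- (1 / 4) * (norm y)\<^sup>2))"
    proof (rule AE_I2)
      fix y
      have "heat s x y * 1 * norm (f y) \<le> heat s x y * (1 + (norm y)\<^sup>2) * norm (f y)"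
        by (intro mult_right_mono mult_left_mono) auto
      then show "norm (of_real (heat s x y) * f y) \<le> norm (C * exp (- (1 / 4) * (norm y)\<^sup>2))"
        using C(1) C(2)[of y] by (simp add: norm_mult)
    qed
  qed auto
qed

section \<open>Derivatives of the semigroup in time and in space\<close>

lemma OU_semigroup_heat:
  fixes f :: "real ^ 'n \<Rightarrow> complex"
  assumes [measurable]: "f \<in> borel_measurable borel" and "0 < s"
  shows "OU_semigroup s f x = (LINT y|lborel. of_real (heat s x y) * f y)"
proof -
  have "OU_semigroup s f x = (LINT y|lborel. (pi powr (- real CARD('n) / 2) * exp (- (norm y)\<^sup>2)) *\<^sub>R (of_real (mehler s x y) * f y))"
    unfolding OU_semigroup_def gaussian_def by (rule integral_density) auto
  also have "\<dots> = (LINT y|lborel. of_real (heat s x y) * f y)"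
    unfolding mehler_heat[OF assms(2), symmetric] by (simp add: scaleR_conv_of_real mult_ac)
  finally show ?thesis .
qed

text \<open>The kernel times its logarithmic derivative in s. The three terms come from the
  normalizing power, from the motion of the centre and from the growth of the variance, as 1 -
  e^{-2s} has derivative 2r^2.\<close>

definition heat_dt :: "real \<Rightarrow> real ^ 'n \<Rightarrow> real ^ 'n \<Rightarrow> real" where
  "heat_dt s x y = (let r = exp (- s); D = 1 - exp (- 2 * s) in
     heat s x y * (- real CARD('n) * r\<^sup>2 / D - 2 * r * (x \<bullet> (y - r *\<^sub>R x)) / D
       + 2 * r\<^sup>2 * (norm (y - r *\<^sub>R x))\<^sup>2 / D\<^sup>2))"

lemma heat_has_derivative_time:
  fixes x y :: "real ^ 'n"
  assumes "0 < s"
  shows "((\<lambda>s. heat s x y) has_real_derivative heat_dt s x y) (at s)"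
proof -
  define n where "n = real CARD('n)"
  define D where "D = 1 - exp (- 2 * s)"
  define r where "r = exp (- s)"
  have D: "0 < D" using assms by (simp add: D_def)
  have rD: "r\<^sup>2 = 1 - D" by (simp add: r_def D_def power2_eq_square flip: exp_add)
  have 1: "((\<lambda>s. (1 - exp (- 2 * s)) powr (- n / 2)) has_real_derivative (- n / 2) * D powr (- n / 2) / D * (2 * r\<^sup>2)) (at s)"
    using D unfolding rD
    by (auto intro!: derivative_eq_intros simp: D_def powr_diff)
  have 2: "((\<lambda>s. (norm (y - exp (- s) *\<^sub>R x))\<^sup>2) has_real_derivative 2 * r * (x \<bullet> (y - r *\<^sub>R x))) (at s)"
    unfolding power2_norm_eq_inner r_def has_field_derivative_def
    by (auto intro!: derivative_eq_intros simp: fun_eq_iff inner_commute algebra_simps)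
  have 3: "((\<lambda>s. - (norm (y - exp (- s) *\<^sub>R x))\<^sup>2 / (1 - exp (- 2 * s))) has_real_derivative
      - 2 * r * (x \<bullet> (y - r *\<^sub>R x)) / D + 2 * r\<^sup>2 * (norm (y - r *\<^sub>R x))\<^sup>2 / D\<^sup>2) (at s)"
  proof (rule DERIV_cong)
    have "exp (- 2 * s) = r\<^sup>2" by (simp add: r_def power2_eq_square flip: exp_add)
    then have "((\<lambda>s. 1 - exp (- 2 * s)) has_real_derivative 2 * r\<^sup>2) (at s)"
      by (auto intro!: derivative_eq_intros)
    then show "((\<lambda>s. - (norm (y - exp (- s) *\<^sub>R x))\<^sup>2 / (1 - exp (- 2 * s))) has_real_derivative
        (- (2 * r * (x \<bullet> (y - r *\<^sub>R x))) * D - - (norm (y - r *\<^sub>R x))\<^sup>2 * (2 * r\<^sup>2)) / (D * D)) (at s)"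
      using DERIV_divide[OF DERIV_minus[OF 2], of "\<lambda>s. 1 - exp (- 2 * s)" "2 * r\<^sup>2"] D
      unfolding D_def r_def by simp
  qed (use D in \<open>simp add: field_simps power2_eq_square\<close>)
  define P where "P = x \<bullet> (y - r *\<^sub>R x)"
  show ?thesis
    unfolding heat_def n_def[symmetric]
    by (rule DERIV_cong[OF DERIV_mult[OF DERIV_cmult[OF 1] DERIV_fun_exp[OF 3]]])
      (unfold heat_dt_def heat_def Let_def n_def[symmetric] D_def[symmetric] r_def[symmetric] P_def[symmetric],
        simp add: algebra_simps)
qed

lemma heat_has_derivative_space:
  fixes x y :: "real ^ 'n"
  assumes "0 < s"
  shows "((\<lambda>h. heat s (x + h *\<^sub>R axis i 1) y) has_real_derivative
    heat s (x + h *\<^sub>R axis i 1) y * (2 * exp (- s) * (y - exp (- s) *\<^sub>R (x + h *\<^sub>R axis i 1)) $ i / (1 - exp (- 2 * s)))) (at h)"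
proof -
  define D where "D = 1 - exp (- 2 * s)"
  define r where "r = exp (- s)"
  have D: "0 < D" using assms by (simp add: D_def)
  have 2: "((\<lambda>h. (norm (y - r *\<^sub>R (x + h *\<^sub>R axis i 1)))\<^sup>2) has_real_derivative - 2 * r * ((y - r *\<^sub>R (x + h *\<^sub>R axis i 1)) $ i)) (at h)"
    unfolding power2_norm_eq_inner has_field_derivative_def
    by (auto intro!: derivative_eq_intros simp: fun_eq_iff inner_axis inner_axis' inner_diff_left inner_diff_right algebra_simps)
  have 3: "((\<lambda>h. - (norm (y - r *\<^sub>R (x + h *\<^sub>R axis i 1)))\<^sup>2 / D) has_real_derivative
      2 * r * ((y - r *\<^sub>R (x + h *\<^sub>R axis i 1)) $ i) / D) (at h)"
    by (rule DERIV_cong[OF DERIV_cdivide[OF DERIV_minus[OF 2]]]) simp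
  show ?thesis
    unfolding heat_def D_def[symmetric] r_def[symmetric]
    by (rule DERIV_cong[OF DERIV_cmult[OF DERIV_fun_exp[OF 3]]]) simp
qed

text \<open>The two sides differ by (1 - |x||y|)^2. The product form separates the variables, as a
  dominating function of y requires.\<close>

lemma norm_sum_sq_le: "(norm y + norm x)\<^sup>2 \<le> (1 + (norm x)\<^sup>2) * (1 + (norm y)\<^sup>2)"
  using zero_le_power2[of "1 - norm x * norm y"] by (simp add: power2_sum power2_diff power_mult_distrib algebra_simps)

lemma norm_shift_le: "0 \<le> r \<Longrightarrow> r \<le> 1 \<Longrightarrow> norm (y - r *\<^sub>R x) \<le> norm y + norm x"
  by (rule order_trans[OF norm_triangle_ineq4]) (simp add: mult_left_le_one_le)

lemma heat_dt_bound:
  fixes x y :: "real ^ 'n"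
  assumes "0 < s1" "s1 \<le> s"
  defines "D1 \<equiv> 1 - exp (- 2 * s1)"
  shows "\<bar>heat_dt s x y\<bar> \<le> (real CARD('n) / D1 + 2 / D1 + 2 / D1\<^sup>2) * (1 + (norm x)\<^sup>2) * (heat s x y * (1 + (norm y)\<^sup>2))"
proof -
  define D where "D = 1 - exp (- 2 * s)"
  define r where "r = exp (- s)"
  define v where "v = y - r *\<^sub>R x"
  define Q where "Q = (1 + (norm x)\<^sup>2) * (1 + (norm y)\<^sup>2)"
  define n where "n = real CARD('n)"
  have D1: "0 < D1" "D1 \<le> D" using assms by (auto simp: D1_def D_def)
  have r: "0 \<le> r" "r \<le> 1" using assms by (auto simp: r_def)
  have r2: "r\<^sup>2 \<le> 1" using r by (simp add: power_le_one)
  have v: "norm v \<le> norm y + norm x" unfolding v_def using r by (rule norm_shift_le)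
  have Q: "(norm y + norm x)\<^sup>2 \<le> Q" unfolding Q_def by (rule norm_sum_sq_le)
  have Q1: "1 \<le> Q" unfolding Q_def using mult_mono[of 1 "1 + (norm x)\<^sup>2" 1 "1 + (norm y)\<^sup>2"] by simp
  have 1: "\<bar>- n * r\<^sup>2 / D\<bar> \<le> n / D1 * Q"
  proof -
    have "\<bar>- n * r\<^sup>2 / D\<bar> = n * r\<^sup>2 / D" using D1 by (simp add: n_def abs_mult)
    also have "\<dots> \<le> n * 1 / D1" using D1 r2 by (intro frac_le mult_left_mono) (auto simp: n_def)
    also have "\<dots> \<le> n / D1 * Q" using D1 Q1 mult_left_mono[OF Q1, of "n / D1"] by (simp add: n_def)
    finally show ?thesis .
  qed
  have 2: "\<bar>2 * r * (x \<bullet> v) / D\<bar> \<le> 2 / D1 * Q"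
  proof -
    have "\<bar>x \<bullet> v\<bar> \<le> norm x * norm v" by (rule Cauchy_Schwarz_ineq2)
    also have "\<dots> \<le> (norm y + norm x) * (norm y + norm x)" using v by (intro mult_mono) auto
    finally have *: "\<bar>x \<bullet> v\<bar> \<le> Q" using Q by (simp add: power2_eq_square)
    have "\<bar>2 * r * (x \<bullet> v) / D\<bar> = 2 * (r * \<bar>x \<bullet> v\<bar>) / D" using D1 r by (simp add: abs_mult)
    also have "\<dots> \<le> 2 * (1 * Q) / D1"
      using D1 r * Q1 by (intro frac_le mult_left_mono mult_mono) auto
    finally show ?thesis by simp
  qed
  have 3: "\<bar>2 * r\<^sup>2 * (norm v)\<^sup>2 / D\<^sup>2\<bar> \<le> 2 / D1\<^sup>2 * Q"
  proof -
    have *: "(norm v)\<^sup>2 \<le> Q" using power_mono[OF v norm_ge_zero, of 2] Q by linarith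
    have "\<bar>2 * r\<^sup>2 * (norm v)\<^sup>2 / D\<^sup>2\<bar> = 2 * (r\<^sup>2 * (norm v)\<^sup>2) / D\<^sup>2" by simp
    also have "\<dots> \<le> 2 * (1 * Q) / D1\<^sup>2"
      using D1 r2 * Q1 by (intro frac_le mult_left_mono mult_mono power_mono) auto
    finally show ?thesis by simp
  qed
  have "\<bar>- n * r\<^sup>2 / D - 2 * r * (x \<bullet> v) / D + 2 * r\<^sup>2 * (norm v)\<^sup>2 / D\<^sup>2\<bar>
    \<le> n / D1 * Q + 2 / D1 * Q + 2 / D1\<^sup>2 * Q"
    using 1 2 3 by linarith
  then have "heat s x y * \<bar>- n * r\<^sup>2 / D - 2 * r * (x \<bullet> v) / D + 2 * r\<^sup>2 * (norm v)\<^sup>2 / D\<^sup>2\<bar>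
     \<le> heat s x y * (n / D1 * Q + 2 / D1 * Q + 2 / D1\<^sup>2 * Q)"
    by (intro mult_left_mono) auto
  also have "\<dots> = (n / D1 + 2 / D1 + 2 / D1\<^sup>2) * (1 + (norm x)\<^sup>2) * (heat s x y * (1 + (norm y)\<^sup>2))"
    by (simp only: Q_def distrib_right distrib_left mult_ac)
  finally show ?thesis
    unfolding heat_dt_def Let_def n_def D_def r_def v_def by (simp add: abs_mult)
qed

lemma OU_semigroup_time_derivative:
  fixes f :: "real ^ 'n \<Rightarrow> complex"
  assumes f: "poly_fn f" and s: "0 < s"
  shows "((\<lambda>s. OU_semigroup s f x) has_vector_derivative (LINT y|lborel. of_real (heat_dt s x y) * f y)) (at s)"
proof -
  \<comment> \<open>Times within s/2 of s stay above s/2, where the Gaussian bounds are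
    uniform.\<close>
  define s1 where "s1 = s / 2"
  define D1 where "D1 = 1 - exp (- 2 * s1)"
  define K where "K = (real CARD('n) / D1 + 2 / D1 + 2 / D1\<^sup>2) * (1 + (norm x)\<^sup>2)"
  have s1: "0 < s1" using s by (simp add: s1_def)
  have D1: "0 < D1" using s1 by (simp add: D1_def)
  have K: "0 \<le> K" using D1 by (simp add: K_def)
  obtain C where C: "0 \<le> C" "\<And>s y. s1 \<le> s \<Longrightarrow>
    heat s x y * (1 + (norm y)\<^sup>2) * norm (f y) \<le> C * exp (- (1 / 4) * (norm y)\<^sup>2)"
    using heat_poly_bound[OF f s1, of "norm x"] by (metis order_refl)
  have pos: "s1 \<le> t" "0 < t" if "\<bar>t - s\<bar> < s1" for t using that s unfolding s1_def by linarith+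
  have "((\<lambda>s. LINT y|lborel. of_real (heat s x y) * f y) has_vector_derivative (LINT y|lborel. of_real (heat_dt s x y) * f y)) (at s)"
  proof (rule has_vector_derivative_param_integral[OF s1])
    show "((\<lambda>t. heat t x y) has_real_derivative heat_dt t x y) (at t)" if "\<bar>t - s\<bar> < s1" for t y
      by (rule heat_has_derivative_time[OF pos(2)[OF that]])
    show "\<bar>heat_dt t x y\<bar> * norm (f y) \<le> (K * C) * exp (- (1 / 4) * (norm y)\<^sup>2)" if "\<bar>t - s\<bar> < s1" for t y
    proof -
      have "\<bar>heat_dt t x y\<bar> * norm (f y) \<le> K * (heat t x y * (1 + (norm y)\<^sup>2)) * norm (f y)"
        unfolding K_def D1_def by (intro mult_right_mono heat_dt_bound s1 pos that) auto
      also have "\<dots> = K * (heat t x y * (1 + (norm y)\<^sup>2) * norm (f y))" by simp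
      also have "\<dots> \<le> K * (C * exp (- (1 / 4) * (norm y)\<^sup>2))"
        by (intro mult_left_mono C K pos that)
      finally show ?thesis by simp
    qed
    show "integrable lborel (\<lambda>y. of_real (heat t x y) * f y)" if "\<bar>t - s\<bar> < s1" for t
      by (rule integrable_heat_poly[OF f pos(2)[OF that]])
  qed (rule integrable_exp_square, simp)
  then show ?thesis
  proof (rule has_vector_derivative_transform_within_open[of _ _ _ "{0<..}"])
    show "(LINT y|lborel. of_real (heat t x y) * f y) = OU_semigroup t f x" if "t \<in> {0<..}" for t
      using that OU_semigroup_heat[OF poly_fn_measurable[OF f], of t x] by simp
  qed (use s in auto)
qed

text \<open>The x_i-derivative of the kernel multiplies it by 2r(y_i - r x_i)/(1 - r^2). Read
  backwards, the identity determines the semigroup on y_i f from the semigroup on f and its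
  derivative; this drives the induction over polynomials.\<close>

lemma OU_semigroup_space_derivative:
  fixes f :: "real ^ 'n \<Rightarrow> complex"
  assumes f: "poly_fn f" and s: "0 < s"
  shows "((\<lambda>h. OU_semigroup s f (x + h *\<^sub>R axis i 1)) has_vector_derivative
    of_real (2 * exp (- s) / (1 - exp (- 2 * s))) *
      (OU_semigroup s (\<lambda>y. of_real (y $ i) * f y) x - of_real (exp (- s) * x $ i) * OU_semigroup s f x)) (at 0)"
proof -
  define D where "D = 1 - exp (- 2 * s)"
  define r where "r = exp (- s)"
  define R where "R = norm x + 1"
  have D: "0 < D" using s by (simp add: D_def)
  have r: "0 \<le> r" "r \<le> 1" using s by (auto simp: r_def)
  have R: "0 \<le> R" by (simp add: R_def)
  obtain C where C: "0 \<le> C" "\<And>x y. norm x \<le> R \<Longrightarrow>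
    heat s x y * (1 + (norm y)\<^sup>2) * norm (f y) \<le> C * exp (- (1 / 4) * (norm y)\<^sup>2)"
    using heat_poly_bound[OF f s, of R] by (metis order_refl)
  define K where "K = 2 / D * (1 + R\<^sup>2)"
  have K: "0 \<le> K" using D by (simp add: K_def)
  have xh: "norm (x + h *\<^sub>R axis i 1) \<le> R" if "\<bar>h - 0\<bar> < 1" for h
    using that norm_triangle_ineq[of x "h *\<^sub>R axis i 1"] by (simp add: R_def norm_axis_1)
  note Pf = poly_fn.coord[OF f, of i]
  note I = integrable_heat_poly[OF f s, of x] integrable_heat_poly[OF Pf s, of x]
  have "((\<lambda>h. LINT y|lborel. of_real (heat s (x + h *\<^sub>R axis i 1) y) * f y) has_vector_derivative
    (LINT y|lborel. of_real (heat s (x + 0 *\<^sub>R axis i 1) y * (2 * r * (y - r *\<^sub>R (x + 0 *\<^sub>R axis i 1)) $ i / D)) * f y)) (at 0)"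
  proof (rule has_vector_derivative_param_integral[OF zero_less_one])
    show "((\<lambda>h. heat s (x + h *\<^sub>R axis i 1) y) has_real_derivative
       heat s (x + h *\<^sub>R axis i 1) y * (2 * r * (y - r *\<^sub>R (x + h *\<^sub>R axis i 1)) $ i / D)) (at h)" for h y
      unfolding r_def D_def by (rule heat_has_derivative_space[OF s])
    show "\<bar>heat s (x + h *\<^sub>R axis i 1) y * (2 * r * (y - r *\<^sub>R (x + h *\<^sub>R axis i 1)) $ i / D)\<bar> * norm (f y)
      \<le> (K * C) * exp (- (1 / 4) * (norm y)\<^sup>2)" if h: "\<bar>h - 0\<bar> < 1" for h y
    proof -
      define x' where "x' = x + h *\<^sub>R axis i 1"
      have x': "norm x' \<le> R" unfolding x'_def by (rule xh[OF h])
      define z where "z = norm y + norm x'"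
      have "\<bar>(y - r *\<^sub>R x') $ i\<bar> \<le> z"
        unfolding z_def by (rule order_trans[OF component_le_norm_cart norm_shift_le[OF r]])
      also have "z \<le> (1 + z\<^sup>2) / 2" using zero_le_power2[of "z - 1"] by (simp add: power2_diff)
      also have "\<dots> \<le> (1 + R\<^sup>2) * (1 + (norm y)\<^sup>2)"
      proof -
        have "z\<^sup>2 \<le> (1 + (norm x')\<^sup>2) * (1 + (norm y)\<^sup>2)" unfolding z_def by (rule norm_sum_sq_le)
        also have "\<dots> \<le> (1 + R\<^sup>2) * (1 + (norm y)\<^sup>2)" using x' by (intro mult_right_mono add_left_mono power_mono) auto
        moreover have "1 * 1 \<le> (1 + R\<^sup>2) * (1 + (norm y)\<^sup>2)" by (intro mult_mono) auto
        ultimately show ?thesis by simp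
      qed
      finally have "r * \<bar>(y - r *\<^sub>R x') $ i\<bar> \<le> 1 * ((1 + R\<^sup>2) * (1 + (norm y)\<^sup>2))"
        using r by (intro mult_mono) auto
      then have "2 / D * (r * \<bar>(y - r *\<^sub>R x') $ i\<bar>) \<le> 2 / D * (1 * ((1 + R\<^sup>2) * (1 + (norm y)\<^sup>2)))"
        using D by (intro mult_left_mono) auto
      then have "\<bar>2 * r * (y - r *\<^sub>R x') $ i / D\<bar> \<le> K * (1 + (norm y)\<^sup>2)"
        using r D by (simp add: K_def abs_mult mult.assoc distrib_left distrib_right)
      then have "heat s x' y * \<bar>2 * r * (y - r *\<^sub>R x') $ i / D\<bar> * norm (f y) \<le> heat s x' y * (K * (1 + (norm y)\<^sup>2)) * norm (f y)"
        by (intro mult_right_mono mult_left_mono) auto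
      also have "\<dots> = K * (heat s x' y * (1 + (norm y)\<^sup>2) * norm (f y))" by simp
      also have "\<dots> \<le> K * (C * exp (- (1 / 4) * (norm y)\<^sup>2))" using x' by (intro mult_left_mono C K)
      finally show ?thesis unfolding x'_def[symmetric] by (simp add: abs_mult)
    qed
    show "integrable lborel (\<lambda>y. of_real (heat s (x + h *\<^sub>R axis i 1) y) * f y)" for h
      by (rule integrable_heat_poly[OF f s])
  qed (rule integrable_exp_square, simp)
  also have "(LINT y|lborel. of_real (heat s (x + 0 *\<^sub>R axis i 1) y * (2 * r * (y - r *\<^sub>R (x + 0 *\<^sub>R axis i 1)) $ i / D)) * f y)
    = (LINT y|lborel. of_real (2 * r / D) * (of_real (heat s x y) * (of_real (y $ i) * f y) - of_real (r * x $ i) * (of_real (heat s x y) * f y)))"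
    by (intro Bochner_Integration.integral_cong) (simp_all add: algebra_simps diff_divide_distrib)
  also have "\<dots> = of_real (2 * r / D) * (OU_semigroup s (\<lambda>y. of_real (y $ i) * f y) x - of_real (r * x $ i) * OU_semigroup s f x)"
    unfolding OU_semigroup_heat[OF poly_fn_measurable[OF f] s] OU_semigroup_heat[OF poly_fn_measurable[OF Pf] s]
    using I by (subst integral_mult_right_zero, subst Bochner_Integration.integral_diff) auto
  finally show ?thesis
    unfolding r_def D_def OU_semigroup_heat[OF poly_fn_measurable[OF f] s] .
qed

lemma OU_semigroup_const: "0 < s \<Longrightarrow> OU_semigroup s (\<lambda>_. c) x = c"
proof -
  assume s: "0 < s"
  have "integrable gaussian (\<lambda>y. mehler s x y)" "(LINT y|gaussian. mehler s x y) = 1"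
    using nn_integral_mehler_1[OF s, of x] by (auto intro!: integrableI_bounded simp: integral_eq_nn_integral)
  then have "(LINT y|gaussian. complex_of_real (mehler s x y)) = 1"
    by (simp only: integral_of_real of_real_1)
  then show ?thesis
    unfolding OU_semigroup_def by simp
qed

lemma OU_semigroup_add:
  assumes "poly_fn f" "poly_fn g" "0 < s"
  shows "OU_semigroup s (\<lambda>x. f x + g x) x = OU_semigroup s f x + OU_semigroup s g x"
  unfolding OU_semigroup_heat[OF poly_fn_measurable[OF assms(1)] assms(3)]
    OU_semigroup_heat[OF poly_fn_measurable[OF assms(2)] assms(3)]
    OU_semigroup_heat[OF poly_fn_measurable[OF poly_fn.add[OF assms(1,2)]] assms(3)]
  using integrable_heat_poly[OF assms(1,3), of x] integrable_heat_poly[OF assms(2,3), of x]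
  by (simp add: distrib_left)

section \<open>Spectral expansion and large times\<close>

text \<open>Multiplying by a coordinate amounts to the \<open>x\<close>-derivative of the heat kernel, so the expansion
  of \<open>e\<^bsup>-sL\<^esup>f\<close> passes from \<open>f\<close> to \<open>y\<^sub>i f\<close> through \<open>x\<^sub>i g = (x\<^sub>i g - \<partial>\<^sub>i g / 2) + \<partial>\<^sub>i g / 2\<close>,
  which raises and lowers the degree of each Hermite component.\<close>

lemma OU_semigroup_expansion:
  fixes f :: "real ^ 'n \<Rightarrow> complex"
  assumes "poly_fn f"
  obtains n g where "\<And>k. herm k (g k)"
    "\<And>s x. 0 < s \<Longrightarrow> OU_semigroup s f x = (\<Sum>k\<le>n. of_real (exp (- s) ^ k) * g k x)"
proof -
  \<comment> \<open>That g k vanishes for k > n is part of the induction so that sums may be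
    extended and shifted at will.\<close>
  have "\<exists>n g. (\<forall>k. herm k (g k)) \<and> (\<forall>k>n. g k = (\<lambda>_. 0)) \<and>
    (\<forall>s x. 0 < s \<longrightarrow> OU_semigroup s f x = (\<Sum>k\<le>n. of_real (exp (- s) ^ k) * g k x))"
    using assms
  proof (induction rule: poly_fn.induct)
    case (const c)
    show ?case
      by (rule exI[of _ 0], rule exI[of _ "\<lambda>k. if k = 0 then (\<lambda>_. c) else (\<lambda>_. 0)"])
        (auto intro: herm.intros simp: OU_semigroup_const)
  next
    case (coord f i)
    then obtain n g where g: "\<And>k. herm k (g k)" "\<And>k. k > n \<Longrightarrow> g k = (\<lambda>_. 0)"
      and U: "\<And>s x. 0 < s \<Longrightarrow> OU_semigroup s f x = (\<Sum>k\<le>n. of_real (exp (- s) ^ k) * g k x)" by blast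
    define A where "A = (\<lambda>k x. of_real (x $ i) * g k x - partial_deriv i (g k) x / 2)"
    define B where "B = (\<lambda>k x. partial_deriv i (g k) x / 2)"
    have A: "herm (Suc k) (A k)" for k unfolding A_def by (rule herm.raise[OF g(1)])
    have B: "herm (k - 1) (B k)" for k
      unfolding B_def using herm_cmult[of "k - 1" "partial_deriv i (g k)" "1/2"] herm_partial_deriv[OF g(1), of k i] by simp
    have B0: "B 0 = (\<lambda>_. 0)" using herm_partial_deriv[OF g(1), of 0 i] by (simp add: B_def)
    have An: "A k = (\<lambda>_. 0)" "B k = (\<lambda>_. 0)" if "k > n" for k
      using that by (simp_all add: A_def B_def g(2))
    \<comment> \<open>The component of degree k of y_i f is what is raised from degree k - 1 plus
      what is lowered from degree k + 1.\<close>
    define g' where "g' = (\<lambda>k x. (if k = 0 then 0 else A (k - 1) x) + B (Suc k) x)"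
    have G1: "herm k (g' k)" for k
      unfolding g'_def using A[of "k - 1"] B[of "Suc k"] by (cases k) (auto intro!: herm.add herm.zero)
    have G2: "g' k = (\<lambda>_. 0)" if "k > Suc n" for k
      using that by (simp add: g'_def An)
    have G3: "OU_semigroup s (\<lambda>x. of_real (x $ i) * f x) x = (\<Sum>k\<le>Suc n. of_real (exp (- s) ^ k) * g' k x)"
      if s: "0 < s" for s x
    proof -
      define r where "r = complex_of_real (exp (- s))"
      define D where "D = complex_of_real (1 - exp (- 2 * s))"
      define V where "V = OU_semigroup s (\<lambda>x. of_real (x $ i) * f x) x"
      have r: "r \<noteq> 0" by (simp add: r_def)
      have D: "D \<noteq> 0" using s by (simp add: D_def del: of_real_diff)
      have Dr: "D = 1 - r * r" by (simp add: D_def r_def flip: of_real_mult exp_add)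
      have S: "OU_semigroup s f x = (\<Sum>k\<le>n. r ^ k * g k x)" for x
        using U[OF s] by (simp add: r_def)
      have "((\<lambda>h. \<Sum>k\<le>n. r ^ k * g k (x + h *\<^sub>R axis i 1)) has_vector_derivative
        (\<Sum>k\<le>n. r ^ k * partial_deriv i (g k) x)) (at 0)"
      proof (intro has_vector_derivative_sum has_vector_derivative_mult_right)
        fix k
        have "((\<lambda>h. g k (x + h *\<^sub>R axis i 1)) has_derivative (\<lambda>h. frechet_derivative (g k) (at x) (h *\<^sub>R axis i 1))) (at 0)"
        proof (rule has_derivative_compose[of "\<lambda>h. x + h *\<^sub>R axis i 1" "\<lambda>h. h *\<^sub>R axis i 1" 0 UNIV "g k"])
          show "((\<lambda>h. x + h *\<^sub>R axis i 1) has_derivative (\<lambda>h. h *\<^sub>R axis i 1)) (at 0)"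
            by (auto intro!: derivative_eq_intros)
          show "(g k has_derivative frechet_derivative (g k) (at x)) (at (x + 0 *\<^sub>R axis i 1))"
            using poly_fn_has_derivative[OF herm_poly_fn[OF g(1)], of k x] by simp
        qed
        moreover have "frechet_derivative (g k) (at x) (h *\<^sub>R axis i 1) = h *\<^sub>R partial_deriv i (g k) x" for h
          unfolding partial_deriv_def
          by (rule linear_scale[OF linear_frechet_derivative[OF poly_fn_differentiable[OF herm_poly_fn[OF g(1)]]]])
        ultimately show "((\<lambda>h. g k (x + h *\<^sub>R axis i 1)) has_vector_derivative partial_deriv i (g k) x) (at 0)"
          by (simp add: has_vector_derivative_def)
      qed
      moreover have "((\<lambda>h. \<Sum>k\<le>n. r ^ k * g k (x + h *\<^sub>R axis i 1)) has_vector_derivative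
        2 * r / D * (V - r * of_real (x $ i) * (\<Sum>k\<le>n. r ^ k * g k x))) (at 0)"
        using OU_semigroup_space_derivative[OF coord.hyps s, of x i]
        unfolding S V_def D_def r_def by simp
      \<comment> \<open>The same derivative computed termwise and from the kernel; the equation is
        then solved for V.\<close>
      ultimately have "(\<Sum>k\<le>n. r ^ k * partial_deriv i (g k) x) = 2 * r / D * (V - r * of_real (x $ i) * (\<Sum>k\<le>n. r ^ k * g k x))"
        by (rule vector_derivative_unique_at)
      then have "D * (\<Sum>k\<le>n. r ^ k * partial_deriv i (g k) x) = 2 * r * (V - r * of_real (x $ i) * (\<Sum>k\<le>n. r ^ k * g k x))"
        using D by (simp add: field_simps)
      then have "2 * (r * V) = D * (\<Sum>k\<le>n. r ^ k * partial_deriv i (g k) x) + 2 * r * r * of_real (x $ i) * (\<Sum>k\<le>n. r ^ k * g k x)"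
        by (simp add: algebra_simps)
      also have "\<dots> = 2 * (\<Sum>k\<le>n. D * (r ^ k * B k x) + r * r * (r ^ k * (of_real (x $ i) * g k x)))"
        by (simp add: B_def sum_distrib_left sum.distrib algebra_simps)
      \<comment> \<open>Because x_i g_k = A_k + B_k and D + r^2 = 1, the lowered part has
        coefficient r^k and the raised part r^{k+2}. After division by r these are the powers
        belonging to the degrees k - 1 and k + 1.\<close>
      also have "\<dots> = 2 * (\<Sum>k\<le>n. r * (r * (r ^ k * A k x)) + r ^ k * B k x)"
      proof (intro arg_cong[of _ _ "\<lambda>z. 2 * z"] sum.cong refl)
        fix k
        have "of_real (x $ i) * g k x = A k x + B k x" by (simp add: A_def B_def)
        then show "D * (r ^ k * B k x) + r * r * (r ^ k * (of_real (x $ i) * g k x)) = r * (r * (r ^ k * A k x)) + r ^ k * B k x"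
          by (simp only: Dr) (simp add: algebra_simps)
      qed
      also have "\<dots> = 2 * (r * (\<Sum>k\<le>n. r * (r ^ k * A k x)) + (\<Sum>k\<le>n. r ^ k * B k x))"
        by (simp add: sum.distrib sum_distrib_left)
      \<comment> \<open>Two zero terms are added at the top; then \<open>B0\<close> removes the
        bottom term, which is what allows a factor r to be taken out.\<close>
      also have "(\<Sum>k\<le>n. r ^ k * B k x) = (\<Sum>k\<le>Suc (Suc n). r ^ k * B k x)"
        by (simp add: An)
      also have "\<dots> = r * (\<Sum>k\<le>Suc n. r ^ k * B (Suc k) x)"
        by (subst sum.atMost_Suc_shift) (simp add: B0 sum_distrib_left mult.assoc distrib_left)
      also have "(\<Sum>k\<le>n. r * (r ^ k * A k x)) = (\<Sum>k\<le>Suc n. r ^ k * (if k = 0 then 0 else A (k - 1) x))"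
        by (subst sum.atMost_Suc_shift) (simp add: mult.assoc)
      finally have twice: "2 * (r * V) = 2 * (r * (\<Sum>k\<le>Suc n. r ^ k * (if k = 0 then 0 else A (k - 1) x)) + r * (\<Sum>k\<le>Suc n. r ^ k * B (Suc k) x))" .
      have "(2::complex) \<noteq> 0" by simp
      from mult_left_cancel[OF this, THEN iffD1, OF twice]
      have "r * V = r * (\<Sum>k\<le>Suc n. r ^ k * (if k = 0 then 0 else A (k - 1) x)) + r * (\<Sum>k\<le>Suc n. r ^ k * B (Suc k) x)" .
      also have "\<dots> = r * (\<Sum>k\<le>Suc n. r ^ k * g' k x)"
        by (simp only: g'_def distrib_left sum.distrib)
      finally have "r * V = r * (\<Sum>k\<le>Suc n. r ^ k * g' k x)" .
      then show ?thesis using r by (simp add: V_def r_def del: sum.atMost_Suc)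
    qed
    show ?case
      by (rule exI[of _ "Suc n"], rule exI[of _ g']) (intro conjI allI impI G1 G2 G3)
  next
    case (add f1 f2)
    let ?P = "\<lambda>f n g. (\<forall>k. herm k (g k)) \<and> (\<forall>k>n. g k = (\<lambda>_. 0)) \<and>
      (\<forall>s x. 0 < s \<longrightarrow> OU_semigroup s f x = (\<Sum>k\<le>n. of_real (exp (- s) ^ k) * g k x))"
    from add.IH(1) obtain n1 g1 where 1: "?P f1 n1 g1" by (elim exE)
    from add.IH(2) obtain n2 g2 where 2: "?P f2 n2 g2" by (elim exE)
    have ext: "(\<Sum>k\<le>n. of_real (exp (- s) ^ k) * g k x) = (\<Sum>k\<le>max n1 n2. of_real (exp (- s) ^ k) * g k x)"
      if "n \<le> max n1 n2" "\<And>k. k > n \<Longrightarrow> g k = (\<lambda>_. 0)" for n s x and g :: "nat \<Rightarrow> real ^ 'n \<Rightarrow> complex"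
      using that by (intro sum.mono_neutral_left) auto
    have "OU_semigroup s (\<lambda>x. f1 x + f2 x) x = (\<Sum>k\<le>max n1 n2. of_real (exp (- s) ^ k) * (g1 k x + g2 k x))"
      if "0 < s" for s x
    proof -
      have "OU_semigroup s f1 x = (\<Sum>k\<le>max n1 n2. of_real (exp (- s) ^ k) * g1 k x)"
        using 1 that by (subst ext[symmetric, of n1]) auto
      moreover have "OU_semigroup s f2 x = (\<Sum>k\<le>max n1 n2. of_real (exp (- s) ^ k) * g2 k x)"
        using 2 that by (subst ext[symmetric, of n2]) auto
      ultimately show ?thesis
        by (simp add: OU_semigroup_add[OF add.hyps that] distrib_left sum.distrib)
    qed
    then have "?P (\<lambda>x. f1 x + f2 x) (max n1 n2) (\<lambda>k x. g1 k x + g2 k x)"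
      using 1 2 by (auto intro: herm.add)
    then show ?case by (intro exI)
  qed
  then obtain n g where "\<forall>k. herm k (g k)"
    "\<forall>s x. 0 < s \<longrightarrow> OU_semigroup s f x = (\<Sum>k\<le>n. of_real (exp (- s) ^ k) * g k x)"
    by (elim exE conjE)
  then show ?thesis by (intro that[of g n]) simp_all
qed

text \<open>Write M_s = e^F. Each term of F carries a factor r = e^{-s}, so |F| \<le> rX with X =
  3(|x|^2 + |y|^2) + n/2, and |e^F - 1| \<le> |F| e^{|F|}. One factor r is kept as the decay; the
  remaining X is absorbed by exp(\<epsilon>X)/\<epsilon>, and 2\<epsilon>X gives the exponents
  6\<epsilon>.\<close>

lemma mehler_minus_one_bound:
  fixes x y :: "real ^ 'n"
  assumes "0 < \<epsilon>" "\<epsilon> \<le> 1 / 2" "exp (- s) \<le> \<epsilon>"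
  shows "\<bar>mehler s x y - 1\<bar> \<le> exp (- s) * (exp (\<epsilon> * real CARD('n)) / \<epsilon>)
    * (exp (6 * \<epsilon> * (norm x)\<^sup>2) * exp (6 * \<epsilon> * (norm y)\<^sup>2))"
proof -
  define r where "r = exp (- s)"
  define n where "n = real CARD('n)"
  define Z where "Z = (norm x)\<^sup>2 + (norm y)\<^sup>2"
  have r: "0 < r" "r \<le> \<epsilon>" "r \<le> 1 / 2" using assms by (auto simp: r_def)
  have n: "0 \<le> n" by (simp add: n_def)
  have Z: "0 \<le> Z" by (simp add: Z_def)
  have D: "3 / 4 \<le> 1 - r * r" using r mult_mono[of r "1/2" r "1/2"] by simp
  define L where "L = - ln (1 - r * r)"
  have L: "0 \<le> L" "L \<le> r"
  proof -
    show "0 \<le> L" using D r by (simp add: L_def)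
    have "L = ln (1 / (1 - r * r))" using D by (simp add: L_def ln_div)
    \<comment> \<open>The bound is of second order in r; with r \<le> 1/2 it is at most 2r/3, so a
      first order bound for L results.\<close>
    also have "\<dots> \<le> 1 / (1 - r * r) - 1" using D by (intro ln_le_minus_one) auto
    also have "\<dots> = r * r / (1 - r * r)" using D by (simp add: field_simps)
    also have "\<dots> \<le> r * r / (3 / 4)" using D r by (intro divide_left_mono) auto
    also have "\<dots> \<le> r * (1 / 2) / (3 / 4)" using r by (intro divide_right_mono mult_left_mono) auto
    also have "\<dots> \<le> r" using r by simp
    finally show "L \<le> r" .
  qed
  define F where "F = n / 2 * L - r / (1 - r * r) * (norm (x - y))\<^sup>2 + r / (1 + r) * Z"
  have m: "mehler s x y = exp F"
  proof -
    have "1 / (1 - r * r) powr (n / 2) = exp (n / 2 * L)"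
      using D by (simp add: powr_def L_def exp_minus inverse_eq_divide)
    then show ?thesis
      unfolding mehler_def exp_neg_two r_def[symmetric] n_def[symmetric] Z_def[symmetric] F_def
      by (simp flip: exp_add exp_diff)
  qed
  define X where "X = 3 * Z + n / 2"
  have X: "0 \<le> X" using Z n by (simp add: X_def)
  have Fr: "\<bar>F\<bar> \<le> r * X"
  proof -
    have "(norm (x - y))\<^sup>2 \<le> (norm x + norm y)\<^sup>2"
      by (intro power_mono norm_triangle_ineq4) auto
    also have "\<dots> \<le> 2 * Z"
      using zero_le_power2[of "norm x - norm y"] by (simp add: Z_def power2_sum power2_diff)
    finally have d: "(norm (x - y))\<^sup>2 \<le> 2 * Z" .
    have rZ: "0 \<le> r * Z" using Z r by simp
    have "r / (1 - r * r) * (norm (x - y))\<^sup>2 \<le> r / (3 / 4) * (2 * Z)"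
      using d r D by (intro mult_mono divide_left_mono) auto
    also have "\<dots> = 8 / 3 * (r * Z)" by simp
    also have "\<dots> \<le> 3 * (r * Z)" using rZ by (intro mult_right_mono) auto
    finally have 1: "r / (1 - r * r) * (norm (x - y))\<^sup>2 \<le> 3 * (r * Z)" .
    have p1: "0 \<le> r / (1 - r * r) * (norm (x - y))\<^sup>2" using r D by simp
    have "r / (1 + r) * Z \<le> r / 1 * Z" using r Z by (intro mult_right_mono divide_left_mono) auto
    then have 2: "r / (1 + r) * Z \<le> r * Z" by simp
    have p2: "0 \<le> r / (1 + r) * Z" using r Z by simp
    have 3: "n / 2 * L \<le> n / 2 * r" "0 \<le> n / 2 * L" using L n by (auto intro!: mult_left_mono)
    have "0 \<le> r * Z" using r Z by simp
    moreover have "r * X = 3 * (r * Z) + n / 2 * r" by (simp add: X_def algebra_simps)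
    moreover have "0 \<le> n / 2 * r" using n r by simp
    ultimately show ?thesis unfolding F_def using 1 p1 2 p2 3 by linarith
  qed
  have "\<bar>exp F - 1\<bar> \<le> \<bar>F\<bar> * exp \<bar>F\<bar>"
  proof (cases "0 \<le> F")
    case True
    have "exp F * (1 - F) \<le> exp F * exp (- F)" using exp_ge_add_one_self[of "- F"] by (intro mult_left_mono) auto
    then have "exp F - 1 \<le> F * exp F" by (simp add: algebra_simps flip: exp_add)
    then show ?thesis using True by simp
  next
    case False
    have "1 - exp F \<le> \<bar>F\<bar> * 1" using exp_ge_add_one_self[of F] False by linarith
    also have "\<dots> \<le> \<bar>F\<bar> * exp \<bar>F\<bar>" by (intro mult_left_mono) auto
    finally show ?thesis using False by simp
  qed
  also have "\<dots> \<le> (r * X) * exp (r * X)" using Fr by (intro mult_mono) auto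
  also have "\<dots> \<le> (r * (exp (\<epsilon> * X) / \<epsilon>)) * exp (\<epsilon> * X)"
  proof (intro mult_mono mult_left_mono)
    have "\<epsilon> * X \<le> exp (\<epsilon> * X)" using exp_ge_add_one_self[of "\<epsilon> * X"] by linarith
    then show "X \<le> exp (\<epsilon> * X) / \<epsilon>" using assms by (simp add: field_simps)
    show "exp (r * X) \<le> exp (\<epsilon> * X)" using r X by (simp add: mult_right_mono)
  qed (use r X assms in auto)
  also have "\<dots> = r * (exp (\<epsilon> * X + \<epsilon> * X) / \<epsilon>)" unfolding exp_add by simp
  also have "\<epsilon> * X + \<epsilon> * X = \<epsilon> * n + (6 * \<epsilon> * (norm x)\<^sup>2 + 6 * \<epsilon> * (norm y)\<^sup>2)"
    by (simp add: X_def Z_def algebra_simps)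
  also have "r * (exp \<dots> / \<epsilon>) = r * (exp (\<epsilon> * n) / \<epsilon>) * (exp (6 * \<epsilon> * (norm x)\<^sup>2) * exp (6 * \<epsilon> * (norm y)\<^sup>2))"
    by (simp add: exp_add)
  finally show ?thesis unfolding m r_def n_def .
qed

lemma integrable_gaussian_poly:
  fixes f :: "real ^ 'n \<Rightarrow> complex"
  assumes "poly_fn f" "0 < s"
  shows "integrable gaussian (\<lambda>y. of_real (mehler s x y) * f y)"
proof -
  note [measurable] = poly_fn_measurable[OF assms(1)]
  have "integrable lborel (\<lambda>y. (pi powr (- real CARD('n) / 2) * exp (- (norm y)\<^sup>2)) *\<^sub>R (of_real (mehler s x y) * f y))"
    using integrable_heat_poly[OF assms, of x] unfolding mehler_heat[OF assms(2), symmetric]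
    by (simp add: scaleR_conv_of_real mult_ac)
  then show ?thesis
    unfolding gaussian_def by (subst integrable_density) auto
qed

lemma integrable_gaussian_exp_poly:
  fixes f :: "real ^ 'n \<Rightarrow> complex"
  assumes "poly_fn f" "\<epsilon> < 1"
  shows "integrable gaussian (\<lambda>y. of_real (exp (\<epsilon> * (norm y)\<^sup>2)) * f y)"
proof -
  note [measurable] = poly_fn_measurable[OF assms(1)]
  define \<eta> where "\<eta> = (1 - \<epsilon>) / 2"
  have \<eta>: "0 < \<eta>" using assms by (simp add: \<eta>_def)
  obtain B where B: "0 \<le> B" "\<And>y. norm (f y) \<le> B * exp (\<eta> * (norm y)\<^sup>2)"
    using poly_fn_bound[OF assms(1) \<eta>] by blast
  have "integrable lborel (\<lambda>y. (pi powr (- real CARD('n) / 2) * exp (- (norm y)\<^sup>2)) *\<^sub>R (of_real (exp (\<epsilon> * (norm y)\<^sup>2)) * f y))"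
  proof (rule Bochner_Integration.integrable_bound[OF integrable_exp_square[OF \<eta>, of "pi powr (- real CARD('n) / 2) * B"]])
    show "AE y in lborel. norm ((pi powr (- real CARD('n) / 2) * exp (- (norm y)\<^sup>2)) *\<^sub>R (of_real (exp (\<epsilon> * (norm y)\<^sup>2)) * f y))
      \<le> norm (pi powr (- real CARD('n) / 2) * B * exp (- \<eta> * (norm y)\<^sup>2))"
    proof (rule AE_I2)
      fix y :: "real ^ 'n"
      have "exp (- (norm y)\<^sup>2) * (exp (\<epsilon> * (norm y)\<^sup>2) * norm (f y))
        \<le> exp (- (norm y)\<^sup>2) * (exp (\<epsilon> * (norm y)\<^sup>2) * (B * exp (\<eta> * (norm y)\<^sup>2)))"
        by (intro mult_left_mono B) auto
      also have "\<dots> = B * exp (- (norm y)\<^sup>2 + \<epsilon> * (norm y)\<^sup>2 + \<eta> * (norm y)\<^sup>2)"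
        by (simp only: exp_add mult_ac)
      also have "- (norm y)\<^sup>2 + \<epsilon> * (norm y)\<^sup>2 + \<eta> * (norm y)\<^sup>2 = - \<eta> * (norm y)\<^sup>2"
        by (simp add: \<eta>_def field_simps)
      finally have "pi powr (- real CARD('n) / 2) * (exp (- (norm y)\<^sup>2) * (exp (\<epsilon> * (norm y)\<^sup>2) * norm (f y)))
        \<le> pi powr (- real CARD('n) / 2) * (B * exp (- \<eta> * (norm y)\<^sup>2))"
        by (intro mult_left_mono) auto
      then show "norm ((pi powr (- real CARD('n) / 2) * exp (- (norm y)\<^sup>2)) *\<^sub>R (of_real (exp (\<epsilon> * (norm y)\<^sup>2)) * f y))
        \<le> norm (pi powr (- real CARD('n) / 2) * B * exp (- \<eta> * (norm y)\<^sup>2))"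
        using B by (simp add: norm_mult mult.assoc)
    qed
  qed measurable
  then show ?thesis
    unfolding gaussian_def by (subst integrable_density) auto
qed

text \<open>Since f has integral zero, the constant 1 may be subtracted from the kernel. The
  condition \<epsilon> < 1/6 keeps 6\<epsilon> below 1, so that the weighted integral of the
  polynomial is finite.\<close>

lemma OU_semigroup_mean_zero_bound:
  fixes f :: "real ^ 'n \<Rightarrow> complex"
  assumes f: "poly_fn f" "(LINT y|gaussian. f y) = 0" and \<epsilon>: "0 < \<epsilon>" "\<epsilon> < 1 / 6" "exp (- s) \<le> \<epsilon>"
  shows "norm (OU_semigroup s f x) \<le> exp (- s) * (exp (\<epsilon> * real CARD('n)) / \<epsilon>)
    * (exp (6 * \<epsilon> * (norm x)\<^sup>2) * (LINT y|gaussian. exp (6 * \<epsilon> * (norm y)\<^sup>2) * norm (f y)))"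
proof -
  have s: "0 < s"
  proof (rule ccontr)
    assume "\<not> 0 < s"
    then have "1 \<le> exp (- s)" by simp
    then show False using \<epsilon> by linarith
  qed
  note [measurable] = poly_fn_measurable[OF f(1)]
  define K where "K = exp (- s) * (exp (\<epsilon> * real CARD('n)) / \<epsilon>)"
  have K: "0 \<le> K" using \<epsilon> by (simp add: K_def)
  have i: "integrable gaussian f"
    using integrable_gaussian_exp_poly[OF f(1), of 0] by simp
  have i2: "integrable gaussian (\<lambda>y. exp (6 * \<epsilon> * (norm y)\<^sup>2) * norm (f y))"
    using integrable_norm[OF integrable_gaussian_exp_poly[OF f(1), of "6 * \<epsilon>"]] \<epsilon> by (simp add: norm_mult)
  have "OU_semigroup s f x = (LINT y|gaussian. of_real (mehler s x y) * f y) - (LINT y|gaussian. f y)"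
    by (simp add: OU_semigroup_def f(2))
  also have "\<dots> = (LINT y|gaussian. of_real (mehler s x y - 1) * f y)"
    by (subst Bochner_Integration.integral_diff[symmetric, OF integrable_gaussian_poly[OF f(1) s] i]) (simp add: algebra_simps)
  finally have eq: "OU_semigroup s f x = (LINT y|gaussian. of_real (mehler s x y - 1) * f y)" .
  have "norm (OU_semigroup s f x) \<le> (LINT y|gaussian. K * exp (6 * \<epsilon> * (norm x)\<^sup>2) * (exp (6 * \<epsilon> * (norm y)\<^sup>2) * norm (f y)))"
    unfolding eq
  proof (rule Bochner_Integration.integral_norm_bound_integral)
    show "integrable gaussian (\<lambda>y. of_real (mehler s x y - 1) * f y)"
      using Bochner_Integration.integrable_diff[OF integrable_gaussian_poly[OF f(1) s, of x] i] by (simp add: algebra_simps)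
    show "integrable gaussian (\<lambda>y. K * exp (6 * \<epsilon> * (norm x)\<^sup>2) * (exp (6 * \<epsilon> * (norm y)\<^sup>2) * norm (f y)))"
      by (intro integrable_mult_right i2)
    fix y :: "real ^ 'n"
    have "\<bar>mehler s x y - 1\<bar> * norm (f y) \<le> K * (exp (6 * \<epsilon> * (norm x)\<^sup>2) * exp (6 * \<epsilon> * (norm y)\<^sup>2)) * norm (f y)"
      unfolding K_def using \<epsilon> by (intro mult_right_mono mehler_minus_one_bound) auto
    then show "norm (of_real (mehler s x y - 1) * f y) \<le> K * exp (6 * \<epsilon> * (norm x)\<^sup>2) * (exp (6 * \<epsilon> * (norm y)\<^sup>2) * norm (f y))"
      by (simp add: norm_mult mult.assoc del: of_real_diff)
  qed
  then show ?thesis unfolding K_def by (simp add: mult.assoc)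
qed

text \<open>As s tends to infinity the expansion tends to its component of degree 0, while the mean
  zero bound forces the limit 0. So the sum starts at k = 1, and the semigroup and its time
  derivatives decay like e^{-s}.\<close>

lemma mean_zero_expansion:
  fixes f :: "real ^ 'n \<Rightarrow> complex"
  assumes f: "mean_zero_polynomial f"
  obtains n g where "\<And>k. herm k (g k)"
    "\<And>s x. 0 < s \<Longrightarrow> OU_semigroup s f x = (\<Sum>k=1..n. of_real (exp (- real k * s)) * g k x)"
proof -
  have p: "poly_fn f" "(LINT y|gaussian. f y) = 0"
    using f by (auto simp: mean_zero_polynomial_def intro: poly_fn_of_polynomial_function)
  obtain n g where g: "\<And>k. herm k (g k)"
    and U: "\<And>s x. 0 < s \<Longrightarrow> OU_semigroup s f x = (\<Sum>k\<le>n. of_real (exp (- s) ^ k) * g k x)"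
    by (rule OU_semigroup_expansion[OF p(1)]) (rule that)
  have "g 0 x = 0" for x
  proof -
    have r0: "((\<lambda>s. exp (- s)) \<longlongrightarrow> (0::real)) at_top" by real_asymp
    have "((\<lambda>s. \<Sum>k\<le>n. of_real (exp (- s) ^ k) * g k x) \<longlongrightarrow> (\<Sum>k\<le>n. of_real (0 ^ k) * g k x)) at_top"
      by (intro tendsto_intros r0)
    also have "(\<Sum>k\<le>n. of_real (0 ^ k) * g k x) = g 0 x"
      by (subst sum.mono_neutral_right[of _ "{0}"]) auto
    finally have "((\<lambda>s. OU_semigroup s f x) \<longlongrightarrow> g 0 x) at_top"
      by (rule Lim_transform_eventually) (rule eventually_mono[OF eventually_gt_at_top[of 0]], rule U[symmetric])
    moreover have "((\<lambda>s. OU_semigroup s f x) \<longlongrightarrow> 0) at_top"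
    proof -
      define \<epsilon> where "\<epsilon> = (1 / 12 :: real)"
      define K where "K = exp (\<epsilon> * real CARD('n)) / \<epsilon>
        * (exp (6 * \<epsilon> * (norm x)\<^sup>2) * (LINT y|gaussian. exp (6 * \<epsilon> * (norm y)\<^sup>2) * norm (f y)))"
      have "((\<lambda>s. exp (- s) * K) \<longlongrightarrow> 0 * K) at_top" by (intro tendsto_intros r0)
      moreover have "\<forall>\<^sub>F s in at_top. norm (OU_semigroup s f x) \<le> exp (- s) * K"
        using order_tendstoD(2)[OF r0, of \<epsilon>]
      proof (rule eventually_mono)
        show "exp (- s) < \<epsilon> \<Longrightarrow> norm (OU_semigroup s f x) \<le> exp (- s) * K" for s
          using OU_semigroup_mean_zero_bound[OF p, of \<epsilon> s x] by (simp add: \<epsilon>_def K_def mult.assoc)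
      qed (simp add: \<epsilon>_def)
      ultimately show ?thesis by (simp add: Lim_null_comparison)
    qed
    ultimately show ?thesis using tendsto_unique[of at_top] by force
  qed
  then have "OU_semigroup s f x = (\<Sum>k=1..n. of_real (exp (- real k * s)) * g k x)" if "0 < s" for s x
    unfolding U[OF that] exp_of_nat_mult[symmetric]
    by (intro sum.mono_neutral_cong_right) (auto simp: not_less_eq_eq)
  then show ?thesis using that g by blast
qed

section \<open>A Harnack inequality and the boundary terms\<close>

text \<open>For \<open>s\<bar>x\<bar>\<^sup>2\<close> bounded the kernel at time \<open>s\<close> and its time derivative are dominated by the kernel at
  any comparable later time: the shift of the centre is \<open>O(s\<bar>x\<bar>) = O(\<surd>s)\<close>, and the larger variance
  absorbs the polynomial factor of the derivative.\<close>

lemma heat_harnack: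
  fixes x y :: "real ^ 'n"
  assumes s: "0 < s" "s \<le> 1 / 8" "s * (norm x)\<^sup>2 \<le> 1 / 8" and s': "2 * s \<le> s'" "s' \<le> 4 * s"
  shows "s * \<bar>heat_dt s x y\<bar> + heat s x y
    \<le> ((real CARD('n) + 14) * exp (81 / 8) * 8 powr (real CARD('n) / 2)) * heat s' x y"
proof -
  define n where "n = real CARD('n)"
  define r where "r = exp (- s)"
  define r' where "r' = exp (- s')"
  define D where "D = 1 - exp (- 2 * s)"
  define D' where "D' = 1 - exp (- 2 * s')"
  define v where "v = norm (y - r *\<^sub>R x)"
  define v' where "v' = norm (y - r' *\<^sub>R x)"
  define q where "q = v\<^sup>2 / D"
  define P where "P = pi powr (- n / 2)"
  have n: "0 \<le> n" by (simp add: n_def)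
  have v: "0 \<le> v" "0 \<le> v'" by (simp_all add: v_def v'_def)
  have r: "0 < r" "r \<le> 1" "0 < r'" "r' \<le> r" using s s' by (auto simp: r_def r'_def)
  \<comment> \<open>This bounds the shift of the centre; s' - s \<le> 3s because s' \<le>
    4s.\<close>
  have rr: "r - r' \<le> 3 * s"
  proof -
    have "r' = r * exp (- (s' - s))" by (simp add: r_def r'_def flip: exp_add)
    moreover have "1 - (s' - s) \<le> exp (- (s' - s))" using exp_ge_add_one_self[of "- (s' - s)"] by linarith
    ultimately have "r - r' = r * (1 - exp (- (s' - s)))" by (simp add: algebra_simps)
    also have "\<dots> \<le> 1 * (s' - s)" using r s s' \<open>1 - (s' - s) \<le> exp (- (s' - s))\<close> by (intro mult_mono) auto
    finally show ?thesis using s' by simp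
  qed
  have Ds: "s \<le> D" "D \<le> 2 * s"
  proof -
    show "D \<le> 2 * s" unfolding D_def using exp_ge_add_one_self[of "- 2 * s"] by simp
    have "1 + 2 * s \<le> exp (2 * s)" by (rule exp_ge_add_one_self)
    then have "exp (- 2 * s) \<le> 1 / (1 + 2 * s)" using s by (simp add: exp_minus field_simps)
    also have "\<dots> \<le> 1 - s"
    proof -
      have "s * s \<le> s * (1 / 8)" using s by (intro mult_left_mono) auto
      then have "1 \<le> (1 - s) * (1 + 2 * s)" using s by (simp add: algebra_simps)
      then show ?thesis using s by (simp add: divide_le_eq)
    qed
    finally show "s \<le> D" by (simp add: D_def)
  qed
  have D: "0 < D" using Ds s by simp
  \<comment> \<open>The chain is D' \<le> 2s' \<le> 8s \<le> 8D; it accounts for the power of 8 in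
    the constant.\<close>
  have D'8: "D' \<le> 8 * D"
    using exp_ge_add_one_self[of "- 2 * s'"] s' Ds unfolding D'_def by linarith
  \<comment> \<open>Already at time 2s the variance has grown by the factor 1 + e^{-2s} \<ge> 3/2.
    This strict gain is what absorbs the polynomial factor below.\<close>
  have DD': "3 / 2 * D \<le> D'"
  proof -
    define e where "e = exp (- 2 * s)"
    have "exp (- 2 * s') \<le> exp (- 4 * s)" using s' by simp
    also have "exp (- 4 * s) = e * e" by (simp add: e_def flip: exp_add)
    finally have "(1 - e) * (1 + e) \<le> D'" by (simp add: D'_def algebra_simps)
    moreover have "1 / 2 \<le> e" using exp_ge_add_one_self[of "- 2 * s"] s by (simp add: e_def)
    moreover have De: "D = 1 - e" by (simp add: D_def e_def)
    ultimately have "D * (3 / 2) \<le> D * (1 + e)" using D by (intro mult_left_mono) auto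
    then show ?thesis using \<open>(1 - e) * (1 + e) \<le> D'\<close> De by simp
  qed
  then have D': "0 < D'" "s \<le> D'" using D Ds by auto
  have q: "0 \<le> q" using D by (simp add: q_def)
  have vq: "v\<^sup>2 = D * q" using D by (simp add: q_def)
  have dt: "s * \<bar>heat_dt s x y\<bar> \<le> heat s x y * (n + 1 + 3 * q)"
  proof -
    have sD: "s / D \<le> 1" "0 \<le> s / D" using Ds s D by (auto simp: divide_le_eq)
    have r2: "r\<^sup>2 \<le> 1" "0 \<le> r\<^sup>2" using r by (auto simp: power_le_one)
    have 1: "\<bar>s * (- n * r\<^sup>2 / D)\<bar> \<le> n"
    proof -
      have "\<bar>s * (- n * r\<^sup>2 / D)\<bar> = n * (r\<^sup>2 * (s / D))" using s D n by (simp add: abs_mult)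
      also have "\<dots> \<le> n * (1 * 1)" using n r2 sD by (intro mult_left_mono mult_mono) auto
      finally show ?thesis by simp
    qed
    have 2: "\<bar>s * (2 * r * (x \<bullet> (y - r *\<^sub>R x)) / D)\<bar> \<le> 1 / 4 + q"
    proof -
      have "\<bar>s * (2 * r * (x \<bullet> (y - r *\<^sub>R x)) / D)\<bar> = 2 * (r * (s / D) * \<bar>x \<bullet> (y - r *\<^sub>R x)\<bar>)"
        using s D r by (simp add: abs_mult)
      also have "\<dots> \<le> 2 * (1 * 1 * (norm x * v))"
        using r sD unfolding v_def by (intro mult_left_mono mult_mono Cauchy_Schwarz_ineq2) auto
      \<comment> \<open>Here the smallness of s|x|^2 enters: the first term is at most 2s|x|^2 \<le>
        1/4.\<close>
      also have "\<dots> \<le> D * (norm x)\<^sup>2 + v\<^sup>2 / D"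
      proof -
        have "0 \<le> (D * norm x - v)\<^sup>2" by simp
        then have "2 * (norm x * v) * D \<le> (D * (norm x)\<^sup>2 + v\<^sup>2 / D) * D"
          using D by (simp add: power2_diff power_mult_distrib power2_eq_square algebra_simps)
        then show ?thesis using D by (simp add: mult_le_cancel_right)
      qed
      also have "D * (norm x)\<^sup>2 \<le> 2 * s * (norm x)\<^sup>2" using Ds by (intro mult_right_mono) auto
      finally show ?thesis using s by (simp add: q_def)
    qed
    have 3: "\<bar>s * (2 * r\<^sup>2 * (norm (y - r *\<^sub>R x))\<^sup>2 / D\<^sup>2)\<bar> \<le> 2 * q"
    proof -
      have "\<bar>s * (2 * r\<^sup>2 * (norm (y - r *\<^sub>R x))\<^sup>2 / D\<^sup>2)\<bar> = 2 * (r\<^sup>2 * (s / D) * q)"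
        using s D by (simp add: abs_mult q_def v_def power2_eq_square)
      also have "\<dots> \<le> 2 * (1 * 1 * q)" using r2 sD q by (intro mult_left_mono mult_mono) auto
      finally show ?thesis by simp
    qed
    define E where "E = - n * r\<^sup>2 / D - 2 * r * (x \<bullet> (y - r *\<^sub>R x)) / D + 2 * r\<^sup>2 * (norm (y - r *\<^sub>R x))\<^sup>2 / D\<^sup>2"
    have "s * E = s * (- n * r\<^sup>2 / D) - s * (2 * r * (x \<bullet> (y - r *\<^sub>R x)) / D) + s * (2 * r\<^sup>2 * (norm (y - r *\<^sub>R x))\<^sup>2 / D\<^sup>2)"
      by (simp add: E_def algebra_simps)
    moreover have "\<bar>S\<bar> \<le> n + 1 + 3 * q" if "S = A - B + C" "\<bar>A\<bar> \<le> n" "\<bar>B\<bar> \<le> 1 / 4 + q" "\<bar>C\<bar> \<le> 2 * q" for S A B C :: real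
      using that by linarith
    ultimately have "\<bar>s * E\<bar> \<le> n + 1 + 3 * q" using 1 2 3 by blast
    then have "heat s x y * \<bar>s * E\<bar> \<le> heat s x y * (n + 1 + 3 * q)" by (intro mult_left_mono) auto
    moreover have "heat_dt s x y = heat s x y * E"
      unfolding heat_dt_def Let_def E_def r_def D_def n_def by simp
    ultimately show ?thesis using s by (simp add: abs_mult mult_ac)
  qed
  have q': "v'\<^sup>2 / D' \<le> 3 / 4 * q + 81 / 8"
  proof -
    have "y - r' *\<^sub>R x = (y - r *\<^sub>R x) + (r - r') *\<^sub>R x" by (simp add: algebra_simps)
    then have "v' \<le> v + norm ((r - r') *\<^sub>R x)" unfolding v_def v'_def by (metis norm_triangle_ineq)
    also have "norm ((r - r') *\<^sub>R x) \<le> 3 * s * norm x"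
      using r rr by (simp add: mult_right_mono)
    finally have "v'\<^sup>2 \<le> (v + 3 * s * norm x)\<^sup>2" using v by (intro power_mono) auto
    \<comment> \<open>The weight 9/8 is chosen so that division by the variance gain 3/2 leaves 3/4
      q; its counterpart 9 times (3s|x|)^2 yields the constant 81/8.\<close>
    also have "\<dots> \<le> 9 / 8 * v\<^sup>2 + 9 * (3 * s * norm x)\<^sup>2"
    proof -
      have "0 \<le> (v - 8 * (3 * s * norm x))\<^sup>2" by simp
      then show ?thesis unfolding power2_sum power2_diff by (simp add: power_mult_distrib)
    qed
    also have "9 * (3 * s * norm x)\<^sup>2 = 81 * s * (s * (norm x)\<^sup>2)"
      by (simp add: power_mult_distrib power2_eq_square)
    also have "\<dots> \<le> 81 * s * (1 / 8)" using s by (intro mult_left_mono) auto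
    also have "\<dots> \<le> 81 / 8 * D'" using D' by simp
    also have "9 / 8 * v\<^sup>2 \<le> 3 / 4 * q * D'"
    proof -
      have "q * (3 / 2 * D) \<le> q * D'" using DD' q by (intro mult_left_mono)
      then show ?thesis unfolding vq by (simp add: mult_ac)
    qed
    finally have "v'\<^sup>2 \<le> (3 / 4 * q + 81 / 8) * D'" by (simp add: algebra_simps)
    then show ?thesis using D' by (simp add: divide_le_eq)
  qed
  \<comment> \<open>The spare quarter of the exponent pays for the linear factor, as 3q \<le> 12
    exp(q/4); hence n + 14.\<close>
  have qe: "(n + 2 + 3 * q) * exp (- q) \<le> (n + 14) * exp (81 / 8) * exp (- (v'\<^sup>2 / D'))"
  proof -
    have "q / 4 \<le> exp (q / 4)" using exp_ge_add_one_self[of "q / 4"] by linarith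
    moreover have "1 \<le> exp (q / 4)" using q by simp
    then have "(n + 2) * 1 \<le> (n + 2) * exp (q / 4)" using n by (intro mult_left_mono) auto
    ultimately have "n + 2 + 3 * q \<le> (n + 14) * exp (q / 4)" by (simp add: algebra_simps)
    then have "(n + 2 + 3 * q) * exp (- q) \<le> (n + 14) * exp (q / 4) * exp (- q)" by (intro mult_right_mono) auto
    also have "\<dots> = (n + 14) * exp (- (3 / 4 * q))" by (simp add: mult.assoc flip: exp_add)
    also have "\<dots> \<le> (n + 14) * exp (81 / 8 + - (v'\<^sup>2 / D'))" using q' n by (intro mult_left_mono) auto
    finally show ?thesis by (simp only: exp_add mult.assoc)
  qed
  have pw: "D powr (- n / 2) \<le> 8 powr (n / 2) * D' powr (- n / 2)"
  proof -
    have "D powr (- n / 2) \<le> (D' / 8) powr (- n / 2)" using D'8 D' n by (intro powr_mono2') auto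
    also have "\<dots> = 8 powr (n / 2) * D' powr (- n / 2)"
      using D' by (simp add: powr_divide powr_minus field_simps)
    finally show ?thesis .
  qed
  have "s * \<bar>heat_dt s x y\<bar> + heat s x y \<le> heat s x y * (n + 2 + 3 * q)" using dt by (simp add: algebra_simps)
  also have "\<dots> = P * (D powr (- n / 2) * ((n + 2 + 3 * q) * exp (- q)))"
    unfolding heat_def P_def n_def D_def q_def v_def r_def by simp
  also have "\<dots> \<le> P * ((8 powr (n / 2) * D' powr (- n / 2)) * ((n + 14) * exp (81 / 8) * exp (- (v'\<^sup>2 / D'))))"
    using n q by (intro mult_left_mono mult_mono[OF pw qe]) (auto simp: P_def)
  also have "\<dots> = ((n + 14) * exp (81 / 8) * 8 powr (n / 2)) * heat s' x y"
    unfolding heat_def P_def n_def D'_def v'_def r'_def by simp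
  finally show ?thesis unfolding n_def .
qed

text \<open>If f is not integrable, its Bochner integral is 0 and the bound is trivial.\<close>

lemma ennreal_norm_integral_le:
  fixes f :: "'a \<Rightarrow> 'b :: {banach, second_countable_topology}"
  shows "ennreal (norm (LINT y|M. f y)) \<le> (\<integral>\<^sup>+y. ennreal (norm (f y)) \<partial>M)"
  by (cases "integrable M f") (auto simp: integral_norm_bound_ennreal not_integrable_integral_eq)

lemma OU_semigroup_le_nn_integral:
  "ennreal (norm (OU_semigroup s f x)) \<le> (\<integral>\<^sup>+y. ennreal (mehler s x y) * ennreal (norm (f y)) \<partial>gaussian)"
  unfolding OU_semigroup_def
  by (rule order_trans[OF ennreal_norm_integral_le]) (simp add: norm_mult ennreal_mult)

text \<open>A value at the single time s_0 is not controlled by an integral over times, but the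
  Harnack inequality bounds it by the value at any s in [2s_0, 4s_0], and averaging over such s
  produces \<open>local_kernel\<close>. From a \<le> 2 and \<kappa> \<ge> 4 one gets s_0 \<le> 1/8
  and s_0|x|^2 \<le> 1/8, and T \<ge> 1/2 makes room for the averaging interval.\<close>

lemma boundary_term_bound:
  fixes f :: "real ^ 'n \<Rightarrow> complex" and x :: "real ^ 'n" and a \<kappa> T :: real
  assumes f: "poly_fn f" and a: "0 < a" "a \<le> 2" and \<kappa>: "4 \<le> \<kappa>" and T: "1 / 2 \<le> T"
  defines "C \<equiv> 4 * ((real CARD('n) + 14) * exp (81 / 8) * 8 powr (real CARD('n) / 2))"
  defines "s0 \<equiv> a * (m_tilde x / \<kappa>)\<^sup>2"
  shows "ennreal (s0 * norm (vector_derivative (\<lambda>s. OU_semigroup s f x) (at s0)))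
      \<le> ennreal C * (\<integral>\<^sup>+y. local_kernel a \<kappa> T x y * ennreal (norm (f y)) \<partial>gaussian)" (is "ennreal ?A \<le> _")
    and "ennreal (norm (OU_semigroup s0 f x))
      \<le> ennreal C * (\<integral>\<^sup>+y. local_kernel a \<kappa> T x y * ennreal (norm (f y)) \<partial>gaussian)" (is "ennreal ?B \<le> _")
proof -
  note [measurable] = poly_fn_measurable[OF f]
  define C0 where "C0 = (real CARD('n) + 14) * exp (81 / 8) * 8 powr (real CARD('n) / 2)"
  have C0: "0 \<le> C0" by (simp add: C0_def)
  define t0 where "t0 = m_tilde x / \<kappa>"
  have t0: "0 < t0" using m_tilde_bounds(1)[of x] \<kappa> by (simp add: t0_def)
  have "m_tilde x / \<kappa> \<le> 1 / 4" using m_tilde_bounds(1,2)[of x] \<kappa> by (intro frac_le) auto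
  then have t04: "t0 \<le> 1 / 4" by (simp add: t0_def)
  have s0: "0 < s0" using a t0 by (simp add: s0_def t0_def[symmetric])
  have s0le: "s0 \<le> 1 / 8"
  proof -
    have "a * t0\<^sup>2 \<le> 2 * (1 / 4)\<^sup>2" using a t0 t04 by (intro mult_mono power_mono) auto
    then show ?thesis by (simp add: s0_def t0_def[symmetric] power2_eq_square)
  qed
  have s0x: "s0 * (norm x)\<^sup>2 \<le> 1 / 8"
  proof -
    have "t0 * norm x = (m_tilde x * norm x) / \<kappa>" by (simp add: t0_def)
    also have "\<dots> \<le> 1 / 4" using m_tilde_bounds(1,3)[of x] \<kappa> by (intro frac_le) auto
    finally have "a * (t0 * norm x)\<^sup>2 \<le> 2 * (1 / 4)\<^sup>2" using a t0 by (intro mult_mono power_mono) auto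
    then show ?thesis by (simp add: s0_def t0_def[symmetric] power2_eq_square mult_ac)
  qed
  define Q where "Q = (\<lambda>s. \<integral>\<^sup>+y. ennreal (mehler s x y) * ennreal (norm (f y)) \<partial>gaussian)"
  have key: "ennreal ?A \<le> ennreal C0 * Q s" "ennreal ?B \<le> ennreal C0 * Q s" if s: "2 * s0 \<le> s" "s \<le> 4 * s0" for s
  proof -
    have "0 < s" using s s0 by simp
    have Qs: "ennreal C0 * Q s = (\<integral>\<^sup>+y. ennreal (C0 * heat s x y * norm (f y)) \<partial>lborel)"
      unfolding Q_def nn_integral_mehler[OF _ \<open>0 < s\<close>, of "\<lambda>y. ennreal (norm (f y))", simplified]
      using C0 by (subst nn_integral_cmult[symmetric]) (simp_all add: ennreal_mult mult.assoc)
    have h: "s0 * \<bar>heat_dt s0 x y\<bar> + heat s0 x y \<le> C0 * heat s x y" for y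
      unfolding C0_def by (rule heat_harnack[OF s0 s0le s0x s])
    have "vector_derivative (\<lambda>s. OU_semigroup s f x) (at s0) = (LINT y|lborel. of_real (heat_dt s0 x y) * f y)"
      by (rule vector_derivative_at[OF OU_semigroup_time_derivative[OF f s0]])
    then have "ennreal ?A = ennreal s0 * ennreal (norm (LINT y|lborel. of_real (heat_dt s0 x y) * f y))"
      using s0 by (simp add: ennreal_mult)
    also have "\<dots> = ennreal (norm (LINT y|lborel. of_real s0 * (of_real (heat_dt s0 x y) * f y)))"
      using s0 by (subst integral_mult_right_zero) (simp add: norm_mult ennreal_mult)
    also have "\<dots> \<le> (\<integral>\<^sup>+y. ennreal (norm (of_real s0 * (of_real (heat_dt s0 x y) * f y))) \<partial>lborel)"
      by (rule ennreal_norm_integral_le)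
    also have "\<dots> \<le> (\<integral>\<^sup>+y. ennreal (C0 * heat s x y * norm (f y)) \<partial>lborel)"
    proof (intro nn_integral_mono ennreal_leI)
      fix y
      have "s0 * \<bar>heat_dt s0 x y\<bar> * norm (f y) \<le> C0 * heat s x y * norm (f y)"
        using h[of y] heat_nonneg[of s0 x y] by (intro mult_right_mono) (linarith, rule norm_ge_zero)
      then show "norm (of_real s0 * (of_real (heat_dt s0 x y) * f y)) \<le> C0 * heat s x y * norm (f y)"
        using s0 by (simp add: norm_mult mult.assoc)
    qed
    finally show "ennreal ?A \<le> ennreal C0 * Q s" unfolding Qs .
    have "ennreal ?B \<le> (\<integral>\<^sup>+y. ennreal (norm (of_real (heat s0 x y) * f y)) \<partial>lborel)"
      unfolding OU_semigroup_heat[OF poly_fn_measurable[OF f] s0] by (rule ennreal_norm_integral_le)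
    also have "\<dots> \<le> (\<integral>\<^sup>+y. ennreal (C0 * heat s x y * norm (f y)) \<partial>lborel)"
    proof (intro nn_integral_mono ennreal_leI)
      fix y
      have "0 \<le> s0 * \<bar>heat_dt s0 x y\<bar>" using s0 by simp
      then have "heat s0 x y * norm (f y) \<le> C0 * heat s x y * norm (f y)"
        using h[of y] by (intro mult_right_mono) (linarith, rule norm_ge_zero)
      then show "norm (of_real (heat s0 x y) * f y) \<le> C0 * heat s x y * norm (f y)" by (simp add: norm_mult)
    qed
    finally show "ennreal ?B \<le> ennreal C0 * Q s" unfolding Qs .
  qed
  have avg: "ennreal q \<le> ennreal C * (\<integral>\<^sup>+y. local_kernel a \<kappa> T x y * ennreal (norm (f y)) \<partial>gaussian)"
    if q: "0 \<le> q" "\<And>s. 2 * s0 \<le> s \<Longrightarrow> s \<le> 4 * s0 \<Longrightarrow> ennreal q \<le> ennreal C0 * Q s" for q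
  proof -
    \<comment> \<open>In t the averaging interval is [3t_0/2, 2t_0]: (3/2)^2 \<ge> 2 keeps s above
      2s_0, and 1/(2t_0) \<le> 1/t there. Its length t_0/2 explains the quarter, and thus the factor
      4 in C.\<close>
    have "ennreal (q / 4) = (\<integral>\<^sup>+t. ennreal (1 / (2 * t0)) * ennreal q * indicator {3 / 2 * t0..2 * t0} t \<partial>lborel)"
      using t0 q by (subst nn_integral_cmult_indicator) (simp_all add: ennreal_mult[symmetric])
    also have "\<dots> \<le> (\<integral>\<^sup>+t. ennreal C0 * (indicator {t0..T} t * ennreal (1 / t) * Q (a * t\<^sup>2)) \<partial>lborel)"
    proof (intro nn_integral_mono)
      fix t
      show "ennreal (1 / (2 * t0)) * ennreal q * indicator {3 / 2 * t0..2 * t0} t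
        \<le> ennreal C0 * (indicator {t0..T} t * ennreal (1 / t) * Q (a * t\<^sup>2))"
      proof (cases "t \<in> {3 / 2 * t0..2 * t0}")
        case True
        then have t: "3 / 2 * t0 \<le> t" "t \<le> 2 * t0" by auto
        then have tT: "t \<in> {t0..T}" using t0 t04 T by auto
        have "(3 / 2 * t0)\<^sup>2 \<le> t\<^sup>2" by (rule power_mono) (use t t0 in auto)
        moreover have "t\<^sup>2 \<le> (2 * t0)\<^sup>2" by (rule power_mono) (use t t0 in auto)
        ultimately have "2 * t0\<^sup>2 \<le> t\<^sup>2" "t\<^sup>2 \<le> 4 * t0\<^sup>2" by (auto simp: power_mult_distrib power2_eq_square)
        then have "a * (2 * t0\<^sup>2) \<le> a * t\<^sup>2" "a * t\<^sup>2 \<le> a * (4 * t0\<^sup>2)" using a by (auto intro!: mult_left_mono)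
        then have "ennreal q \<le> ennreal C0 * Q (a * t\<^sup>2)" by (intro q(2)) (auto simp: s0_def t0_def[symmetric])
        moreover have "1 / (2 * t0) \<le> 1 / t" using t t0 by (intro divide_left_mono) auto
        ultimately have "ennreal (1 / (2 * t0)) * ennreal q \<le> ennreal (1 / t) * (ennreal C0 * Q (a * t\<^sup>2))"
          by (intro mult_mono ennreal_leI) auto
        then show ?thesis using True tT by (simp add: mult_ac)
      qed simp
    qed
    also have "\<dots> = ennreal C0 * (\<integral>\<^sup>+y. local_kernel a \<kappa> T x y * ennreal (norm (f y)) \<partial>gaussian)"
      unfolding Q_def t0_def by (subst local_kernel_row, measurable, rule nn_integral_cmult, measurable)
    finally have "ennreal 4 * ennreal (q / 4) \<le> ennreal 4 * (ennreal C0 * (\<integral>\<^sup>+y. local_kernel a \<kappa> T x y * ennreal (norm (f y)) \<partial>gaussian))"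
      by (rule mult_left_mono) simp
    moreover have "ennreal 4 * ennreal (q / 4) = ennreal q" using q ennreal_mult[of 4 "q / 4"] by simp
    moreover have "ennreal C = ennreal 4 * ennreal C0" using C0 ennreal_mult[of 4 C0] by (simp add: C_def C0_def[symmetric])
    ultimately show ?thesis by (simp add: mult.assoc)
  qed
  show "ennreal ?A \<le> ennreal C * (\<integral>\<^sup>+y. local_kernel a \<kappa> T x y * ennreal (norm (f y)) \<partial>gaussian)"
    using s0 by (intro avg key) auto
  show "ennreal ?B \<le> ennreal C * (\<integral>\<^sup>+y. local_kernel a \<kappa> T x y * ennreal (norm (f y)) \<partial>gaussian)"
    by (intro avg key) auto
qed

section \<open>Integration by parts\<close>

lemma set_integrable_continuous_on:
  fixes f :: "real \<Rightarrow> 'b :: {banach, second_countable_topology}"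
  assumes "continuous_on A f" "A \<in> sets borel" "(\<integral>\<^sup>+t. indicator A t * ennreal (norm (f t)) \<partial>lborel) < \<infinity>"
  shows "set_integrable lborel A f"
  unfolding set_integrable_def
proof (rule integrableI_bounded)
  show "(\<lambda>t. indicator A t *\<^sub>R f t) \<in> borel_measurable lborel"
    using borel_measurable_continuous_on_indicator[OF assms(2,1)] by simp
  have "(\<integral>\<^sup>+t. ennreal (norm (indicator A t *\<^sub>R f t)) \<partial>lborel) = (\<integral>\<^sup>+t. indicator A t * ennreal (norm (f t)) \<partial>lborel)"
    by (intro nn_integral_cong) (auto split: split_indicator)
  then show "(\<integral>\<^sup>+t. ennreal (norm (indicator A t *\<^sub>R f t)) \<partial>lborel) < \<infinity>" using assms(3) by simp
qed

text \<open>Dropping the endpoint, a null set, gives an interval integral up to infinity, for which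
  the fundamental theorem accepts limits at both ends.\<close>

lemma set_integral_FTC_atLeast:
  fixes F f :: "real \<Rightarrow> complex"
  assumes F: "\<And>t. t0 \<le> t \<Longrightarrow> (F has_vector_derivative f t) (at t)"
    and f: "continuous_on {t0..} f" "set_integrable lborel {t0..} f"
    and L: "(F \<longlongrightarrow> L) at_top"
  shows "(LINT t:{t0..}|lborel. f t) = L - F t0"
proof -
  have i: "set_integrable lborel {t0<..} f" by (rule set_integrable_subset[OF f(2)]) auto
  have "(LINT t:{t0..}|lborel. f t) = (LINT t:{t0<..}|lborel. f t)"
    unfolding set_lebesgue_integral_def
    by (rule integral_cong_AE)
      (use f(2) i AE_lborel_singleton[of t0] in
        \<open>auto simp: set_integrable_def split: split_indicator elim!: eventually_mono\<close>)
  also have "\<dots> = (LBINT t=ereal t0..\<infinity>. f t)"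
    by (simp add: interval_integral_to_infinity_eq)
  also have "\<dots> = L - F t0"
  proof (rule interval_integral_FTC_integrable)
    show "(F has_vector_derivative f t) (at t)" if "ereal t0 < ereal t" for t
      using F that by simp
    show "isCont f t" if "ereal t0 < ereal t" for t
    proof -
      have "continuous_on {t0<..} f" by (rule continuous_on_subset[OF f(1)]) auto
      then show ?thesis using that continuous_on_eq_continuous_at[OF open_greaterThan] by auto
    qed
    have "einterval (ereal t0) \<infinity> = {t0<..}" by (auto simp: einterval_def)
    then show "set_integrable lborel (einterval (ereal t0) \<infinity>) f"
      using i by simp
    have "(F \<longlongrightarrow> F t0) (at_right t0)"
      using has_vector_derivative_continuous[OF F[of t0]] by (simp add: continuous_at_imp_continuous_at_within continuous_within[symmetric])
    then show "((F \<circ> real_of_ereal) \<longlongrightarrow> F t0) (at_right (ereal t0))"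
      unfolding ereal_tendsto_simps1 .
    show "((F \<circ> real_of_ereal) \<longlongrightarrow> L) (at_left \<infinity>)"
      using L unfolding ereal_tendsto_simps1 .
  qed simp
  finally show ?thesis .
qed

lemma OU_sum_herm:
  assumes "\<And>k. herm k (g k)"
  shows "OU (\<lambda>x. \<Sum>k\<in>A. c k * g k x) = (\<lambda>x. \<Sum>k\<in>A. c k * (of_nat k * g k x))"
proof -
  have p: "poly_fn (g k)" for k by (rule herm_poly_fn[OF assms])
  show ?thesis
    by (subst OU_sum) (simp_all add: poly_fn_cmult p OU_cmult herm_OU[OF assms])
qed

lemma power_times_exp_le:
  fixes z :: real
  assumes "0 \<le> z"
  shows "z ^ k * exp (- z) \<le> fact k"
proof -
  have "summable (\<lambda>i. z ^ i / fact i)" using summable_exp[of z] by (simp add: divide_inverse mult.commute)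
  then have "(\<Sum>i\<in>{k}. z ^ i / fact i) \<le> (\<Sum>i. z ^ i / fact i)"
    using assms by (intro sum_le_suminf) auto
  then have "z ^ k / fact k \<le> exp z" by (simp add: exp_def divide_inverse mult.commute scaleR_conv_of_real)
  then show ?thesis by (simp add: exp_minus field_simps)
qed

section \<open>The multiplier and its second order remainder\<close>

locale multiplier =
  fixes \<Phi> \<Phi>' \<Phi>'' :: "real \<Rightarrow> complex"
  assumes d1: "\<And>t. t > 0 \<Longrightarrow> (\<Phi> has_vector_derivative \<Phi>' t) (at t)"
    and d2: "\<And>t. t > 0 \<Longrightarrow> (\<Phi>' has_vector_derivative \<Phi>'' t) (at t)"
    and c2: "continuous_on {0<..} \<Phi>''"
    and b1: "bdd_above ((\<lambda>t. norm (\<Phi> t) + t * norm (\<Phi>' t)) ` {0<..})"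
    and b2: "bdd_above ((\<lambda>t. norm (of_real (t\<^sup>2) * \<Phi>'' t)) ` {0<..1})"
begin

text \<open>This is \<open>(t \<Phi>(t))''\<close>, which remains after integrating by parts twice.\<close>

definition remainder :: "real \<Rightarrow> complex" where
  "remainder t = 2 * \<Phi>' t + of_real t * \<Phi>'' t"

lemma \<Phi>_bound:
  obtains M where "0 < M" "\<And>t. 0 < t \<Longrightarrow> norm (\<Phi> t) \<le> M" "\<And>t. 0 < t \<Longrightarrow> t * norm (\<Phi>' t) \<le> M"
proof -
  obtain M where M: "\<And>t. 0 < t \<Longrightarrow> norm (\<Phi> t) + t * norm (\<Phi>' t) \<le> M"
    using b1 by (auto simp: bdd_above_def)
  have "norm (\<Phi> t) \<le> max M 1" "t * norm (\<Phi>' t) \<le> max M 1" if "0 < t" for t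
  proof -
    have "0 \<le> t * norm (\<Phi>' t)" "0 \<le> norm (\<Phi> t)" using that by auto
    then show "norm (\<Phi> t) \<le> max M 1" "t * norm (\<Phi>' t) \<le> max M 1" using M[OF that] by linarith+
  qed
  then show ?thesis using that[of "max M 1"] by auto
qed

lemma continuous_\<Phi>: "continuous_on {0<..} \<Phi>" and continuous_\<Phi>': "continuous_on {0<..} \<Phi>'"
  by (auto intro!: continuous_at_imp_continuous_on has_vector_derivative_continuous d1 d2)

lemma continuous_remainder: "continuous_on {0<..} remainder"
  unfolding remainder_def by (intro continuous_intros continuous_\<Phi>' c2)

text \<open>On (0,1] this is the hypothesis on t^2 \<Phi>''(t), on [1,S] it is compactness. The size
  1/s turns the remaining integral into one with the measure ds/s, that is, into the local
  kernel.\<close>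

lemma remainder_bound:
  assumes "0 < S"
  obtains C where "0 < C" "\<And>s. 0 < s \<Longrightarrow> s \<le> S \<Longrightarrow> norm (remainder s) \<le> C / s"
proof -
  obtain M where M: "0 < M" "\<And>t. 0 < t \<Longrightarrow> t * norm (\<Phi>' t) \<le> M" using \<Phi>_bound by metis
  obtain N where "\<forall>t\<in>{0<..1}. t\<^sup>2 * norm (\<Phi>'' t) \<le> N"
    using b2 by (auto simp: bdd_above_def norm_mult norm_power)
  then have N: "t\<^sup>2 * norm (\<Phi>'' t) \<le> N" if "0 < t" "t \<le> 1" for t using that by auto
  have "bounded ((\<lambda>t. of_real (t\<^sup>2) * \<Phi>'' t) ` {1..max 1 S})"
    by (intro compact_imp_bounded compact_continuous_image continuous_intros continuous_on_subset[OF c2]) auto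
  then obtain N' where "\<forall>t\<in>{1..max 1 S}. t\<^sup>2 * norm (\<Phi>'' t) \<le> N'"
    unfolding bounded_iff by (auto simp: norm_mult norm_power)
  then have N': "t\<^sup>2 * norm (\<Phi>'' t) \<le> N'" if "1 \<le> t" "t \<le> S" for t using that by auto
  show ?thesis
  proof (rule that[of "2 * M + \<bar>N\<bar> + \<bar>N'\<bar>"])
    show "0 < 2 * M + \<bar>N\<bar> + \<bar>N'\<bar>" using M by simp
    fix s assume s: "0 < s" "s \<le> S"
    have "s\<^sup>2 * norm (\<Phi>'' s) \<le> \<bar>N\<bar> + \<bar>N'\<bar>"
      using N[of s] N'[of s] s by (cases "s \<le> 1") auto
    moreover have "s * norm (\<Phi>' s) \<le> M" using M s by auto
    moreover have "s * norm (remainder s) \<le> s * (2 * norm (\<Phi>' s) + s * norm (\<Phi>'' s))"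
      unfolding remainder_def using s by (intro mult_left_mono order_trans[OF norm_triangle_ineq]) (auto simp: norm_mult)
    ultimately have "s * norm (remainder s) \<le> 2 * M + \<bar>N\<bar> + \<bar>N'\<bar>"
      by (simp add: algebra_simps power2_eq_square)
    then show "norm (remainder s) \<le> (2 * M + \<bar>N\<bar> + \<bar>N'\<bar>) / s"
      using s by (simp add: field_simps)
  qed
qed

text \<open>B(s) = s\<Phi>u' - (s\<Phi>)'u has derivative s\<Phi>u'' - (s\<Phi>)''u. With s = at^2
  the chain rule contributes 2at, so B(at^2)/(2a^2) is a primitive of the difference of both
  integrands in t. The bounds involving A serve integrability and the limit at infinity only; the
  conclusion is free of A.\<close>

lemma integration_by_parts:
  fixes u u1 u2 :: "real \<Rightarrow> complex" and a t0 A M :: real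
  assumes a: "0 < a" and t0: "0 < t0" and M: "0 < M" "\<And>t. 0 < t \<Longrightarrow> norm (\<Phi> t) \<le> M" "\<And>t. 0 < t \<Longrightarrow> t * norm (\<Phi>' t) \<le> M"
    and u: "\<And>s. (u has_vector_derivative u1 s) (at s)" "\<And>s. (u1 has_vector_derivative u2 s) (at s)" "continuous_on UNIV u2"
    and A: "0 \<le> A" "\<And>s. 0 < s \<Longrightarrow> norm (u s) \<le> A * exp (- s)" "\<And>s. 0 < s \<Longrightarrow> norm (u1 s) \<le> A * exp (- s)"
      "\<And>s. 0 < s \<Longrightarrow> norm (u2 s) \<le> A * exp (- s)"
    and fin: "(\<integral>\<^sup>+t. indicator {t0..} t * ennreal (t / a * norm (remainder (a * t\<^sup>2)) * norm (u (a * t\<^sup>2))) \<partial>lborel) < \<infinity>"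
  shows "ennreal (norm (LINT t:{t0..}|lborel. \<Phi> (a * t\<^sup>2) * of_real (t ^ 3) * u2 (a * t\<^sup>2)))
    \<le> ennreal (M / a\<^sup>2 * (a * t0\<^sup>2 * norm (u1 (a * t0\<^sup>2)) + norm (u (a * t0\<^sup>2))))
      + (\<integral>\<^sup>+t. indicator {t0..} t * ennreal (t / a * norm (remainder (a * t\<^sup>2)) * norm (u (a * t\<^sup>2))) \<partial>lborel)"
proof -
  define B where "B = (\<lambda>s. of_real s * \<Phi> s * u1 s - (\<Phi> s + of_real s * \<Phi>' s) * u s)"
  define f1 where "f1 = (\<lambda>t. \<Phi> (a * t\<^sup>2) * of_real (t ^ 3) * u2 (a * t\<^sup>2))"
  define f2 where "f2 = (\<lambda>t. of_real (t / a) * remainder (a * t\<^sup>2) * u (a * t\<^sup>2))"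
  have pos: "0 < a * t\<^sup>2" if "t0 \<le> t" for t using that t0 a by simp
  have cu: "continuous_on UNIV u" "continuous_on UNIV u1"
    by (auto intro!: continuous_at_imp_continuous_on has_vector_derivative_continuous u)
  have comp: "continuous_on {t0..} (\<lambda>t. h (a * t\<^sup>2))" if "continuous_on {0<..} h" for h :: "real \<Rightarrow> complex"
    by (rule continuous_on_compose2[OF that]) (auto intro!: continuous_intros pos)
  have cont: "continuous_on {t0..} f1" "continuous_on {t0..} f2"
    unfolding f1_def f2_def using a
    by (intro continuous_intros comp continuous_\<Phi> continuous_remainder continuous_on_subset[OF u(3)] continuous_on_subset[OF cu(1)]; simp)+
  have dB: "(B has_vector_derivative (of_real s * \<Phi> s * u2 s - remainder s * u s)) (at s)" if s: "0 < s" for s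
    unfolding B_def remainder_def
    by (rule has_vector_derivative_eq_rhs)
      (rule has_vector_derivative_diff has_vector_derivative_mult has_vector_derivative_add has_vector_derivative_of_real
         DERIV_ident d1[OF s] d2[OF s] u | simp add: algebra_simps)+
  have dV: "((\<lambda>t. B (a * t\<^sup>2) / of_real (2 * a\<^sup>2)) has_vector_derivative f1 t - f2 t) (at t)" if t: "t0 \<le> t" for t
  proof -
    have "((\<lambda>t. a * t\<^sup>2) has_vector_derivative 2 * a * t) (at t)"
      unfolding has_real_derivative_iff_has_vector_derivative[symmetric]
      by (auto intro!: derivative_eq_intros)
    from vector_diff_chain_at[OF this dB[OF pos[OF t]]]
    have "((\<lambda>t. B (a * t\<^sup>2)) has_vector_derivative (2 * a * t) *\<^sub>R (of_real (a * t\<^sup>2) * \<Phi> (a * t\<^sup>2) * u2 (a * t\<^sup>2) - remainder (a * t\<^sup>2) * u (a * t\<^sup>2))) (at t)"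
      by (simp add: comp_def)
    from has_vector_derivative_divide[OF this, of "of_real (2 * a\<^sup>2)"]
    show ?thesis
      by (rule has_vector_derivative_eq_rhs)
        (use a in \<open>simp add: f1_def f2_def scaleR_conv_of_real field_simps power2_eq_square power3_eq_cube\<close>)
  qed
  have Bn: "norm (B s) \<le> s * M * norm (u1 s) + (M + M) * norm (u s)" if s: "0 < s" for s
  proof -
    have "norm (B s) \<le> norm (of_real s * \<Phi> s * u1 s) + norm ((\<Phi> s + of_real s * \<Phi>' s) * u s)"
      unfolding B_def by (rule norm_triangle_ineq4)
    also have "\<dots> \<le> s * M * norm (u1 s) + (M + M) * norm (u s)"
    proof (intro add_mono)
      show "norm (of_real s * \<Phi> s * u1 s) \<le> s * M * norm (u1 s)"
        unfolding norm_mult using s M by (intro mult_mono) auto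
      have "norm (\<Phi> s + of_real s * \<Phi>' s) \<le> M + M"
        by (rule order_trans[OF norm_triangle_ineq]) (use s M(2,3)[OF s] in \<open>auto simp: norm_mult\<close>)
      then show "norm ((\<Phi> s + of_real s * \<Phi>' s) * u s) \<le> (M + M) * norm (u s)"
        unfolding norm_mult using s M by (intro mult_mono) auto
    qed
    finally show ?thesis .
  qed
  have lim: "((\<lambda>t. B (a * t\<^sup>2) / of_real (2 * a\<^sup>2)) \<longlongrightarrow> 0) at_top"
  proof -
    have "((\<lambda>s. B s) \<longlongrightarrow> 0) at_top"
    proof (rule Lim_null_comparison)
      show "\<forall>\<^sub>F s in at_top. norm (B s) \<le> M * A * ((s + 2) * exp (- s))"
      proof (rule eventually_mono[OF eventually_gt_at_top[of 0]])
        fix s :: real assume s: "0 < s"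
        have "norm (B s) \<le> s * M * norm (u1 s) + (M + M) * norm (u s)" by (rule Bn[OF s])
        also have "\<dots> \<le> s * M * (A * exp (- s)) + (M + M) * (A * exp (- s))"
          using s M A by (intro add_mono mult_left_mono) auto
        finally show "norm (B s) \<le> M * A * ((s + 2) * exp (- s))" by (simp add: algebra_simps)
      qed
      have "((\<lambda>s::real. (s + 2) * exp (- s)) \<longlongrightarrow> 0) at_top" by real_asymp
      then show "((\<lambda>s. M * A * ((s + 2) * exp (- s))) \<longlongrightarrow> 0) at_top" using tendsto_mult_right_zero by blast
    qed
    moreover have "filterlim (\<lambda>t. a * t\<^sup>2) at_top at_top" using a by real_asymp
    ultimately have "((\<lambda>t. B (a * t\<^sup>2)) \<longlongrightarrow> 0) at_top" by (rule filterlim_compose)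
    then show ?thesis by (intro tendsto_divide_zero)
  qed
  have int2: "set_integrable lborel {t0..} f2"
  proof (rule set_integrable_continuous_on[OF cont(2)])
    have "indicator {t0..} t * ennreal (norm (f2 t)) = indicator {t0..} t * ennreal (t / a * norm (remainder (a * t\<^sup>2)) * norm (u (a * t\<^sup>2)))" for t
      using t0 a by (auto simp: f2_def norm_mult norm_divide split: split_indicator)
    then show "(\<integral>\<^sup>+t. indicator {t0..} t * ennreal (norm (f2 t)) \<partial>lborel) < \<infinity>" using fin by simp
  qed auto
  have int1: "set_integrable lborel {t0..} f1"
  proof (rule set_integrable_continuous_on[OF cont(1)])
    have "(\<integral>\<^sup>+t. indicator {t0..} t * ennreal (norm (f1 t)) \<partial>lborel)
      \<le> (\<integral>\<^sup>+t. ennreal (M * A * 6 / a ^ 3) * (ennreal (1 / t ^ 3) * indicator {t0..} t) \<partial>lborel)"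
    proof (intro nn_integral_mono)
      fix t
      show "indicator {t0..} t * ennreal (norm (f1 t)) \<le> ennreal (M * A * 6 / a ^ 3) * (ennreal (1 / t ^ 3) * indicator {t0..} t)"
      proof (cases "t0 \<le> t")
        case True
        then have t: "0 < t" using t0 by simp
        have s: "0 < a * t\<^sup>2" by (rule pos[OF True])
        have "norm (f1 t) = norm (\<Phi> (a * t\<^sup>2)) * t ^ 3 * norm (u2 (a * t\<^sup>2))"
          using t by (simp add: f1_def norm_mult norm_power)
        also have "\<dots> \<le> M * t ^ 3 * (A * exp (- (a * t\<^sup>2)))"
          using t M A s by (intro mult_mono) auto
        \<comment> \<open>Since s^3 e^{-s} \<le> 3! = 6, the growth t^3 is traded for the integrable
          1/t^3.\<close>
        also have "\<dots> = M * A / (a ^ 3 * t ^ 3) * ((a * t\<^sup>2) ^ 3 * exp (- (a * t\<^sup>2)))"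
          using t a by (simp add: power_mult_distrib field_simps flip: power_mult power_add)
        also have "\<dots> \<le> M * A / (a ^ 3 * t ^ 3) * 6"
          using s t a M A power_times_exp_le[of "a * t\<^sup>2" 3] by (intro mult_left_mono) (auto simp: fact_numeral)
        also have "\<dots> = M * A * 6 / a ^ 3 * (1 / t ^ 3)" by simp
        finally have "norm (f1 t) \<le> M * A * 6 / a ^ 3 * (1 / t ^ 3)" .
        then have "ennreal (norm (f1 t)) \<le> ennreal (M * A * 6 / a ^ 3) * ennreal (1 / t ^ 3)"
          using M A a t by (subst ennreal_mult[symmetric]) (auto intro!: ennreal_leI)
        then show ?thesis using True by simp
      qed simp
    qed
    also have "\<dots> < \<infinity>"
      by (subst nn_integral_cmult) (auto simp: nn_integral_inverse_cube[OF t0] ennreal_mult_less_top)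
    finally show "(\<integral>\<^sup>+t. indicator {t0..} t * ennreal (norm (f1 t)) \<partial>lborel) < \<infinity>" .
  qed auto
  have "(LINT t:{t0..}|lborel. f1 t - f2 t) = 0 - B (a * t0\<^sup>2) / of_real (2 * a\<^sup>2)"
    by (rule set_integral_FTC_atLeast[OF dV _ _ lim])
      (intro continuous_intros cont set_integral_diff(1) int1 int2 | assumption)+
  then have eq: "(LINT t:{t0..}|lborel. f1 t) = (LINT t:{t0..}|lborel. f2 t) - B (a * t0\<^sup>2) / of_real (2 * a\<^sup>2)"
    using set_integral_diff(2)[OF int1 int2] by (simp add: algebra_simps)
  have "norm (LINT t:{t0..}|lborel. f1 t) \<le> norm (LINT t:{t0..}|lborel. f2 t) + norm (B (a * t0\<^sup>2) / of_real (2 * a\<^sup>2))"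
    unfolding eq by (rule norm_triangle_ineq4)
  also have "norm (B (a * t0\<^sup>2) / of_real (2 * a\<^sup>2)) \<le> M / a\<^sup>2 * (a * t0\<^sup>2 * norm (u1 (a * t0\<^sup>2)) + norm (u (a * t0\<^sup>2)))"
  proof -
    define s where "s = a * t0\<^sup>2"
    have s: "0 < s" unfolding s_def by (rule pos) simp
    have "norm (B s) \<le> s * M * norm (u1 s) + (M + M) * norm (u s)" by (rule Bn[OF s])
    also have "\<dots> \<le> 2 * M * (s * norm (u1 s) + norm (u s))" using s M by (simp add: algebra_simps)
    finally have "norm (B s) \<le> 2 * M * (s * norm (u1 s) + norm (u s))" .
    then have "norm (B s) / (2 * a\<^sup>2) \<le> 2 * M * (s * norm (u1 s) + norm (u s)) / (2 * a\<^sup>2)"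
      using a by (intro divide_right_mono) auto
    then show ?thesis unfolding s_def[symmetric] by (simp add: norm_divide norm_mult norm_power)
  qed
  finally have "norm (LINT t:{t0..}|lborel. f1 t) \<le> norm (LINT t:{t0..}|lborel. f2 t)
      + M / a\<^sup>2 * (a * t0\<^sup>2 * norm (u1 (a * t0\<^sup>2)) + norm (u (a * t0\<^sup>2)))" by simp
  then have "ennreal (norm (LINT t:{t0..}|lborel. f1 t)) \<le> ennreal (norm (LINT t:{t0..}|lborel. f2 t))
      + ennreal (M / a\<^sup>2 * (a * t0\<^sup>2 * norm (u1 (a * t0\<^sup>2)) + norm (u (a * t0\<^sup>2))))"
    using M a by (subst ennreal_plus[symmetric]) (auto intro!: ennreal_leI simp del: ennreal_plus)
  also have "ennreal (norm (LINT t:{t0..}|lborel. f2 t)) \<le> (\<integral>\<^sup>+t. ennreal (norm (indicator {t0..} t *\<^sub>R f2 t)) \<partial>lborel)"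
    unfolding set_lebesgue_integral_def by (rule ennreal_norm_integral_le)
  also have "\<dots> = (\<integral>\<^sup>+t. indicator {t0..} t * ennreal (t / a * norm (remainder (a * t\<^sup>2)) * norm (u (a * t\<^sup>2))) \<partial>lborel)"
    by (intro nn_integral_cong) (use t0 a in \<open>auto simp: f2_def norm_mult norm_divide split: split_indicator\<close>)
  finally show ?thesis unfolding f1_def by (simp add: add.commute add_right_mono)
qed

text \<open>On the component of degree k, (t^2 L)^2 is multiplication by t^4 k^2, and k^2 e^{-ks} is
  the second derivative of e^{-ks} in s. Thus the sum is u''(s) at s = at^2, and the measure dt/t
  lowers t^4 to t^3.\<close>

lemma pi3_expansion:
  fixes f :: "real ^ 'n \<Rightarrow> complex"
  assumes "0 < \<delta>' + \<delta>" "0 < \<kappa>"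
    and g: "\<And>k. herm k (g k)"
    and U: "\<And>s x. 0 < s \<Longrightarrow> OU_semigroup s f x = (\<Sum>k=1..n. of_real (exp (- real k * s)) * g k x)"
  shows "pi3 \<Phi> \<delta> \<delta>' \<kappa> f x = (LINT t:{m_tilde x / \<kappa>..}|lborel.
    \<Phi> ((\<delta>' + \<delta>) * t\<^sup>2) * of_real (t ^ 3) * (\<Sum>k=1..n. of_real ((real k)\<^sup>2 * exp (- real k * ((\<delta>' + \<delta>) * t\<^sup>2))) * g k x))"
  unfolding pi3_def
proof (rule set_lebesgue_integral_cong)
  show "\<forall>t. t \<in> {m_tilde x / \<kappa>..} \<longrightarrow>
    \<Phi> ((\<delta>' + \<delta>) * t\<^sup>2) * ((\<lambda>g y. of_real (t\<^sup>2) * OU g y) ^^ 2) (OU_semigroup ((\<delta>' + \<delta>) * t\<^sup>2) f) x / of_real t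
    = \<Phi> ((\<delta>' + \<delta>) * t\<^sup>2) * of_real (t ^ 3) * (\<Sum>k=1..n. of_real ((real k)\<^sup>2 * exp (- real k * ((\<delta>' + \<delta>) * t\<^sup>2))) * g k x)"
  proof (intro allI impI)
    fix t assume "t \<in> {m_tilde x / \<kappa>..}"
    then have t: "0 < t" using m_tilde_bounds(1)[of x] assms by (auto intro: less_le_trans[of 0 "m_tilde x / \<kappa>"])
    define s where "s = (\<delta>' + \<delta>) * t\<^sup>2"
    have s: "0 < s" using t assms by (simp add: s_def)
    define c where "c = (\<lambda>k. complex_of_real (exp (- real k * s)))"
    have 1: "OU_semigroup s f = (\<lambda>x. \<Sum>k=1..n. c k * g k x)"
      using U[OF s] by (auto simp: c_def fun_eq_iff)
    have 2: "(\<lambda>y. of_real (t\<^sup>2) * OU (\<lambda>x. \<Sum>k=1..n. c k * g k x) y)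
      = (\<lambda>x. \<Sum>k=1..n. (of_real (t\<^sup>2) * c k * of_nat k) * g k x)"
      unfolding OU_sum_herm[OF g] by (simp add: sum_distrib_left mult.assoc)
    have 3: "OU (\<lambda>x. \<Sum>k=1..n. (of_real (t\<^sup>2) * c k * of_nat k) * g k x) x
      = (\<Sum>k=1..n. (of_real (t\<^sup>2) * c k * of_nat k) * (of_nat k * g k x))"
      unfolding OU_sum_herm[OF g] ..
    have twice: "(F ^^ 2) h = F (F h)" for F :: "(real ^ 'n \<Rightarrow> complex) \<Rightarrow> real ^ 'n \<Rightarrow> complex" and h
      by (simp add: numeral_2_eq_2)
    have "((\<lambda>g y. of_real (t\<^sup>2) * OU g y) ^^ 2) (OU_semigroup s f) x
      = of_real (t\<^sup>2) * (\<Sum>k=1..n. (of_real (t\<^sup>2) * c k * of_nat k) * (of_nat k * g k x))"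
      unfolding twice 1 2 3 ..
    also have "\<dots> = of_real (t ^ 4) * (\<Sum>k=1..n. of_real ((real k)\<^sup>2 * exp (- real k * s)) * g k x)"
      unfolding sum_distrib_left
      by (intro sum.cong refl) (simp add: c_def power2_eq_square eval_nat_numeral mult_ac)
    finally have *: "((\<lambda>g y. of_real (t\<^sup>2) * OU g y) ^^ 2) (OU_semigroup s f) x
      = of_real (t ^ 4) * (\<Sum>k=1..n. of_real ((real k)\<^sup>2 * exp (- real k * s)) * g k x)" .
    have "complex_of_real (t ^ 4) = of_real (t ^ 3) * of_real t" by (simp flip: power_Suc2)
    then show "\<Phi> ((\<delta>' + \<delta>) * t\<^sup>2) * ((\<lambda>g y. of_real (t\<^sup>2) * OU g y) ^^ 2) (OU_semigroup ((\<delta>' + \<delta>) * t\<^sup>2) f) x / of_real t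
    = \<Phi> ((\<delta>' + \<delta>) * t\<^sup>2) * of_real (t ^ 3) * (\<Sum>k=1..n. of_real ((real k)\<^sup>2 * exp (- real k * ((\<delta>' + \<delta>) * t\<^sup>2))) * g k x)"
      unfolding s_def[symmetric] * using t by simp
  qed
qed auto

lemma pi3_measurable:
  fixes f :: "real ^ 'n \<Rightarrow> complex"
  assumes "0 < \<delta>' + \<delta>" "0 < \<kappa>" "mean_zero_polynomial f"
  shows "pi3 \<Phi> \<delta> \<delta>' \<kappa> f \<in> borel_measurable borel"
proof -
  define a where "a = \<delta>' + \<delta>"
  have a: "0 < a" using assms by (simp add: a_def)
  obtain n g where g: "\<And>k. herm k (g k)"
    and U: "\<And>s x. 0 < s \<Longrightarrow> OU_semigroup s f x = (\<Sum>k=1..n. of_real (exp (- real k * s)) * g k x)"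
    by (rule mean_zero_expansion[OF assms(3)]) (rule that)
  have [measurable]: "g k \<in> borel_measurable borel" for k
    by (rule poly_fn_measurable[OF herm_poly_fn[OF g]])
  \<comment> \<open>Nothing is known about \<Phi> outside the positive half-line; cutting it off
    there gives a Borel function and leaves the integrand unchanged.\<close>
  define \<Psi> where "\<Psi> = (\<lambda>s. indicator {0<..} s *\<^sub>R \<Phi> s)"
  have [measurable]: "\<Psi> \<in> borel_measurable borel"
    unfolding \<Psi>_def by (rule borel_measurable_continuous_on_indicator[OF _ continuous_\<Phi>]) simp
  have "pi3 \<Phi> \<delta> \<delta>' \<kappa> f = (\<lambda>x. LINT t|lborel. (if m_tilde x / \<kappa> \<le> t then
    \<Psi> (a * t\<^sup>2) * of_real (t ^ 3) * (\<Sum>k=1..n. of_real ((real k)\<^sup>2 * exp (- real k * (a * t\<^sup>2))) * g k x) else 0))"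
  proof
    fix x :: "real ^ 'n"
    have eq: "pi3 \<Phi> \<delta> \<delta>' \<kappa> f x = (LINT t:{m_tilde x / \<kappa>..}|lborel.
      \<Phi> (a * t\<^sup>2) * of_real (t ^ 3) * (\<Sum>k=1..n. of_real ((real k)\<^sup>2 * exp (- real k * (a * t\<^sup>2))) * g k x))"
      unfolding a_def by (intro pi3_expansion assms(1,2) g U)
    have "0 < a * t\<^sup>2" if "m_tilde x / \<kappa> \<le> t" for t
    proof -
      have "0 < t" by (rule less_le_trans[OF _ that]) (use m_tilde_bounds(1)[of x] assms in auto)
      then show ?thesis using a by simp
    qed
    then show "pi3 \<Phi> \<delta> \<delta>' \<kappa> f x = (LINT t|lborel. (if m_tilde x / \<kappa> \<le> t then
      \<Psi> (a * t\<^sup>2) * of_real (t ^ 3) * (\<Sum>k=1..n. of_real ((real k)\<^sup>2 * exp (- real k * (a * t\<^sup>2))) * g k x) else 0))"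
      unfolding eq set_lebesgue_integral_def
      by (intro Bochner_Integration.integral_cong) (auto simp: \<Psi>_def)
  qed
  also have "\<dots> \<in> borel_measurable borel" by measurable
  finally show ?thesis .
qed

lemma remainder_weight_measurable:
  assumes "0 < a" "0 < T"
  shows "(\<lambda>t. indicator {T..} t * ennreal (t / a * norm (remainder (a * t\<^sup>2)))) \<in> borel_measurable borel"
proof -
  have "continuous_on {T..} (\<lambda>t. t / a * norm (remainder (a * t\<^sup>2)))"
  proof (intro continuous_intros)
    show "continuous_on {T..} (\<lambda>t. remainder (a * t\<^sup>2))"
      by (rule continuous_on_compose2[OF continuous_remainder]) (use assms in \<open>auto intro!: continuous_intros\<close>)
  qed (use assms in auto)
  then have "(\<lambda>t. indicator {T..} t *\<^sub>R (t / a * norm (remainder (a * t\<^sup>2)))) \<in> borel_measurable borel"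
    by (intro borel_measurable_continuous_on_indicator) auto
  then have "(\<lambda>t. ennreal (indicator {T..} t *\<^sub>R (t / a * norm (remainder (a * t\<^sup>2))))) \<in> borel_measurable borel" by measurable
  moreover have "(\<lambda>t. ennreal (indicator {T..} t *\<^sub>R (t / a * norm (remainder (a * t\<^sup>2)))))
     = (\<lambda>t. indicator {T..} t * ennreal (t / a * norm (remainder (a * t\<^sup>2))))"
    by (auto simp: fun_eq_iff split: split_indicator)
  ultimately show ?thesis by simp
qed

text \<open>Boundary terms and times in [t_0, T] are both dominated by the local kernel. The tail
  beyond T is left as it stands, since the two growth hypotheses treat it differently;
  \<open>fin\<close> is the weakest finiteness common to both that justifies integrating by
  parts.\<close>

lemma pi3_pointwise_bound:
  assumes a: "0 < \<delta>' + \<delta>" "\<delta>' + \<delta> \<le> 2" and \<kappa>: "4 \<le> \<kappa>" and T: "1 / 2 \<le> T"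
    and fin: "(\<integral>\<^sup>+t. indicator {T..} t * ennreal (t / (\<delta>' + \<delta>) * norm (remainder ((\<delta>' + \<delta>) * t\<^sup>2)) * exp (- ((\<delta>' + \<delta>) * t\<^sup>2))) \<partial>lborel) < \<infinity>"
  obtains C where "0 < C" "\<And>(f :: real ^ 'n \<Rightarrow> complex) x. mean_zero_polynomial f \<Longrightarrow>
    ennreal (norm (pi3 \<Phi> \<delta> \<delta>' \<kappa> f x)) \<le> ennreal C * (\<integral>\<^sup>+y. local_kernel (\<delta>' + \<delta>) \<kappa> T x y * ennreal (norm (f y)) \<partial>gaussian)
      + (\<integral>\<^sup>+t. indicator {T..} t * ennreal (t / (\<delta>' + \<delta>) * norm (remainder ((\<delta>' + \<delta>) * t\<^sup>2))) * ennreal (norm (OU_semigroup ((\<delta>' + \<delta>) * t\<^sup>2) f x)) \<partial>lborel)"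
proof -
  define a where "a = \<delta>' + \<delta>"
  note a = a[folded a_def]
  obtain M where M: "0 < M" "\<And>t. 0 < t \<Longrightarrow> norm (\<Phi> t) \<le> M" "\<And>t. 0 < t \<Longrightarrow> t * norm (\<Phi>' t) \<le> M"
    using \<Phi>_bound by metis
  have "0 < a * T\<^sup>2" using a T by simp
  then obtain R where R: "0 < R" "\<And>s. 0 < s \<Longrightarrow> s \<le> a * T\<^sup>2 \<Longrightarrow> norm (remainder s) \<le> R / s"
    using remainder_bound by metis
  define Cb where "Cb = 4 * ((real CARD('n) + 14) * exp (81 / 8) * 8 powr (real CARD('n) / 2))"
  have Cb: "0 < Cb" by (simp add: Cb_def add_nonneg_pos)
  define C where "C = M / a\<^sup>2 * (2 * Cb) + R / a\<^sup>2"
  have rem: "t / a * norm (remainder (a * t\<^sup>2)) \<le> R / a\<^sup>2 * (1 / t)" if "0 < t" "t \<le> T" for t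
  proof -
    have "t\<^sup>2 \<le> T\<^sup>2" using that by (intro power_mono) auto
    then have "norm (remainder (a * t\<^sup>2)) \<le> R / (a * t\<^sup>2)" using a that by (intro R(2)) auto
    then have "t / a * norm (remainder (a * t\<^sup>2)) \<le> t / a * (R / (a * t\<^sup>2))" using a that by (intro mult_left_mono) auto
    then show ?thesis using a that by (simp add: power2_eq_square)
  qed
  show ?thesis
  proof (rule that[of C])
    show "0 < C" using M R a Cb by (simp add: C_def add_pos_pos)
    fix f :: "real ^ 'n \<Rightarrow> complex" and x :: "real ^ 'n" assume f: "mean_zero_polynomial f"
    have pf: "poly_fn f" using f by (auto simp: mean_zero_polynomial_def intro: poly_fn_of_polynomial_function)
    note [measurable] = poly_fn_measurable[OF pf]
    obtain n g where g: "\<And>k. herm k (g k)"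
      and U: "\<And>s x. 0 < s \<Longrightarrow> OU_semigroup s f x = (\<Sum>k=1..n. of_real (exp (- real k * s)) * g k x)"
      by (rule mean_zero_expansion[OF f]) (rule that)
    define t0 where "t0 = m_tilde x / \<kappa>"
    have t0: "0 < t0" using m_tilde_bounds(1)[of x] \<kappa> by (simp add: t0_def)
    have "m_tilde x / \<kappa> \<le> 1 / 4" using m_tilde_bounds(1,2)[of x] \<kappa> by (intro frac_le) auto
    then have t0T: "t0 \<le> T" using T unfolding t0_def by linarith
    define u where "u = (\<lambda>s. \<Sum>k=1..n. of_real (exp (- real k * s)) * g k x)"
    define u1 where "u1 = (\<lambda>s. \<Sum>k=1..n. of_real (- real k * exp (- real k * s)) * g k x)"
    define u2 where "u2 = (\<lambda>s. \<Sum>k=1..n. of_real ((real k)\<^sup>2 * exp (- real k * s)) * g k x)"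
    define A where "A = (\<Sum>k=1..n. (real k)\<^sup>2 * norm (g k x))"
    define S where "S = a * t0\<^sup>2"
    have S: "0 < S" using a t0 by (simp add: S_def)
    have du: "(u has_vector_derivative u1 s) (at s)" for s
      unfolding u_def u1_def
      by (intro has_vector_derivative_sum has_vector_derivative_mult_left has_vector_derivative_of_real)
        (auto intro!: derivative_eq_intros)
    have du1: "(u1 has_vector_derivative u2 s) (at s)" for s
      unfolding u1_def u2_def
      by (intro has_vector_derivative_sum has_vector_derivative_mult_left has_vector_derivative_of_real)
        (auto intro!: derivative_eq_intros simp: power2_eq_square)
    have cu2: "continuous_on UNIV u2" unfolding u2_def by (intro continuous_intros)
    have A: "0 \<le> A" by (auto simp: A_def intro!: sum_nonneg)
    \<comment> \<open>One estimate for u, u1 and u2, with c_k = 1, -k and k^2. As k \<ge> 1, every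
      exponential is at most e^{-s}.\<close>
    have bound: "norm (\<Sum>k=1..n. of_real (c k * exp (- real k * s)) * g k x) \<le> A * exp (- s)"
      if "0 < s" "\<And>k. 1 \<le> k \<Longrightarrow> \<bar>c k\<bar> \<le> (real k)\<^sup>2" for s and c :: "nat \<Rightarrow> real"
    proof -
      have "norm (\<Sum>k=1..n. of_real (c k * exp (- real k * s)) * g k x) \<le> (\<Sum>k=1..n. (real k)\<^sup>2 * exp (- s) * norm (g k x))"
      proof (rule sum_norm_le)
        fix k assume "k \<in> {1..n}"
        then have k: "1 \<le> k" by simp
        then have "1 * s \<le> real k * s" using that by (intro mult_right_mono) auto
        then have "\<bar>c k\<bar> * exp (- real k * s) * norm (g k x) \<le> (real k)\<^sup>2 * exp (- s) * norm (g k x)"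
          using that(2)[OF k] by (intro mult_right_mono mult_mono) auto
        then show "norm (of_real (c k * exp (- real k * s)) * g k x) \<le> (real k)\<^sup>2 * exp (- s) * norm (g k x)"
          by (simp add: norm_mult abs_mult)
      qed
      also have "\<dots> = A * exp (- s)" by (simp add: A_def sum_distrib_right sum_distrib_left mult_ac)
      finally show ?thesis .
    qed
    have k2: "real k \<le> (real k)\<^sup>2" "1 \<le> (real k)\<^sup>2" if "1 \<le> k" for k :: nat
      using that by (auto simp: power2_eq_square mult_ge1_I)
    have bu: "norm (u s) \<le> A * exp (- s)" "norm (u1 s) \<le> A * exp (- s)" "norm (u2 s) \<le> A * exp (- s)" if "0 < s" for s
      using bound[OF that, of "\<lambda>_. 1"] bound[OF that, of "\<lambda>k. - real k"] bound[OF that, of "\<lambda>k. (real k)\<^sup>2"] k2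
      by (simp_all add: u_def u1_def u2_def)
    have uU: "u s = OU_semigroup s f x" if "0 < s" for s using U[OF that] by (simp add: u_def)
    define I where "I = (\<integral>\<^sup>+t. indicator {t0..} t * ennreal (t / a * norm (remainder (a * t\<^sup>2)) * norm (u (a * t\<^sup>2))) \<partial>lborel)"
    define h where "h = (\<lambda>t. t / a * norm (remainder (a * t\<^sup>2)))"
    define K where "K = (\<integral>\<^sup>+y. local_kernel a \<kappa> T x y * ennreal (norm (f y)) \<partial>gaussian)"
    define J where "J = (\<integral>\<^sup>+t. indicator {T..} t * ennreal (h t) * ennreal (norm (OU_semigroup (a * t\<^sup>2) f x)) \<partial>lborel)"
    have h0: "0 \<le> h t" if "0 < t" for t using a that by (simp add: h_def)
    have hm: "(\<lambda>t. indicator {t1..} t * ennreal (h t * v (a * t\<^sup>2))) \<in> borel_measurable lborel"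
      if "0 < t1" and [measurable]: "v \<in> borel_measurable borel" and v: "\<And>s. 0 \<le> v s" for t1 v
    proof -
      have [measurable]: "(\<lambda>t. indicator {t1..} t * ennreal (h t)) \<in> borel_measurable borel"
        unfolding h_def by (rule remainder_weight_measurable[OF a(1) that(1)])
      have "(\<lambda>t. indicator {t1..} t * ennreal (h t * v (a * t\<^sup>2))) = (\<lambda>t. indicator {t1..} t * ennreal (h t) * ennreal (v (a * t\<^sup>2)))"
        using h0 v that(1) by (auto simp: fun_eq_iff ennreal_mult split: split_indicator)
      also have "\<dots> \<in> borel_measurable lborel" by measurable
      finally show ?thesis .
    qed
    have um: "(\<lambda>s. norm (u s)) \<in> borel_measurable borel"
      by (intro borel_measurable_continuous_onI continuous_on_norm continuous_at_imp_continuous_on)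
        (auto intro: has_vector_derivative_continuous du)
    have Ile: "I \<le> (\<integral>\<^sup>+t. indicator {t0..T} t * ennreal (h t * norm (u (a * t\<^sup>2))) \<partial>lborel)
       + (\<integral>\<^sup>+t. indicator {T..} t * ennreal (h t * norm (u (a * t\<^sup>2))) \<partial>lborel)"
    proof -
      have "I \<le> (\<integral>\<^sup>+t. indicator {t0..T} t * ennreal (h t * norm (u (a * t\<^sup>2)))
         + indicator {T..} t * ennreal (h t * norm (u (a * t\<^sup>2))) \<partial>lborel)"
        unfolding I_def h_def by (intro nn_integral_mono) (auto split: split_indicator)
      also have "\<dots> = (\<integral>\<^sup>+t. indicator {t0..T} t * ennreal (h t * norm (u (a * t\<^sup>2))) \<partial>lborel)
       + (\<integral>\<^sup>+t. indicator {T..} t * ennreal (h t * norm (u (a * t\<^sup>2))) \<partial>lborel)"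
      proof (rule nn_integral_add)
        have "(\<lambda>t. indicator {t0..T} t * ennreal (h t * norm (u (a * t\<^sup>2))))
          = (\<lambda>t. indicator {..T} t * (indicator {t0..} t * ennreal (h t * norm (u (a * t\<^sup>2)))))"
          by (auto simp: fun_eq_iff split: split_indicator)
        also have "\<dots> \<in> borel_measurable lborel"
          by (intro borel_measurable_times_ennreal hm t0 um) auto
        finally show "(\<lambda>t. indicator {t0..T} t * ennreal (h t * norm (u (a * t\<^sup>2)))) \<in> borel_measurable lborel" .
        show "(\<lambda>t. indicator {T..} t * ennreal (h t * norm (u (a * t\<^sup>2)))) \<in> borel_measurable lborel"
          using T by (intro hm um) auto
      qed
      finally show ?thesis .
    qed
    have J2: "(\<integral>\<^sup>+t. indicator {T..} t * ennreal (h t * norm (u (a * t\<^sup>2))) \<partial>lborel) = J"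
      unfolding J_def
    proof (intro nn_integral_cong)
      fix t
      show "indicator {T..} t * ennreal (h t * norm (u (a * t\<^sup>2))) = indicator {T..} t * ennreal (h t) * ennreal (norm (OU_semigroup (a * t\<^sup>2) f x))"
      proof (cases "T \<le> t")
        case True
        then have "0 < t" using T by simp
        then show ?thesis using a by (simp add: uU ennreal_mult h0 mult.assoc)
      qed simp
    qed
    have Q: "(\<integral>\<^sup>+t. indicator {t0..T} t * ennreal (h t * norm (u (a * t\<^sup>2))) \<partial>lborel) \<le> ennreal (R / a\<^sup>2) * K"
    proof -
      have "(\<integral>\<^sup>+t. indicator {t0..T} t * ennreal (h t * norm (u (a * t\<^sup>2))) \<partial>lborel)
        \<le> (\<integral>\<^sup>+t. ennreal (R / a\<^sup>2) * (indicator {t0..T} t * ennreal (1 / t) * (\<integral>\<^sup>+y. ennreal (mehler (a * t\<^sup>2) x y) * ennreal (norm (f y)) \<partial>gaussian)) \<partial>lborel)"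
      proof (intro nn_integral_mono)
        fix t
        show "indicator {t0..T} t * ennreal (h t * norm (u (a * t\<^sup>2)))
          \<le> ennreal (R / a\<^sup>2) * (indicator {t0..T} t * ennreal (1 / t) * (\<integral>\<^sup>+y. ennreal (mehler (a * t\<^sup>2) x y) * ennreal (norm (f y)) \<partial>gaussian))"
        proof (cases "t \<in> {t0..T}")
          case True
          then have t: "0 < t" "t \<le> T" using t0 by auto
          have "ennreal (h t * norm (u (a * t\<^sup>2))) = ennreal (h t) * ennreal (norm (OU_semigroup (a * t\<^sup>2) f x))"
            using t a by (simp add: uU ennreal_mult h0)
          also have "\<dots> \<le> ennreal (R / a\<^sup>2 * (1 / t)) * (\<integral>\<^sup>+y. ennreal (mehler (a * t\<^sup>2) x y) * ennreal (norm (f y)) \<partial>gaussian)"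
            using rem[OF t] by (intro mult_mono ennreal_leI OU_semigroup_le_nn_integral) (auto simp: h_def)
          also have "ennreal (R / a\<^sup>2 * (1 / t)) = ennreal (R / a\<^sup>2) * ennreal (1 / t)"
            using R t by (intro ennreal_mult) auto
          finally show ?thesis using True by (simp add: mult.assoc)
        qed simp
      qed
      also have "\<dots> = ennreal (R / a\<^sup>2) * K"
        unfolding K_def t0_def by (subst local_kernel_row, measurable, rule nn_integral_cmult, measurable)
      finally show ?thesis .
    qed
    \<comment> \<open>The bound obtained here depends on f and x through A and t0; it only licenses
      the integration by parts and does not enter the constant.\<close>
    have Ifin: "I < \<infinity>"
    proof -
      have "(\<integral>\<^sup>+t. indicator {t0..T} t * ennreal (h t * norm (u (a * t\<^sup>2))) \<partial>lborel)
        \<le> (\<integral>\<^sup>+t. ennreal (R / a\<^sup>2 * (1 / t0) * A) * indicator {t0..T} t \<partial>lborel)"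
      proof (intro nn_integral_mono)
        fix t
        show "indicator {t0..T} t * ennreal (h t * norm (u (a * t\<^sup>2))) \<le> ennreal (R / a\<^sup>2 * (1 / t0) * A) * indicator {t0..T} t"
        proof (cases "t \<in> {t0..T}")
          case True
          then have t: "0 < t" "t \<le> T" "t0 \<le> t" using t0 by auto
          have "norm (u (a * t\<^sup>2)) \<le> A * exp (- (a * t\<^sup>2))" using t a by (intro bu) auto
          also have "\<dots> \<le> A * 1" using A a by (intro mult_left_mono) auto
          finally have uA: "norm (u (a * t\<^sup>2)) \<le> A" by simp
          have "h t \<le> R / a\<^sup>2 * (1 / t)" using rem[OF t(1,2)] by (simp add: h_def)
          also have "\<dots> \<le> R / a\<^sup>2 * (1 / t0)" using R t t0 by (intro mult_left_mono divide_left_mono) auto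
          finally have "h t * norm (u (a * t\<^sup>2)) \<le> R / a\<^sup>2 * (1 / t0) * A"
            using uA R t0 by (intro mult_mono) auto
          then show ?thesis using True by (simp add: ennreal_leI)
        qed simp
      qed
      also have "\<dots> < \<infinity>"
        by (subst nn_integral_cmult_indicator) (auto simp: ennreal_mult_less_top emeasure_lborel_Icc[OF t0T])
      finally have 1: "(\<integral>\<^sup>+t. indicator {t0..T} t * ennreal (h t * norm (u (a * t\<^sup>2))) \<partial>lborel) < \<infinity>" .
      have "(\<integral>\<^sup>+t. indicator {T..} t * ennreal (h t * norm (u (a * t\<^sup>2))) \<partial>lborel)
        \<le> (\<integral>\<^sup>+t. ennreal A * (indicator {T..} t * ennreal (h t * exp (- (a * t\<^sup>2)))) \<partial>lborel)"
      proof (intro nn_integral_mono)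
        fix t
        show "indicator {T..} t * ennreal (h t * norm (u (a * t\<^sup>2))) \<le> ennreal A * (indicator {T..} t * ennreal (h t * exp (- (a * t\<^sup>2))))"
        proof (cases "T \<le> t")
          case True
          then have t: "0 < t" using T by simp
          have "h t * norm (u (a * t\<^sup>2)) \<le> h t * (A * exp (- (a * t\<^sup>2)))"
            using t a by (intro mult_left_mono bu h0) auto
          then have "ennreal (h t * norm (u (a * t\<^sup>2))) \<le> ennreal A * ennreal (h t * exp (- (a * t\<^sup>2)))"
            using A h0[OF t] by (subst ennreal_mult[symmetric]) (auto intro!: ennreal_leI simp: mult_ac)
          then show ?thesis using True by simp
        qed simp
      qed
      also have "\<dots> = ennreal A * (\<integral>\<^sup>+t. indicator {T..} t * ennreal (h t * exp (- (a * t\<^sup>2))) \<partial>lborel)"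
        using T by (intro nn_integral_cmult hm[of T "\<lambda>s. exp (- s)"]) auto
      also have "\<dots> < \<infinity>" using fin unfolding a_def[symmetric] h_def by (simp add: ennreal_mult_less_top)
      finally show ?thesis using 1 order_le_less_trans[OF Ile] by simp
    qed
    have "pi3 \<Phi> \<delta> \<delta>' \<kappa> f x = (LINT t:{t0..}|lborel. \<Phi> (a * t\<^sup>2) * of_real (t ^ 3) * u2 (a * t\<^sup>2))"
      unfolding t0_def u2_def a_def using \<kappa> by (intro pi3_expansion assms(1) g U) auto
    then have "ennreal (norm (pi3 \<Phi> \<delta> \<delta>' \<kappa> f x)) \<le> ennreal (M / a\<^sup>2 * (S * norm (u1 S) + norm (u S))) + I"
      using integration_by_parts[OF a(1) t0 M du du1 cu2 A bu Ifin[unfolded I_def]] unfolding I_def S_def by simp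
    also have "ennreal (M / a\<^sup>2 * (S * norm (u1 S) + norm (u S))) = ennreal (M / a\<^sup>2) * (ennreal (S * norm (u1 S)) + ennreal (norm (u S)))"
      using M a S by (subst ennreal_plus[symmetric]) (auto simp: ennreal_mult[symmetric] simp del: ennreal_plus)
    also have "\<dots> \<le> ennreal (M / a\<^sup>2) * (ennreal Cb * K + ennreal Cb * K)"
    proof (intro mult_left_mono add_mono)
      have "((\<lambda>s. OU_semigroup s f x) has_vector_derivative u1 S) (at S)"
        by (rule has_vector_derivative_transform_within_open[OF du, of "{0<..}"]) (use S uU in auto)
      then have "u1 S = vector_derivative (\<lambda>s. OU_semigroup s f x) (at S)" by (simp add: vector_derivative_at)
      then show "ennreal (S * norm (u1 S)) \<le> ennreal Cb * K"
        using boundary_term_bound(1)[OF pf a \<kappa> T, of x] unfolding S_def t0_def Cb_def K_def by simp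
      show "ennreal (norm (u S)) \<le> ennreal Cb * K"
        using boundary_term_bound(2)[OF pf a \<kappa> T, of x] uU[OF S] unfolding S_def t0_def Cb_def K_def by simp
    qed auto
    also have "\<dots> = ennreal (M / a\<^sup>2 * (2 * Cb)) * K"
    proof -
      have "ennreal Cb * K + ennreal Cb * K = ennreal (2 * Cb) * K"
        unfolding mult_2 using Cb by (subst ennreal_plus) (auto simp: distrib_right)
      moreover have "ennreal (M / a\<^sup>2 * (2 * Cb)) = ennreal (M / a\<^sup>2) * ennreal (2 * Cb)"
        using M Cb by (intro ennreal_mult) auto
      ultimately show ?thesis by (simp only: mult.assoc)
    qed
    also have "I \<le> ennreal (R / a\<^sup>2) * K + J"
      using Ile Q unfolding J2 by (meson add_right_mono order_trans)
    finally have "ennreal (norm (pi3 \<Phi> \<delta> \<delta>' \<kappa> f x)) \<le> ennreal (M / a\<^sup>2 * (2 * Cb)) * K + (ennreal (R / a\<^sup>2) * K + J)"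
      by (simp add: add_left_mono)
    also have "\<dots> = ennreal C * K + J"
      unfolding C_def using M R a Cb by (subst ennreal_plus) (auto simp: distrib_right add.assoc)
    finally show "ennreal (norm (pi3 \<Phi> \<delta> \<delta>' \<kappa> f x)) \<le> ennreal C * (\<integral>\<^sup>+y. local_kernel (\<delta>' + \<delta>) \<kappa> T x y * ennreal (norm (f y)) \<partial>gaussian)
      + (\<integral>\<^sup>+t. indicator {T..} t * ennreal (t / (\<delta>' + \<delta>) * norm (remainder ((\<delta>' + \<delta>) * t\<^sup>2))) * ennreal (norm (OU_semigroup ((\<delta>' + \<delta>) * t\<^sup>2) f x)) \<partial>lborel)"
      unfolding K_def J_def h_def a_def .
  qed
qed

end

section \<open>Schur's test\<close>

text \<open>Hoelder's inequality is obtained from Young's inequality with a free parameter \<open>l\<close>, optimized at each \<open>x\<close>;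
  replacing \<open>z\<close> by a larger \<open>z'\<close> avoids a vanishing parameter.\<close>

lemma schur_test:
  fixes K :: "'a \<Rightarrow> 'a \<Rightarrow> ennreal" and h f F :: "'a \<Rightarrow> real"
  assumes M: "sigma_finite_measure M"
    and p: "1 < p" "1 < q" "1 / p + 1 / q = 1"
    and K[measurable]: "case_prod K \<in> borel_measurable (M \<Otimes>\<^sub>M M)"
    and h[measurable]: "h \<in> borel_measurable M" and h_pos: "\<And>x. 0 < h x"
    and f[measurable]: "f \<in> borel_measurable M" and f_nonneg: "\<And>x. 0 \<le> f x"
    and AB: "0 < A" "0 < B"
    and row: "\<And>x. x \<in> space M \<Longrightarrow> (\<integral>\<^sup>+y. K x y * ennreal (h y powr q) \<partial>M) \<le> ennreal (A * h x powr q)"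
    and col: "\<And>y. y \<in> space M \<Longrightarrow> (\<integral>\<^sup>+x. K x y * ennreal (h x powr p) \<partial>M) \<le> ennreal (B * h y powr p)"
    and F: "\<And>x. x \<in> space M \<Longrightarrow> 0 \<le> F x" "\<And>x. x \<in> space M \<Longrightarrow> ennreal (F x) \<le> (\<integral>\<^sup>+y. K x y * ennreal (f y) \<partial>M)"
  shows "(\<integral>\<^sup>+x. ennreal (F x powr p) \<partial>M) \<le> ennreal (A powr (p - 1) * B) * (\<integral>\<^sup>+y. ennreal (f y powr p) \<partial>M)"
proof -
  interpret M: sigma_finite_measure M by (rule M)
  interpret MM: pair_sigma_finite M M by unfold_locales
  have pq: "p + q = p * q" using p by (simp add: field_simps)
  have Kx[measurable]: "K x \<in> borel_measurable M" if "x \<in> space M" for x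
    using that by measurable
  define Z where "Z = (\<lambda>x. \<integral>\<^sup>+y. K x y * ennreal ((f y / h y) powr p) \<partial>M)"
  have pointwise: "ennreal (F x powr p) \<le> ennreal (A powr (p - 1)) * (ennreal (h x powr p) * Z x)"
    if x: "x \<in> space M" for x
  proof (cases "Z x")
    case top
    then show ?thesis using AB h_pos[of x] by (simp add: ennreal_mult_top)
  next
    case (real z)
    define H where "H = A * h x powr q"
    have H: "0 < H" using AB h_pos[of x] by (simp add: H_def)
    have Fz: "F x \<le> z' powr (1 / p) * H powr (1 / q)" if z': "0 < z'" "z \<le> z'" for z'
    proof -
      \<comment> \<open>This value balances the two Young terms: before the weights 1/p and 1/q,
        both equal z'^{1/p} H^{1/q}.\<close>
      define l where "l = (z' / H) powr (1 / (p * q))"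
      have l: "0 < l" using z' H by (simp add: l_def)
      have lq: "l powr q = (z' / H) powr (1 / p)" using p by (simp add: l_def powr_powr)
      have lp: "l powr p = (z' / H) powr (1 / q)" using p by (simp add: l_def powr_powr)
      have young: "f y \<le> l powr q / q * h y powr q + 1 / (l powr p * p) * (f y / h y) powr p" for y
      proof -
        have "f y = (f y / h y / l) * (l * h y)" using l h_pos[of y] by simp
        also have "\<dots> \<le> (f y / h y / l) powr p / p + (l * h y) powr q / q"
          using p l h_pos[of y] f_nonneg[of y] by (intro Youngs_inequality) auto
        also have "(f y / h y / l) powr p = (f y / h y) powr p / l powr p"
          by (rule powr_divide)
        also have "(l * h y) powr q = l powr q * h y powr q"
          by (rule powr_mult)
        finally show ?thesis by (simp add: mult.commute)
      qed
      have "ennreal (F x) \<le> (\<integral>\<^sup>+y. K x y * ennreal (f y) \<partial>M)" by (rule F(2)[OF x])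
      also have "\<dots> \<le> (\<integral>\<^sup>+y. ennreal (l powr q / q) * (K x y * ennreal (h y powr q))
          + ennreal (1 / (l powr p * p)) * (K x y * ennreal ((f y / h y) powr p)) \<partial>M)"
      proof (intro nn_integral_mono)
        fix y
        have "K x y * ennreal (f y) \<le> K x y * ennreal (l powr q / q * h y powr q + 1 / (l powr p * p) * (f y / h y) powr p)"
          by (intro mult_left_mono ennreal_leI young) auto
        also have "\<dots> = K x y * (ennreal (l powr q / q) * ennreal (h y powr q) + ennreal (1 / (l powr p * p)) * ennreal ((f y / h y) powr p))"
          using p by (subst ennreal_plus) (auto simp: ennreal_mult[symmetric])
        finally show "K x y * ennreal (f y) \<le> ennreal (l powr q / q) * (K x y * ennreal (h y powr q))
          + ennreal (1 / (l powr p * p)) * (K x y * ennreal ((f y / h y) powr p))"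
          by (simp add: distrib_left mult_ac)
      qed
      also have "\<dots> = ennreal (l powr q / q) * (\<integral>\<^sup>+y. K x y * ennreal (h y powr q) \<partial>M) + ennreal (1 / (l powr p * p)) * Z x"
        unfolding Z_def using x by (subst nn_integral_add, measurable, subst (1 2) nn_integral_cmult, auto)
      also have "\<dots> \<le> ennreal (l powr q / q) * ennreal H + ennreal (1 / (l powr p * p)) * ennreal z'"
        unfolding H_def real(2) using real(1) z' by (intro add_mono mult_left_mono row x ennreal_leI) auto
      also have "\<dots> = ennreal (l powr q / q * H + 1 / (l powr p * p) * z')"
        using p H z' by (subst ennreal_plus) (auto simp: ennreal_mult[symmetric])
      finally have "F x \<le> l powr q / q * H + 1 / (l powr p * p) * z'"
        using p H z' by (subst (asm) ennreal_le_iff) auto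
      also have "\<dots> = (1 / q) * ((z' / H) powr (1 / p) * H) + (1 / p) * (z' / (z' / H) powr (1 / q))"
        unfolding lq lp by simp
      also have "(z' / H) powr (1 / p) * H = z' powr (1 / p) * H powr (1 / q)"
      proof -
        have "H = H powr (1 / p + 1 / q)" using H p by simp
        then have "H = H powr (1 / p) * H powr (1 / q)" by (simp only: powr_add)
        then have "(z' / H) powr (1 / p) * H = (z' powr (1 / p) / H powr (1 / p)) * (H powr (1 / p) * H powr (1 / q))"
          using z' H by (simp add: powr_divide)
        then show ?thesis using H by simp
      qed
      also have "z' / (z' / H) powr (1 / q) = z' powr (1 / p) * H powr (1 / q)"
      proof -
        have "z' = z' powr (1 / p + 1 / q)" using z' p by simp
        then have "z' = z' powr (1 / p) * z' powr (1 / q)" by (simp only: powr_add)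
        then have "z' / (z' / H) powr (1 / q) = (z' powr (1 / p) * z' powr (1 / q)) / (z' powr (1 / q) / H powr (1 / q))"
          using z' H by (simp add: powr_divide)
        then show ?thesis using z' by simp
      qed
      also have "(1 / q) * (z' powr (1 / p) * H powr (1 / q)) + (1 / p) * (z' powr (1 / p) * H powr (1 / q))
        = (1 / p + 1 / q) * (z' powr (1 / p) * H powr (1 / q))" by (simp add: algebra_simps)
      finally show ?thesis unfolding p(3) by simp
    qed
    have Fz': "F x powr p \<le> A powr (p - 1) * h x powr p * z'" if z': "0 < z'" "z \<le> z'" for z'
    proof -
      have "F x powr p \<le> (z' powr (1 / p) * H powr (1 / q)) powr p"
        using p F(1)[OF x] by (intro powr_mono2 Fz z') auto
      also have "\<dots> = z' * H powr (p / q)" using p z' H by (simp add: powr_mult powr_powr)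
      also have "p / q = p - 1" using pq p by (simp add: field_simps)
      also have "H powr (p - 1) = A powr (p - 1) * h x powr (q * (p - 1))"
        using AB h_pos[of x] by (simp add: H_def powr_mult powr_powr)
      also have "q * (p - 1) = p" using pq by (simp add: algebra_simps)
      finally show ?thesis by (simp add: mult_ac)
    qed
    define c where "c = A powr (p - 1) * h x powr p"
    have c: "0 < c" using AB h_pos[of x] by (simp add: c_def)
    have "F x powr p \<le> c * z"
    proof (rule field_le_epsilon)
      fix e :: real assume e: "0 < e"
      have "F x powr p \<le> c * (z + e / c)"
        using e c real(1) unfolding c_def by (intro Fz') (auto intro: add_nonneg_pos)
      then show "F x powr p \<le> c * z + e" using c by (simp add: distrib_left)
    qed
    then have "F x powr p \<le> A powr (p - 1) * h x powr p * z" unfolding c_def .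
    then show ?thesis unfolding real(2) using real(1) by (simp add: ennreal_mult[symmetric] ennreal_leI mult.assoc)
  qed
  have "(\<integral>\<^sup>+x. ennreal (F x powr p) \<partial>M) \<le> (\<integral>\<^sup>+x. ennreal (A powr (p - 1)) * (ennreal (h x powr p) * Z x) \<partial>M)"
    by (intro nn_integral_mono pointwise)
  also have "\<dots> = ennreal (A powr (p - 1)) * (\<integral>\<^sup>+x. ennreal (h x powr p) * Z x \<partial>M)"
    unfolding Z_def by (rule nn_integral_cmult) measurable
  also have "(\<integral>\<^sup>+x. ennreal (h x powr p) * Z x \<partial>M)
    = (\<integral>\<^sup>+x. (\<integral>\<^sup>+y. ennreal (h x powr p) * (K x y * ennreal ((f y / h y) powr p)) \<partial>M) \<partial>M)"
    unfolding Z_def by (intro nn_integral_cong nn_integral_cmult[symmetric]) measurable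
  also have "\<dots> = (\<integral>\<^sup>+y. (\<integral>\<^sup>+x. ennreal (h x powr p) * (K x y * ennreal ((f y / h y) powr p)) \<partial>M) \<partial>M)"
    by (rule MM.Fubini'[symmetric]) measurable
  also have "\<dots> = (\<integral>\<^sup>+y. (\<integral>\<^sup>+x. K x y * ennreal (h x powr p) \<partial>M) * ennreal ((f y / h y) powr p) \<partial>M)"
  proof (intro nn_integral_cong)
    fix y assume "y \<in> space M"
    then have "(\<integral>\<^sup>+x. K x y * ennreal (h x powr p) * ennreal ((f y / h y) powr p) \<partial>M)
      = (\<integral>\<^sup>+x. K x y * ennreal (h x powr p) \<partial>M) * ennreal ((f y / h y) powr p)"
      by (intro nn_integral_multc) measurable
    then show "(\<integral>\<^sup>+x. ennreal (h x powr p) * (K x y * ennreal ((f y / h y) powr p)) \<partial>M)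
      = (\<integral>\<^sup>+x. K x y * ennreal (h x powr p) \<partial>M) * ennreal ((f y / h y) powr p)"
      by (simp add: mult_ac)
  qed
  also have "\<dots> \<le> (\<integral>\<^sup>+y. ennreal B * ennreal (f y powr p) \<partial>M)"
  proof (intro nn_integral_mono)
    fix y assume y: "y \<in> space M"
    have "(\<integral>\<^sup>+x. K x y * ennreal (h x powr p) \<partial>M) * ennreal ((f y / h y) powr p)
      \<le> ennreal (B * h y powr p) * ennreal ((f y / h y) powr p)"
      by (intro mult_right_mono col y) auto
    also have "\<dots> = ennreal (B * f y powr p)"
      using AB f_nonneg[of y] h_pos[of y] by (simp add: ennreal_mult[symmetric] powr_divide)
    finally show "(\<integral>\<^sup>+x. K x y * ennreal (h x powr p) \<partial>M) * ennreal ((f y / h y) powr p) \<le> ennreal B * ennreal (f y powr p)"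
      using AB by (simp add: ennreal_mult)
  qed
  also have "\<dots> = ennreal B * (\<integral>\<^sup>+y. ennreal (f y powr p) \<partial>M)"
    by (rule nn_integral_cmult) measurable
  finally show ?thesis
    using AB by (simp add: ennreal_mult mult.assoc mult_left_mono)
qed

text \<open>Finiteness of the integral for g carries over to F, so membership in L^p is part of the
  conclusion. If g is not in L^p the right side is infinite, where C > 0 excludes the product 0
  times infinity.\<close>

lemma gaussian_Lp_le:
  fixes F g :: "real ^ 'n \<Rightarrow> complex"
  assumes F[measurable]: "F \<in> borel_measurable borel" and p: "0 < p" and C: "0 < C"
    and le: "(\<integral>\<^sup>+x. ennreal (norm (F x) powr p) \<partial>gaussian) \<le> ennreal (C powr p) * (\<integral>\<^sup>+x. ennreal (norm (g x) powr p) \<partial>gaussian)"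
  shows "gaussian_Lp p F \<le> ennreal C * gaussian_Lp p g"
proof (cases "g \<in> borel_measurable gaussian \<and> integrable gaussian (\<lambda>x. norm (g x) powr p)")
  case False
  then have "gaussian_Lp p g = \<infinity>" by (simp add: gaussian_Lp_def)
  then show ?thesis using C by (simp add: ennreal_mult_top)
next
  case True
  define I where "I = (LINT x|gaussian. norm (g x) powr p)"
  have I: "0 \<le> I" by (simp add: I_def)
  have "(\<integral>\<^sup>+x. ennreal (norm (g x) powr p) \<partial>gaussian) = ennreal I"
    unfolding I_def using True by (intro nn_integral_eq_integral) auto
  then have le': "(\<integral>\<^sup>+x. ennreal (norm (F x) powr p) \<partial>gaussian) \<le> ennreal (C powr p * I)"
    using le I by (simp add: ennreal_mult)
  have int: "integrable gaussian (\<lambda>x. norm (F x) powr p)"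
    by (rule integrableI_bounded) (use le' in \<open>auto intro: le_less_trans\<close>)
  have "(LINT x|gaussian. norm (F x) powr p) \<le> C powr p * I"
    using le' I unfolding nn_integral_eq_integral[OF int, simplified] by (subst (asm) ennreal_le_iff) auto
  then have "(LINT x|gaussian. norm (F x) powr p) powr (1 / p) \<le> (C powr p * I) powr (1 / p)"
    using p by (intro powr_mono2) auto
  also have "\<dots> = C * I powr (1 / p)" using C I p by (simp add: powr_mult powr_powr)
  finally have "gaussian_Lp p F \<le> ennreal (C * I powr (1 / p))"
    using int by (simp add: gaussian_Lp_def ennreal_leI)
  also have "\<dots> = ennreal C * gaussian_Lp p g"
    using True C by (simp add: gaussian_Lp_def I_def ennreal_mult)
  finally show ?thesis .
qed

section \<open>The two estimates\<close>

text \<open>The substitution s = at^2, of which only finiteness is kept. The change of variables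
  holds for the completed measure, hence the passage through \<open>lebesgue\<close> and
  back.\<close>

lemma nn_integral_square_substitution_finite:
  fixes f :: "real \<Rightarrow> real"
  assumes "0 < a" "0 < T" "set_integrable lborel {a * T\<^sup>2..} f" "\<And>s. 0 \<le> f s"
  shows "(\<integral>\<^sup>+t. indicator {T..} t * ennreal (t * f (a * t\<^sup>2)) \<partial>lborel) < \<infinity>"
proof -
  have im: "(\<lambda>t. a * t\<^sup>2) ` {T..} = {a * T\<^sup>2..}"
  proof
    show "(\<lambda>t. a * t\<^sup>2) ` {T..} \<subseteq> {a * T\<^sup>2..}" using assms by (auto intro!: power_mono)
    show "{a * T\<^sup>2..} \<subseteq> (\<lambda>t. a * t\<^sup>2) ` {T..}"
    proof
      fix s assume "s \<in> {a * T\<^sup>2..}"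
      then have s: "T\<^sup>2 \<le> s / a" using assms by (simp add: field_simps)
      then have "T \<le> sqrt (s / a)" using assms by (intro real_le_rsqrt)
      moreover have "s = a * (sqrt (s / a))\<^sup>2"
        using assms s order_trans[OF zero_le_power2 s] by simp
      ultimately show "s \<in> (\<lambda>t. a * t\<^sup>2) ` {T..}" by blast
    qed
  qed
  have "f absolutely_integrable_on {a * T\<^sup>2..}"
    using assms(3) unfolding set_integrable_def
    by (subst integrable_completion) auto
  then have "(\<lambda>t. \<bar>2 * a * t\<bar> * f (a * t\<^sup>2)) absolutely_integrable_on {T..}"
  proof -
    have "inj_on (\<lambda>t. a * t\<^sup>2) {T..}"
      using assms by (auto simp: inj_on_def power2_eq_iff)
    moreover have "((\<lambda>t. a * t\<^sup>2) has_field_derivative 2 * a * t) (at t within {T..})" for t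
      by (auto intro!: derivative_eq_intros)
    ultimately show ?thesis
      using has_absolute_integral_change_of_variables_1'[of "{T..}" "\<lambda>t. a * t\<^sup>2" "\<lambda>t. 2 * a * t" f]
        \<open>f absolutely_integrable_on {a * T\<^sup>2..}\<close> unfolding im by auto
  qed
  then have "(\<integral>\<^sup>+t. ennreal (norm (indicator {T..} t *\<^sub>R (\<bar>2 * a * t\<bar> * f (a * t\<^sup>2)))) \<partial>lebesgue) < \<infinity>"
    unfolding set_integrable_def integrable_iff_bounded by blast
  then have fin: "(\<integral>\<^sup>+t. ennreal (norm (indicator {T..} t *\<^sub>R (\<bar>2 * a * t\<bar> * f (a * t\<^sup>2)))) \<partial>lborel) < \<infinity>"
    by (simp add: nn_integral_completion)
  have *: "indicator {T..} t * ennreal (t * f (a * t\<^sup>2)) = ennreal (1 / (2 * a)) * ennreal (norm (indicator {T..} t *\<^sub>R (\<bar>2 * a * t\<bar> * f (a * t\<^sup>2))))" for t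
    using assms by (auto simp: ennreal_mult[symmetric] abs_mult split: split_indicator)
  have "(\<lambda>t. indicator {T..} t *\<^sub>R (\<bar>2 * a * t\<bar> * f (a * t\<^sup>2))) \<in> borel_measurable borel"
  proof -
    have [measurable]: "(\<lambda>s. indicator {a * T\<^sup>2..} s *\<^sub>R f s) \<in> borel_measurable borel"
      using assms(3) unfolding set_integrable_def by auto
    have "(\<lambda>t. indicator {T..} t *\<^sub>R (\<bar>2 * a * t\<bar> * f (a * t\<^sup>2)))
       = (\<lambda>t. indicator {T..} t * (\<bar>2 * a * t\<bar> * (indicator {a * T\<^sup>2..} (a * t\<^sup>2) *\<^sub>R f (a * t\<^sup>2))))"
      using im by (auto simp: fun_eq_iff split: split_indicator)
    also have "\<dots> \<in> borel_measurable borel" by measurable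
    finally show ?thesis .
  qed
  then show ?thesis
    unfolding * using fin by (subst nn_integral_cmult) (auto simp: ennreal_mult_less_top)
qed

lemma nn_integral_exp_gaussian_finite:
  assumes "\<alpha> < 1"
  obtains E where "0 \<le> E" "(\<integral>\<^sup>+y. ennreal (exp (\<alpha> * (norm y)\<^sup>2)) \<partial>(gaussian :: (real ^ 'n) measure)) = ennreal E"
proof -
  have "integrable gaussian (\<lambda>y :: real ^ 'n. norm (complex_of_real (exp (\<alpha> * (norm y)\<^sup>2)) * 1))"
    by (intro integrable_norm integrable_gaussian_exp_poly poly_fn.const assms)
  then have "integrable gaussian (\<lambda>y :: real ^ 'n. exp (\<alpha> * (norm y)\<^sup>2))" by simp
  then have "(\<integral>\<^sup>+y. ennreal (exp (\<alpha> * (norm y)\<^sup>2)) \<partial>(gaussian :: (real ^ 'n) measure)) = ennreal (LINT y|gaussian. exp (\<alpha> * (norm (y :: real ^ 'n))\<^sup>2))"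
    by (intro nn_integral_eq_integral) auto
  then show ?thesis by (intro that[of "LINT y|gaussian. exp (\<alpha> * (norm (y :: real ^ 'n))\<^sup>2)"]) auto
qed

context multiplier
begin

lemma norm_remainder_le: "0 < s \<Longrightarrow> norm (remainder s) \<le> 2 * (norm (\<Phi>' s) + s * norm (\<Phi>'' s))"
  unfolding remainder_def by (rule order_trans[OF norm_triangle_ineq]) (simp add: norm_mult)

text \<open>Tonelli's theorem reduces the local part to the logarithmic column bound. In the tail
  the symmetry of M_s and its mass 1 give contractivity on L^1 at each time, and the weight H,
  finite by the hypothesis on \<Phi>', \<Phi>'', is integrated afterwards.\<close>

lemma pi3_weighted_L1_bound:
  assumes a: "0 < \<delta>' + \<delta>" "\<delta>' + \<delta> \<le> 2" and \<kappa>: "4 \<le> \<kappa>"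
    and int: "set_integrable lborel {1..} (\<lambda>t. norm (\<Phi>' t) + t * norm (\<Phi>'' t))"
  shows "\<exists>C\<ge>0. \<forall>f :: real ^ 'n \<Rightarrow> complex. mean_zero_polynomial f \<longrightarrow>
    gaussian_Lp 1 (pi3 \<Phi> \<delta> \<delta>' \<kappa> f) \<le> ennreal C * gaussian_Lp 1 (\<lambda>x. of_real (1 + log_plus (norm x)) * f x)"
proof -
  define a where "a = \<delta>' + \<delta>"
  note a' = a and a = a[folded a_def]
  \<comment> \<open>This makes aT^2 \<ge> 1, so in the tail the multiplier is evaluated on
    [1,\<infinity>), where the hypothesis applies.\<close>
  define T where "T = max 1 (1 / a)"
  have T: "1 \<le> T" "1 / a \<le> T" by (auto simp: T_def)
  have aT: "1 \<le> a * T\<^sup>2"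
  proof -
    have "a * (1 / a) \<le> a * T" using T a by (intro mult_left_mono) auto
    also have "\<dots> \<le> a * (T * T)" using T a by (intro mult_left_mono mult_right_mono[of 1 T T, simplified]) auto
    finally show ?thesis using a by (simp add: power2_eq_square)
  qed
  define H where "H = (\<lambda>t. indicator {T..} t * ennreal (t / a * norm (remainder (a * t\<^sup>2))))"
  have [measurable]: "H \<in> borel_measurable borel"
    unfolding H_def using a T by (intro remainder_weight_measurable) auto
  have "set_integrable lborel {1..} (\<lambda>s. norm (remainder s))"
  proof (rule set_integrable_continuous_on)
    show "continuous_on {1..} (\<lambda>s. norm (remainder s))"
      by (intro continuous_intros continuous_on_subset[OF continuous_remainder]) auto
    have "(\<integral>\<^sup>+t. ennreal (norm (indicator {1..} t *\<^sub>R (norm (\<Phi>' t) + t * norm (\<Phi>'' t)))) \<partial>lborel) < \<infinity>"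
      using int unfolding set_integrable_def integrable_iff_bounded by blast
    moreover have "(\<integral>\<^sup>+t. indicator {1..} t * ennreal (norm (norm (remainder t))) \<partial>lborel)
      \<le> (\<integral>\<^sup>+t. ennreal 2 * ennreal (norm (indicator {1..} t *\<^sub>R (norm (\<Phi>' t) + t * norm (\<Phi>'' t)))) \<partial>lborel)"
    proof (intro nn_integral_mono)
      fix t :: real
      show "indicator {1..} t * ennreal (norm (norm (remainder t))) \<le> ennreal 2 * ennreal (norm (indicator {1..} t *\<^sub>R (norm (\<Phi>' t) + t * norm (\<Phi>'' t))))"
      proof (cases "1 \<le> t")
        case True
        then have "norm (remainder t) \<le> 2 * norm (indicator {1..} t *\<^sub>R (norm (\<Phi>' t) + t * norm (\<Phi>'' t)))"
          using norm_remainder_le[of t] by simp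
        then have "ennreal (norm (remainder t)) \<le> ennreal 2 * ennreal (norm (indicator {1..} t *\<^sub>R (norm (\<Phi>' t) + t * norm (\<Phi>'' t))))"
          by (subst ennreal_mult[symmetric]) (simp_all only: ennreal_leI norm_ge_zero zero_le_numeral)
        then show ?thesis using True by simp
      qed simp
    qed
    moreover have "(\<integral>\<^sup>+t. ennreal 2 * ennreal (norm (indicator {1..} t *\<^sub>R (norm (\<Phi>' t) + t * norm (\<Phi>'' t)))) \<partial>lborel)
      = ennreal 2 * (\<integral>\<^sup>+t. ennreal (norm (indicator {1..} t *\<^sub>R (norm (\<Phi>' t) + t * norm (\<Phi>'' t)))) \<partial>lborel)"
      using int unfolding set_integrable_def by (intro nn_integral_cmult) auto
    ultimately show "(\<integral>\<^sup>+t. indicator {1..} t * ennreal (norm (norm (remainder t))) \<partial>lborel) < \<infinity>"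
      by (auto simp: ennreal_mult_less_top intro: le_less_trans)
  qed auto
  then have "set_integrable lborel {a * T\<^sup>2..} (\<lambda>s. norm (remainder s))"
    by (rule set_integrable_subset) (use aT in auto)
  then have "(\<integral>\<^sup>+t. indicator {T..} t * ennreal (t * norm (remainder (a * t\<^sup>2))) \<partial>lborel) < \<infinity>"
    using a T by (intro nn_integral_square_substitution_finite) auto
  moreover have "(\<integral>\<^sup>+t. H t \<partial>lborel) = ennreal (1 / a) * (\<integral>\<^sup>+t. indicator {T..} t * ennreal (t * norm (remainder (a * t\<^sup>2))) \<partial>lborel)"
  proof -
    have "indicator {T..} t * ennreal (t * norm (remainder (a * t\<^sup>2))) = ennreal a * H t" for t
      using a T by (auto simp: H_def ennreal_mult[symmetric] split: split_indicator)
    then have "(\<integral>\<^sup>+t. indicator {T..} t * ennreal (t * norm (remainder (a * t\<^sup>2))) \<partial>lborel) = ennreal a * (\<integral>\<^sup>+t. H t \<partial>lborel)"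
      by (simp add: nn_integral_cmult)
    then show ?thesis using a by (simp add: mult.assoc[symmetric] ennreal_mult[symmetric])
  qed
  ultimately have Hfin: "(\<integral>\<^sup>+t. H t \<partial>lborel) < \<infinity>" by (simp add: ennreal_mult_less_top)
  then obtain j where j: "0 \<le> j" "(\<integral>\<^sup>+t. H t \<partial>lborel) = ennreal j"
    by (cases "\<integral>\<^sup>+t. H t \<partial>lborel") auto
  have "(\<integral>\<^sup>+t. indicator {T..} t * ennreal (t / a * norm (remainder (a * t\<^sup>2)) * exp (- (a * t\<^sup>2))) \<partial>lborel) \<le> (\<integral>\<^sup>+t. H t \<partial>lborel)"
  proof (intro nn_integral_mono)
    fix t
    show "indicator {T..} t * ennreal (t / a * norm (remainder (a * t\<^sup>2)) * exp (- (a * t\<^sup>2))) \<le> H t"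
    proof (cases "T \<le> t")
      case True
      then have "t / a * norm (remainder (a * t\<^sup>2)) * exp (- (a * t\<^sup>2)) \<le> t / a * norm (remainder (a * t\<^sup>2)) * 1"
        using a T by (intro mult_left_mono) auto
      then show ?thesis using True by (simp add: H_def ennreal_leI)
    qed simp
  qed
  then have fin: "(\<integral>\<^sup>+t. indicator {T..} t * ennreal (t / a * norm (remainder (a * t\<^sup>2)) * exp (- (a * t\<^sup>2))) \<partial>lborel) < \<infinity>"
    using Hfin by (rule le_less_trans)
  have T2: "1 / 2 \<le> T" using T by simp
  obtain C0 where C0: "0 < C0" "\<And>(f :: real ^ 'n \<Rightarrow> complex) x. mean_zero_polynomial f \<Longrightarrow>
    ennreal (norm (pi3 \<Phi> \<delta> \<delta>' \<kappa> f x)) \<le> ennreal C0 * (\<integral>\<^sup>+y. local_kernel a \<kappa> T x y * ennreal (norm (f y)) \<partial>gaussian)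
      + (\<integral>\<^sup>+t. H t * ennreal (norm (OU_semigroup (a * t\<^sup>2) f x)) \<partial>lborel)"
    using pi3_pointwise_bound[OF a' \<kappa> T2 fin[unfolded a_def]] unfolding a_def[symmetric] H_def by blast
  have \<kappa>0: "0 < \<kappa>" and T0: "0 < T" using \<kappa> T by auto
  obtain C1 where C1: "0 < C1" "\<And>y :: real ^ 'n.
    (\<integral>\<^sup>+x. local_kernel a \<kappa> T x y \<partial>gaussian) \<le> ennreal (C1 * (1 + log_plus (norm y)))"
    using local_kernel_column_log[OF a(1) \<kappa>0 T0] by blast
  define C where "C = C0 * C1 + j"
  have C: "0 < C" using C0 C1 j by (simp add: C_def add_pos_nonneg)
  have lp: "0 \<le> log_plus r" for r by (simp add: log_plus_def)
  have [measurable]: "log_plus \<in> borel_measurable borel" unfolding log_plus_def by measurable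
  show ?thesis
  proof (intro exI[of _ C] conjI allI impI)
    show "0 \<le> C" using C by simp
    fix f :: "real ^ 'n \<Rightarrow> complex" assume f: "mean_zero_polynomial f"
    have pf: "poly_fn f" using f by (auto simp: mean_zero_polynomial_def intro: poly_fn_of_polynomial_function)
    note [measurable] = poly_fn_measurable[OF pf]
    define W where "W = (\<integral>\<^sup>+y. ennreal ((1 + log_plus (norm y)) * norm (f y)) \<partial>gaussian)"
    have K: "(\<integral>\<^sup>+x. (\<integral>\<^sup>+y. local_kernel a \<kappa> T x y * ennreal (norm (f y)) \<partial>gaussian) \<partial>gaussian) \<le> ennreal C1 * W"
    proof -
      have "(\<integral>\<^sup>+x. (\<integral>\<^sup>+y. local_kernel a \<kappa> T x y * ennreal (norm (f y)) \<partial>gaussian) \<partial>gaussian)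
        = (\<integral>\<^sup>+y. (\<integral>\<^sup>+x. local_kernel a \<kappa> T x y * ennreal (norm (f y)) \<partial>gaussian) \<partial>gaussian)"
        by (rule gaussian_gaussian.Fubini'[symmetric]) measurable
      also have "\<dots> = (\<integral>\<^sup>+y. (\<integral>\<^sup>+x. local_kernel a \<kappa> T x y \<partial>gaussian) * ennreal (norm (f y)) \<partial>gaussian)"
        by (intro nn_integral_cong nn_integral_multc) measurable
      also have "\<dots> \<le> (\<integral>\<^sup>+y. ennreal (C1 * (1 + log_plus (norm y))) * ennreal (norm (f y)) \<partial>gaussian)"
        by (intro nn_integral_mono mult_right_mono C1) auto
      also have "\<dots> = (\<integral>\<^sup>+y. ennreal C1 * ennreal ((1 + log_plus (norm y)) * norm (f y)) \<partial>gaussian)"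
        using C1 lp by (intro nn_integral_cong) (simp add: ennreal_mult[symmetric] mult.assoc)
      also have "\<dots> = ennreal C1 * W" unfolding W_def by (rule nn_integral_cmult) measurable
      finally show ?thesis .
    qed
    have J: "(\<integral>\<^sup>+x. (\<integral>\<^sup>+t. H t * ennreal (norm (OU_semigroup (a * t\<^sup>2) f x)) \<partial>lborel) \<partial>gaussian) \<le> ennreal j * W"
    proof -
      have "(\<integral>\<^sup>+x. (\<integral>\<^sup>+t. H t * ennreal (norm (OU_semigroup (a * t\<^sup>2) f x)) \<partial>lborel) \<partial>gaussian)
        \<le> (\<integral>\<^sup>+x. (\<integral>\<^sup>+t. H t * (\<integral>\<^sup>+y. ennreal (mehler (a * t\<^sup>2) x y) * ennreal (norm (f y)) \<partial>gaussian) \<partial>lborel) \<partial>gaussian)"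
        by (intro nn_integral_mono mult_left_mono OU_semigroup_le_nn_integral) auto
      also have "\<dots> = (\<integral>\<^sup>+t. (\<integral>\<^sup>+x. H t * (\<integral>\<^sup>+y. ennreal (mehler (a * t\<^sup>2) x y) * ennreal (norm (f y)) \<partial>gaussian) \<partial>gaussian) \<partial>lborel)"
        by (rule gaussian_lborel.Fubini'[symmetric]) measurable
      also have "\<dots> = (\<integral>\<^sup>+t. H t * (\<integral>\<^sup>+x. (\<integral>\<^sup>+y. ennreal (mehler (a * t\<^sup>2) x y) * ennreal (norm (f y)) \<partial>gaussian) \<partial>gaussian) \<partial>lborel)"
        by (intro nn_integral_cong nn_integral_cmult) measurable
      also have "\<dots> \<le> (\<integral>\<^sup>+t. H t * W \<partial>lborel)"
      proof (intro nn_integral_mono)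
        fix t :: real
        show "H t * (\<integral>\<^sup>+x. (\<integral>\<^sup>+y. ennreal (mehler (a * t\<^sup>2) x y) * ennreal (norm (f y)) \<partial>gaussian) \<partial>gaussian) \<le> H t * W"
        proof (cases "T \<le> t")
          case True
          then have s: "0 < a * t\<^sup>2" using T a by simp
          have "(\<integral>\<^sup>+x. (\<integral>\<^sup>+y. ennreal (mehler (a * t\<^sup>2) x y) * ennreal (norm (f y)) \<partial>gaussian) \<partial>gaussian)
            = (\<integral>\<^sup>+y. (\<integral>\<^sup>+x. ennreal (mehler (a * t\<^sup>2) x y) * ennreal (norm (f y)) \<partial>gaussian) \<partial>gaussian)"
            by (rule gaussian_gaussian.Fubini'[symmetric]) measurable
          also have "\<dots> = (\<integral>\<^sup>+y. (\<integral>\<^sup>+x. ennreal (mehler (a * t\<^sup>2) y x) \<partial>gaussian) * ennreal (norm (f y)) \<partial>gaussian)"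
            by (simp add: mehler_commute[of _ _ "_ :: real ^ 'n"] nn_integral_multc)
          also have "\<dots> = (\<integral>\<^sup>+y. ennreal (norm (f y)) \<partial>gaussian)" by (simp add: nn_integral_mehler_1[OF s])
          also have "\<dots> \<le> W"
            unfolding W_def using lp by (intro nn_integral_mono ennreal_leI) (simp add: distrib_right)
          finally show ?thesis by (rule mult_left_mono) simp
        qed (simp add: H_def)
      qed
      also have "\<dots> = ennreal j * W" by (simp add: nn_integral_multc j)
      finally show ?thesis .
    qed
    show "gaussian_Lp 1 (pi3 \<Phi> \<delta> \<delta>' \<kappa> f) \<le> ennreal C * gaussian_Lp 1 (\<lambda>x. of_real (1 + log_plus (norm x)) * f x)"
    proof (rule gaussian_Lp_le)
      show "pi3 \<Phi> \<delta> \<delta>' \<kappa> f \<in> borel_measurable borel" by (rule pi3_measurable[OF a'(1) \<kappa>0 f])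
      have "(\<integral>\<^sup>+x. ennreal (norm (pi3 \<Phi> \<delta> \<delta>' \<kappa> f x) powr 1) \<partial>gaussian)
        \<le> (\<integral>\<^sup>+x. ennreal C0 * (\<integral>\<^sup>+y. local_kernel a \<kappa> T x y * ennreal (norm (f y)) \<partial>gaussian)
          + (\<integral>\<^sup>+t. H t * ennreal (norm (OU_semigroup (a * t\<^sup>2) f x)) \<partial>lborel) \<partial>gaussian)"
        using C0(2)[OF f] by (intro nn_integral_mono) simp
      also have "\<dots> = ennreal C0 * (\<integral>\<^sup>+x. (\<integral>\<^sup>+y. local_kernel a \<kappa> T x y * ennreal (norm (f y)) \<partial>gaussian) \<partial>gaussian)
          + (\<integral>\<^sup>+x. (\<integral>\<^sup>+t. H t * ennreal (norm (OU_semigroup (a * t\<^sup>2) f x)) \<partial>lborel) \<partial>gaussian)"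
      proof -
        have [measurable]: "(\<lambda>z. OU_semigroup (a * (snd z)\<^sup>2) f (fst z)) \<in> borel_measurable (gaussian \<Otimes>\<^sub>M lborel)"
          unfolding OU_semigroup_def by measurable
        show ?thesis by (subst nn_integral_add, measurable, subst nn_integral_cmult, measurable)
      qed
      also have "\<dots> \<le> ennreal C0 * (ennreal C1 * W) + ennreal j * W"
        using K J by (intro add_mono mult_left_mono) auto
      also have "\<dots> = ennreal (C powr 1) * W"
        using C0 C1 j C by (simp add: C_def ennreal_plus ennreal_mult distrib_right mult.assoc)
      also have "W = (\<integral>\<^sup>+x. ennreal (norm (of_real (1 + log_plus (norm x)) * f x) powr 1) \<partial>gaussian)"
        unfolding W_def using lp by (intro nn_integral_cong) (simp add: norm_mult add_nonneg_nonneg del: of_real_add)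
      finally show "(\<integral>\<^sup>+x. ennreal (norm (pi3 \<Phi> \<delta> \<delta>' \<kappa> f x) powr 1) \<partial>gaussian)
        \<le> ennreal (C powr 1) * (\<integral>\<^sup>+x. ennreal (norm (of_real (1 + log_plus (norm x)) * f x) powr 1) \<partial>gaussian)" .
    qed (use C in auto)
  qed
qed

text \<open>The tail is dominated by a rank one kernel D e^{\<beta>|x|^2} e^{\<beta>|y|^2}, because
  the mean zero bound separates x from y. Added to the local kernel it gives a single positive
  kernel, to which Schur's test applies with weight e^{\<beta>|.|^2}.\<close>

lemma pi3_Lp_bound:
  assumes a: "0 < \<delta>' + \<delta>" "\<delta>' + \<delta> \<le> 2" and \<kappa>: "4 \<le> \<kappa>" and p: "1 < p"
    and growth: "\<And>t. 1 \<le> t \<Longrightarrow> norm (\<Phi>' t) + t * norm (\<Phi>'' t) \<le> C\<^sub>0 * t powi N"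
  shows "\<exists>C\<ge>0. \<forall>f :: real ^ 'n \<Rightarrow> complex. mean_zero_polynomial f \<longrightarrow>
    gaussian_Lp p (pi3 \<Phi> \<delta> \<delta>' \<kappa> f) \<le> ennreal C * gaussian_Lp p f"
proof -
  define a where "a = \<delta>' + \<delta>"
  note a' = a and a = a[folded a_def]
  define q where "q = p / (p - 1)"
  \<comment> \<open>Then the weight to the power q is e^{|.|^2/p} and to the power p is e^{|.|^2/q},
    so both Schur conditions involve exponents strictly between 0 and 1. Moreover \<beta> + 1/p and
    \<beta> + 1/q stay below 1, which makes the rank one part finite.\<close>
  define \<beta> where "\<beta> = 1 / (p * q)"
  have q: "1 < q" "1 / p + 1 / q = 1" using p by (auto simp: q_def field_simps)
  have \<beta>: "0 < \<beta>" "\<beta> < 1" "\<beta> \<le> 1 / p" "\<beta> \<le> 1 / q" "\<beta> * q = 1 / p" "\<beta> * p = 1 / q"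
  proof -
    have "1 * 1 < p * q" using p q by (intro mult_strict_mono) auto
    then show "0 < \<beta>" "\<beta> < 1" by (auto simp: \<beta>_def)
    show "\<beta> * q = 1 / p" "\<beta> * p = 1 / q" using p q by (auto simp: \<beta>_def)
    have "1 / p * (1 / q) \<le> 1 / p * 1" using p q by (intro mult_left_mono) auto
    moreover have "1 / p * (1 / q) \<le> 1 * (1 / q)" using p q by (intro mult_right_mono) auto
    ultimately show "\<beta> \<le> 1 / p" "\<beta> \<le> 1 / q" by (simp_all add: \<beta>_def)
  qed
  have \<beta>p: "\<beta> + 1 / p < 1" and \<beta>q: "\<beta> + 1 / q < 1"
  proof -
    have "\<beta> = 1 / p * (1 / q)" by (simp add: \<beta>_def)
    moreover have "1 / p * (1 / q) < 1 * (1 / q)" using p q by (intro mult_strict_right_mono) auto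
    moreover have "1 / p * (1 / q) < 1 / p * 1" using p q by (intro mult_strict_left_mono) auto
    ultimately show "\<beta> + 1 / p < 1" "\<beta> + 1 / q < 1" using q by linarith+
  qed
  \<comment> \<open>The large time bound has weights with exponent 6\<epsilon>, which is thus the
    Schur exponent \<beta>.\<close>
  define \<epsilon> where "\<epsilon> = \<beta> / 6"
  have \<epsilon>: "0 < \<epsilon>" "\<epsilon> < 1 / 6" using \<beta> by (auto simp: \<epsilon>_def)
  \<comment> \<open>Beyond T the time s = at^2 is at least 1, for the growth hypothesis, and e^{-s}
    \<le> \<epsilon>, for the large time bound.\<close>
  define T where "T = max 1 (max (1 / a) (ln (1 / \<epsilon>) / a))"
  have T: "1 \<le> T" "1 / a \<le> T" "ln (1 / \<epsilon>) / a \<le> T" by (auto simp: T_def)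
  have aT: "1 \<le> a * t\<^sup>2" "exp (- (a * t\<^sup>2)) \<le> \<epsilon>" if "T \<le> t" for t
  proof -
    have "a * T \<le> a * t" using that a by (intro mult_left_mono) auto
    also have "\<dots> \<le> a * (t * t)" using T a that by (intro mult_left_mono mult_right_mono[of 1 t t, simplified]) auto
    finally have "a * T \<le> a * t\<^sup>2" by (simp add: power2_eq_square)
    moreover have "1 \<le> a * T" "ln (1 / \<epsilon>) \<le> a * T" using T(2,3) a by (auto simp: field_simps)
    ultimately have "1 \<le> a * t\<^sup>2" "ln (1 / \<epsilon>) \<le> a * t\<^sup>2" by linarith+
    then show "1 \<le> a * t\<^sup>2" by simp
    have "exp (- (a * t\<^sup>2)) \<le> exp (- ln (1 / \<epsilon>))" using \<open>ln (1 / \<epsilon>) \<le> a * t\<^sup>2\<close> by simp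
    also have "\<dots> = \<epsilon>" using \<epsilon> by (simp add: ln_div)
    finally show "exp (- (a * t\<^sup>2)) \<le> \<epsilon>" .
  qed
  have T2: "1 / 2 \<le> T" and T0: "0 < T" and \<kappa>0: "0 < \<kappa>" using T \<kappa> by auto
  define h where "h = (\<lambda>t. t / a * norm (remainder (a * t\<^sup>2)))"
  have h0: "0 \<le> h t" if "T \<le> t" for t using a T that by (simp add: h_def)
  define J0 where "J0 = (\<integral>\<^sup>+t. indicator {T..} t * ennreal (h t * exp (- (a * t\<^sup>2))) \<partial>lborel)"
  have J0: "J0 < \<infinity>"
  proof -
    define m where "m = nat \<bar>N\<bar>"
    \<comment> \<open>The exponential absorbs s^{m+2} at the cost of (m+2)!; the two extra powers of
      s turn the factor t into t^{-3}, which is integrable. N may be negative, hence m is its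
      absolute value.\<close>
    define c where "c = 2 * \<bar>C\<^sub>0\<bar> * fact (m + 2) / a ^ 3"
    have c: "0 \<le> c" using a by (simp add: c_def)
    have "J0 \<le> (\<integral>\<^sup>+t. ennreal c * (ennreal (1 / t ^ 3) * indicator {T..} t) \<partial>lborel)"
      unfolding J0_def
    proof (intro nn_integral_mono)
      fix t
      show "indicator {T..} t * ennreal (h t * exp (- (a * t\<^sup>2))) \<le> ennreal c * (ennreal (1 / t ^ 3) * indicator {T..} t)"
      proof (cases "T \<le> t")
        case True
        define s where "s = a * t\<^sup>2"
        have t: "0 < t" using True T by simp
        have s: "1 \<le> s" unfolding s_def by (rule aT[OF True])
        have "s powi N \<le> s ^ m"
        proof -
          have "s powi N \<le> s powi \<bar>N\<bar>" using s by (intro power_int_increasing) auto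
          then show ?thesis by (simp add: m_def power_int_def)
        qed
        then have "C\<^sub>0 * s powi N \<le> \<bar>C\<^sub>0\<bar> * s ^ m" using s by (intro mult_mono) auto
        then have "norm (\<Phi>' s) + s * norm (\<Phi>'' s) \<le> \<bar>C\<^sub>0\<bar> * s ^ m"
          by (rule order_trans[OF growth[OF s]])
        then have "norm (remainder s) \<le> 2 * (\<bar>C\<^sub>0\<bar> * s ^ m)"
          by (intro order_trans[OF norm_remainder_le[OF less_le_trans[OF zero_less_one s]]] mult_left_mono) auto
        then have "h t * exp (- s) \<le> t / a * (2 * (\<bar>C\<^sub>0\<bar> * s ^ m)) * exp (- s)"
          unfolding h_def s_def[symmetric] using a t by (intro mult_right_mono mult_left_mono) auto
        also have "\<dots> = t / a * (2 * \<bar>C\<^sub>0\<bar>) / s\<^sup>2 * (s ^ (m + 2) * exp (- s))"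
          using s by (simp add: power_add power2_eq_square)
        also have "\<dots> \<le> t / a * (2 * \<bar>C\<^sub>0\<bar>) / s\<^sup>2 * fact (m + 2)"
          using s a t by (intro mult_left_mono power_times_exp_le) auto
        also have "\<dots> = c * (1 / t ^ 3)"
          using a t by (simp add: c_def s_def field_simps power2_eq_square power3_eq_cube)
        finally have "ennreal (h t * exp (- s)) \<le> ennreal c * ennreal (1 / t ^ 3)"
          using c t by (subst ennreal_mult[symmetric]) (auto intro!: ennreal_leI)
        then show ?thesis using True by (simp add: s_def)
      qed simp
    qed
    also have "\<dots> < \<infinity>"
      by (subst nn_integral_cmult) (auto simp: nn_integral_inverse_cube[OF T0] ennreal_mult_less_top)
    finally show ?thesis .
  qed
  then obtain j where j: "0 \<le> j" "J0 = ennreal j" by (cases J0) auto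
  obtain C0 where C0: "0 < C0" "\<And>(f :: real ^ 'n \<Rightarrow> complex) x. mean_zero_polynomial f \<Longrightarrow>
    ennreal (norm (pi3 \<Phi> \<delta> \<delta>' \<kappa> f x)) \<le> ennreal C0 * (\<integral>\<^sup>+y. local_kernel a \<kappa> T x y * ennreal (norm (f y)) \<partial>gaussian)
      + (\<integral>\<^sup>+t. indicator {T..} t * ennreal (h t) * ennreal (norm (OU_semigroup (a * t\<^sup>2) f x)) \<partial>lborel)"
    using pi3_pointwise_bound[OF a' \<kappa> T2 J0[unfolded J0_def h_def a_def]] unfolding a_def[symmetric] h_def by blast
  define D where "D = exp (\<epsilon> * real CARD('n)) / \<epsilon> * j"
  have D: "0 \<le> D" using \<epsilon> j by (simp add: D_def)
  define e where "e = (\<lambda>\<alpha> (x :: real ^ 'n). exp (\<alpha> * (norm x)\<^sup>2))"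
  have e: "0 < e \<alpha> x" for \<alpha> x by (simp add: e_def)
  have e_mono: "e \<alpha> x \<le> e \<alpha>' x" if "\<alpha> \<le> \<alpha>'" for \<alpha> \<alpha>' x using that by (simp add: e_def mult_right_mono)
  have e_add: "e \<alpha> x * e \<alpha>' x = e (\<alpha> + \<alpha>') x" for \<alpha> \<alpha>' x by (simp add: e_def distrib_right exp_add)
  have e_powr: "e \<alpha> x powr r = e (\<alpha> * r) x" for \<alpha> x r by (simp add: e_def powr_def)
  have [measurable]: "e \<alpha> \<in> borel_measurable borel" for \<alpha> unfolding e_def by measurable
  define K where "K = (\<lambda>x y :: real ^ 'n. ennreal C0 * local_kernel a \<kappa> T x y + ennreal (D * e \<beta> x) * ennreal (e \<beta> y))"
  have Kf: "(\<integral>\<^sup>+y. K x y * g y \<partial>gaussian) = ennreal C0 * (\<integral>\<^sup>+y. local_kernel a \<kappa> T x y * g y \<partial>gaussian)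
      + ennreal (D * e \<beta> x) * (\<integral>\<^sup>+y. ennreal (e \<beta> y) * g y \<partial>gaussian)"
    if [measurable]: "g \<in> borel_measurable borel" for g and x :: "real ^ 'n"
  proof -
    have "(\<integral>\<^sup>+y. K x y * g y \<partial>gaussian) = (\<integral>\<^sup>+y. ennreal C0 * (local_kernel a \<kappa> T x y * g y) + ennreal (D * e \<beta> x) * (ennreal (e \<beta> y) * g y) \<partial>gaussian)"
      by (simp add: K_def distrib_right mult.assoc)
    then show ?thesis by (simp add: nn_integral_add nn_integral_cmult)
  qed
  have Kc: "(\<integral>\<^sup>+x. K x y * g x \<partial>gaussian) = ennreal C0 * (\<integral>\<^sup>+x. local_kernel a \<kappa> T x y * g x \<partial>gaussian)
      + ennreal (D * e \<beta> y) * (\<integral>\<^sup>+x. ennreal (e \<beta> x) * g x \<partial>gaussian)"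
    if [measurable]: "g \<in> borel_measurable borel" for g and y :: "real ^ 'n"
  proof -
    have "(\<integral>\<^sup>+x. K x y * g x \<partial>gaussian) = (\<integral>\<^sup>+x. ennreal C0 * (local_kernel a \<kappa> T x y * g x) + ennreal (D * e \<beta> y) * (ennreal (e \<beta> x) * g x) \<partial>gaussian)"
      using D e by (intro nn_integral_cong) (simp add: K_def distrib_right distrib_left mult_ac ennreal_mult less_imp_le)
    then show ?thesis by (simp add: nn_integral_add nn_integral_cmult)
  qed
  obtain E1 where E1: "0 \<le> E1" "(\<integral>\<^sup>+y. ennreal (e (\<beta> + 1 / p) y) \<partial>gaussian) = ennreal E1"
    using nn_integral_exp_gaussian_finite[OF \<beta>p] unfolding e_def by blast
  obtain E2 where E2: "0 \<le> E2" "(\<integral>\<^sup>+y. ennreal (e (\<beta> + 1 / q) y) \<partial>gaussian) = ennreal E2"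
    using nn_integral_exp_gaussian_finite[OF \<beta>q] unfolding e_def by blast
  have ip: "0 < 1 / p" "1 / p < 1" "0 < 1 / q" "1 / q < 1" using p q by auto
  obtain R1 where R1: "0 < R1" "\<And>x :: real ^ 'n.
    (\<integral>\<^sup>+y. local_kernel a \<kappa> T x y * ennreal (e (1 / p) y) \<partial>gaussian) \<le> ennreal (R1 * e (1 / p) x)"
    using local_kernel_row_exp[OF ip(1,2) a(1) \<kappa>0 T0] unfolding e_def by blast
  obtain R2 where R2: "0 < R2" "\<And>y :: real ^ 'n.
    (\<integral>\<^sup>+x. local_kernel a \<kappa> T x y * ennreal (e (1 / q) x) \<partial>gaussian) \<le> ennreal (R2 * e (1 / q) y)"
    using local_kernel_column_exp[OF ip(3,4) a(1) \<kappa>0 T0] unfolding e_def by blast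
  define A where "A = C0 * R1 + D * E1"
  define B where "B = C0 * R2 + D * E2"
  have AB: "0 < A" "0 < B" using C0 R1 R2 D E1 E2 by (auto simp: A_def B_def add_pos_nonneg)
  \<comment> \<open>As \<beta> \<le> \<alpha>, the factor e^{\<beta>|x|^2} of the rank one part may
    be enlarged to the weight e^{\<alpha>|x|^2} of the local part.\<close>
  have comb: "ennreal C0 * X + ennreal (D * e \<beta> x) * Y \<le> ennreal ((C0 * r + D * E) * e \<alpha> x)"
    if "X \<le> ennreal (r * e \<alpha> x)" "Y = ennreal E" "\<beta> \<le> \<alpha>" "0 \<le> r" "0 \<le> E" for X Y r E \<alpha> x
  proof -
    have "ennreal C0 * X + ennreal (D * e \<beta> x) * Y \<le> ennreal C0 * ennreal (r * e \<alpha> x) + ennreal (D * e \<alpha> x) * ennreal E"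
      unfolding that(2) using that D by (intro add_mono mult_left_mono mult_right_mono ennreal_leI e_mono) auto
    also have "\<dots> = ennreal (C0 * (r * e \<alpha> x) + D * e \<alpha> x * E)"
      using C0 that D e[of \<alpha> x] by (subst ennreal_plus) (auto simp: ennreal_mult[symmetric])
    also have "C0 * (r * e \<alpha> x) + D * e \<alpha> x * E = (C0 * r + D * E) * e \<alpha> x" by (simp add: algebra_simps)
    finally show ?thesis .
  qed
  have row: "(\<integral>\<^sup>+y. K x y * ennreal (e \<beta> y powr q) \<partial>gaussian) \<le> ennreal (A * e \<beta> x powr q)" for x
  proof -
    have "(\<integral>\<^sup>+y. ennreal (e \<beta> y) * ennreal (e (1 / p) y) \<partial>gaussian) = ennreal E1"
      using e by (simp add: ennreal_mult[symmetric] less_imp_le e_add E1)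
    then show ?thesis
      unfolding e_powr \<beta>(5) A_def using R1 E1 \<beta> by (subst Kf) (auto intro!: comb)
  qed
  have col: "(\<integral>\<^sup>+x. K x y * ennreal (e \<beta> x powr p) \<partial>gaussian) \<le> ennreal (B * e \<beta> y powr p)" for y
  proof -
    have "(\<integral>\<^sup>+y. ennreal (e \<beta> y) * ennreal (e (1 / q) y) \<partial>gaussian) = ennreal E2"
      using e by (simp add: ennreal_mult[symmetric] less_imp_le e_add E2)
    then show ?thesis
      unfolding e_powr \<beta>(6) B_def using R2 E2 \<beta> by (subst Kc) (auto intro!: comb)
  qed
  define C where "C = (A powr (p - 1) * B) powr (1 / p)"
  have C: "0 < C" "C powr p = A powr (p - 1) * B" using AB p by (auto simp: C_def powr_powr)
  show ?thesis
  proof (intro exI[of _ C] conjI allI impI)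
    show "0 \<le> C" using C by simp
    fix f :: "real ^ 'n \<Rightarrow> complex" assume f: "mean_zero_polynomial f"
    have pf: "poly_fn f" "(LINT y|gaussian. f y) = 0"
      using f by (auto simp: mean_zero_polynomial_def intro: poly_fn_of_polynomial_function)
    note [measurable] = poly_fn_measurable[OF pf(1)]
    define L where "L = (LINT y|gaussian. e \<beta> y * norm (f y))"
    have L: "0 \<le> L" using e by (auto simp: L_def less_imp_le)
    have iL: "integrable gaussian (\<lambda>y. e \<beta> y * norm (f y))"
      using integrable_norm[OF integrable_gaussian_exp_poly[OF pf(1) \<beta>(2)]] by (simp add: e_def norm_mult)
    have Ln: "ennreal L = (\<integral>\<^sup>+y. ennreal (e \<beta> y) * ennreal (norm (f y)) \<partial>gaussian)"
      unfolding L_def using e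
      by (subst nn_integral_eq_integral[OF iL, symmetric]) (auto simp: ennreal_mult[symmetric] less_imp_le)
    have dom: "ennreal (norm (pi3 \<Phi> \<delta> \<delta>' \<kappa> f x)) \<le> (\<integral>\<^sup>+y. K x y * ennreal (norm (f y)) \<partial>gaussian)" for x
    proof -
      define c where "c = exp (\<epsilon> * real CARD('n)) / \<epsilon> * (e \<beta> x * L)"
      have c: "0 \<le> c" using \<epsilon> L e[of \<beta> x] by (simp add: c_def)
      have "(\<integral>\<^sup>+t. indicator {T..} t * ennreal (h t) * ennreal (norm (OU_semigroup (a * t\<^sup>2) f x)) \<partial>lborel)
        \<le> (\<integral>\<^sup>+t. ennreal c * (indicator {T..} t * ennreal (h t * exp (- (a * t\<^sup>2)))) \<partial>lborel)"
      proof (intro nn_integral_mono)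
        fix t
        show "indicator {T..} t * ennreal (h t) * ennreal (norm (OU_semigroup (a * t\<^sup>2) f x))
          \<le> ennreal c * (indicator {T..} t * ennreal (h t * exp (- (a * t\<^sup>2))))"
        proof (cases "T \<le> t")
          case True
          have "norm (OU_semigroup (a * t\<^sup>2) f x) \<le> exp (- (a * t\<^sup>2)) * c"
            using OU_semigroup_mean_zero_bound[OF pf \<epsilon> aT(2)[OF True], of x]
            by (simp add: c_def L_def e_def \<epsilon>_def mult.assoc)
          from mult_left_mono[OF this h0[OF True]]
          have "h t * norm (OU_semigroup (a * t\<^sup>2) f x) \<le> c * (h t * exp (- (a * t\<^sup>2)))"
            by (simp add: mult_ac)
          then have "ennreal (h t) * ennreal (norm (OU_semigroup (a * t\<^sup>2) f x)) \<le> ennreal c * ennreal (h t * exp (- (a * t\<^sup>2)))"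
            using c h0[OF True] by (simp add: ennreal_mult[symmetric] ennreal_leI)
          then show ?thesis using True by simp
        qed simp
      qed
      also have "\<dots> = ennreal c * J0"
        unfolding J0_def
      proof (rule nn_integral_cmult)
        have "(\<lambda>t. indicator {T..} t * ennreal (h t * exp (- (a * t\<^sup>2))))
          = (\<lambda>t. (indicator {T..} t * ennreal (h t)) * ennreal (exp (- (a * t\<^sup>2))))"
          using h0 by (auto simp: fun_eq_iff ennreal_mult split: split_indicator)
        also have "\<dots> \<in> borel_measurable lborel"
          using remainder_weight_measurable[OF a(1) T0] unfolding h_def by measurable
        finally show "(\<lambda>t. indicator {T..} t * ennreal (h t * exp (- (a * t\<^sup>2)))) \<in> borel_measurable lborel" .
      qed
      also have "\<dots> = ennreal (D * e \<beta> x) * ennreal L"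
      proof -
        have "c * j = D * e \<beta> x * L" by (simp add: c_def D_def)
        moreover have "0 \<le> D * e \<beta> x" using D e[of \<beta> x] by simp
        ultimately show ?thesis
          unfolding j(2) using ennreal_mult[OF c j(1)] ennreal_mult[OF _ L, of "D * e \<beta> x"] by simp
      qed
      finally show ?thesis
        using C0(2)[OF f, of x] unfolding Ln by (subst Kf) (auto intro: order_trans add_left_mono)
    qed
    show "gaussian_Lp p (pi3 \<Phi> \<delta> \<delta>' \<kappa> f) \<le> ennreal C * gaussian_Lp p f"
    proof (rule gaussian_Lp_le)
      show "pi3 \<Phi> \<delta> \<delta>' \<kappa> f \<in> borel_measurable borel" by (rule pi3_measurable[OF a'(1) \<kappa>0 f])
      show "(\<integral>\<^sup>+x. ennreal (norm (pi3 \<Phi> \<delta> \<delta>' \<kappa> f x) powr p) \<partial>gaussian)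
        \<le> ennreal (C powr p) * (\<integral>\<^sup>+x. ennreal (norm (f x) powr p) \<partial>gaussian)"
        unfolding C(2)
      proof (rule schur_test[where K = K and h = "e \<beta>" and q = q])
        show "sigma_finite_measure (gaussian :: (real ^ 'n) measure)" by unfold_locales
        show "case_prod K \<in> borel_measurable (gaussian \<Otimes>\<^sub>M gaussian)" unfolding K_def by measurable
      qed (use p q e AB row col dom in auto)
    qed (use C p in auto)
  qed
qed

end

theorem proposition5:
  fixes \<Phi> \<Phi>' \<Phi>'' :: "real \<Rightarrow> complex"
  assumes "\<And>t. t > 0 \<Longrightarrow> (\<Phi> has_vector_derivative \<Phi>' t) (at t)"
    and "\<And>t. t > 0 \<Longrightarrow> (\<Phi>' has_vector_derivative \<Phi>'' t) (at t)"
    and "continuous_on {0<..} \<Phi>''"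
    and "bdd_above ((\<lambda>t. norm (\<Phi> t) + t * norm (\<Phi>' t)) ` {0<..})"
    and "bdd_above ((\<lambda>t. norm (of_real (t\<^sup>2) * \<Phi>'' t)) ` {0<..1})"
  shows "\<exists>\<delta>\<^sub>0>0. \<forall>\<delta> \<delta>'. 0 < \<delta> \<and> \<delta> \<le> \<delta>\<^sub>0 \<and> 0 < \<delta>' \<and> \<delta>' \<le> \<delta>\<^sub>0 \<longrightarrow>
    (\<exists>\<kappa>\<^sub>0\<ge>1. \<forall>\<kappa>\<ge>\<kappa>\<^sub>0.
      (set_integrable lborel {1..} (\<lambda>t. norm (\<Phi>' t) + t * norm (\<Phi>'' t)) \<longrightarrow>
        (\<exists>C\<ge>0. \<forall>f :: real ^ 'n \<Rightarrow> complex. mean_zero_polynomial f \<longrightarrow>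
          gaussian_Lp 1 (pi3 \<Phi> \<delta> \<delta>' \<kappa> f)
            \<le> ennreal C * gaussian_Lp 1 (\<lambda>x. of_real (1 + log_plus (norm x)) * f x)))
      \<and>
      ((\<exists>N::int. \<exists>C\<^sub>0::real. \<forall>t\<ge>1. norm (\<Phi>' t) + t * norm (\<Phi>'' t) \<le> C\<^sub>0 * t powi N) \<longrightarrow>
        (\<forall>p. 1 < p \<and> p \<le> 2 \<longrightarrow>
          (\<exists>C\<ge>0. \<forall>f :: real ^ 'n \<Rightarrow> complex. mean_zero_polynomial f \<longrightarrow>
            gaussian_Lp p (pi3 \<Phi> \<delta> \<delta>' \<kappa> f) \<le> ennreal C * gaussian_Lp p f))))"
proof -
  interpret multiplier \<Phi> \<Phi>' \<Phi>'' by unfold_locales (fact assms)+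
  show ?thesis
  \<comment> \<open>With \<delta>, \<delta>' \<le> 1 the sum a is at most 2, as the Harnack
    inequality at s_0 requires.\<close>
  proof (rule exI[of _ 1], intro conjI allI impI)
    fix \<delta> \<delta>' :: real assume "0 < \<delta> \<and> \<delta> \<le> 1 \<and> 0 < \<delta>' \<and> \<delta>' \<le> 1"
    then have a: "0 < \<delta>' + \<delta>" "\<delta>' + \<delta> \<le> 2" by auto
    show "\<exists>\<kappa>\<^sub>0\<ge>1. \<forall>\<kappa>\<ge>\<kappa>\<^sub>0.
      (set_integrable lborel {1..} (\<lambda>t. norm (\<Phi>' t) + t * norm (\<Phi>'' t)) \<longrightarrow>
        (\<exists>C\<ge>0. \<forall>f :: real ^ 'n \<Rightarrow> complex. mean_zero_polynomial f \<longrightarrow>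
          gaussian_Lp 1 (pi3 \<Phi> \<delta> \<delta>' \<kappa> f)
            \<le> ennreal C * gaussian_Lp 1 (\<lambda>x. of_real (1 + log_plus (norm x)) * f x)))
      \<and>
      ((\<exists>N::int. \<exists>C\<^sub>0::real. \<forall>t\<ge>1. norm (\<Phi>' t) + t * norm (\<Phi>'' t) \<le> C\<^sub>0 * t powi N) \<longrightarrow>
        (\<forall>p. 1 < p \<and> p \<le> 2 \<longrightarrow>
          (\<exists>C\<ge>0. \<forall>f :: real ^ 'n \<Rightarrow> complex. mean_zero_polynomial f \<longrightarrow>
            gaussian_Lp p (pi3 \<Phi> \<delta> \<delta>' \<kappa> f) \<le> ennreal C * gaussian_Lp p f)))"
    \<comment> \<open>With \<kappa> \<ge> 4 the lower limit is at most 1/4, so that s_0 and s_0|x|^2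
      are at most 2/16 = 1/8.\<close>
    proof (rule exI[of _ 4], intro conjI allI impI)
      fix \<kappa> :: real assume \<kappa>: "4 \<le> \<kappa>"
      show "\<exists>C\<ge>0. \<forall>f :: real ^ 'n \<Rightarrow> complex. mean_zero_polynomial f \<longrightarrow>
          gaussian_Lp 1 (pi3 \<Phi> \<delta> \<delta>' \<kappa> f)
            \<le> ennreal C * gaussian_Lp 1 (\<lambda>x. of_real (1 + log_plus (norm x)) * f x)"
        if "set_integrable lborel {1..} (\<lambda>t. norm (\<Phi>' t) + t * norm (\<Phi>'' t))"
        by (rule pi3_weighted_L1_bound[OF a \<kappa> that])
      fix p :: real
      assume "\<exists>N::int. \<exists>C\<^sub>0::real. \<forall>t\<ge>1. norm (\<Phi>' t) + t * norm (\<Phi>'' t) \<le> C\<^sub>0 * t powi N" and p: "1 < p \<and> p \<le> 2"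
      then obtain N C\<^sub>0 where N: "\<And>t. 1 \<le> t \<Longrightarrow> norm (\<Phi>' t) + t * norm (\<Phi>'' t) \<le> C\<^sub>0 * t powi N"
        by blast
      show "\<exists>C\<ge>0. \<forall>f :: real ^ 'n \<Rightarrow> complex. mean_zero_polynomial f \<longrightarrow>
            gaussian_Lp p (pi3 \<Phi> \<delta> \<delta>' \<kappa> f) \<le> ennreal C * gaussian_Lp p f"
        by (rule pi3_Lp_bound[OF a \<kappa> conjunct1[OF p] N])
    qed simp
  qed simp
qed

end
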